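(* Let $A$ be a finite involutively closed alphabet and let $\Gamma^{(1)},\ldots,\Gamma^{(k)}$ be complete context-free $A$-graphs. Then the transition group $\mathcal{G}(\Gamma^{(1)}\sqcup\cdots\sqcup\Gamma^{(k)})$ is rational, i.e. it embeds into the rational group $\mathcal{R}$.
   Context: Let $A$ be a finite alphabet closed under a formal inversion $a\mapsto a^{-1}$ ($a^{-1}\ne a$, $(a^{-1})^{-1}=a$), $A^*$ the free monoid on $A$, and $F_A$ the free group whose elements are the reduced words over $A$. An $A$-graph is a connected directed graph $\Gamma$ with vertex set $V(\Gamma)$, edges labeled by letters of $A$, and a fixed-point-free involution $e\mapsto e^{-1}$ on edges which exchanges initial and terminal vertices and inverts labels, and which is deterministic: for each vertex $v$ and each $a\in A$ there is at most one edge labeled $a$ starting at $v$. It is complete if for each $v$ and $a$ there is at least one such edge. $L(\Gamma,x)\subseteq A^*$ is the set of labels of circuits at the vertex $x$ (walks from $x$ to $x$). $\Gamma$ is context-free if $L(\Gamma,x_0)$ is a context-free language for some (equivalently, every) vertex $x_0$. For complete $A$-graphs $\Gamma^{(1)},\ldots,\Gamma^{(k)}$ the transition group $\mathcal{G}(\Gamma^{(1)}\sqcup\cdots\sqcup\Gamma^{(k)})$ is the quotient of $F_A$ by the normal subgroup defined by $\bigcap_{i}\bigcap_{p\in V(\Gamma^{(i)})}L(\Gamma^{(i)},p)$; equivalently, it is the group of permutations of the disjoint union of the sets $V(\Gamma^{(i)})$ generated by the permutations induced by the letters of $A$. A sequential transducer over a finite alphabet $\Sigma$ is a tuple $(Q,q_0,\Sigma,\delta,o)$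 with $Q$ a finite set of states, $q_0\in Q$ the initial state, $\delta:Q\times\Sigma\to Q$ the transition function and $o:Q\times\Sigma\to\Sigma^*$ the output function; $o$ is extended to finite and infinite words by $o(q,\sigma w)=o(q,\sigma)\,o(\delta(q,\sigma),w)$. A homeomorphism $\varphi$ of the Cantor space $\Sigma^\omega$ (infinite words, $|\Sigma|\ge2$, product topology) is rational if there is a sequential transducer with $\varphi(\eta)=o(q_0,\eta)$ for all $\eta\in\Sigma^\omega$. The rational homeomorphisms of $\Sigma^\omega$ form a group $\mathcal{R}_\Sigma$, whose isomorphism type does not depend on $\Sigma$; it is denoted $\mathcal{R}$ and called the rational group. A group is called rational if it embeds in a rational group. *)

theory Defs
  imports
    "HOL-Algebra.Bij"
    "HOL-Algebra.Coset"
    "HOL-Analysis.Function_Topology"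
    "Graph_Theory.Bidirected_Digraph"
    "Graph_Theory.Digraph_Component"
begin

section \<open>Involutive alphabets and free groups\<close>

locale involutive_alphabet =
  fixes A :: "'a set" and ainv :: "'a \<Rightarrow> 'a"
  assumes finite_alphabet: "finite A"
    and ainv_closed: "a \<in> A \<Longrightarrow> ainv a \<in> A"
    and ainv_neq: "a \<in> A \<Longrightarrow> ainv a \<noteq> a"
    and ainv_ainv: "a \<in> A \<Longrightarrow> ainv (ainv a) = a"

definition reduced :: "('a \<Rightarrow> 'a) \<Rightarrow> 'a list \<Rightarrow> bool" where
  "reduced ainv w \<longleftrightarrow> successively (\<lambda>a b. b \<noteq> ainv a) w"

fun push_letter :: "('a \<Rightarrow> 'a) \<Rightarrow> 'a \<Rightarrow> 'a list \<Rightarrow> 'a list" where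
  "push_letter ainv a [] = [a]"
| "push_letter ainv a (b # w) = (if b = ainv a then w else a # b # w)"

definition reduce :: "('a \<Rightarrow> 'a) \<Rightarrow> 'a list \<Rightarrow> 'a list" where
  "reduce ainv w = foldr (push_letter ainv) w []"

text \<open>The generators in \<open>A\<close> come in inverse pairs, so the rank is half the size of \<open>A\<close>.\<close>

definition free_group :: "'a set \<Rightarrow> ('a \<Rightarrow> 'a) \<Rightarrow> 'a list monoid" where
  "free_group A ainv =
     \<lparr>carrier = {w \<in> lists A. reduced ainv w},
      monoid.mult = (\<lambda>u v. reduce ainv (u @ v)),
      one = []\<rparr>"


section \<open>Context-free languages\<close>

datatype ('n, 't) symbol = Nonterminal 'n | Terminal 't

inductive derives_step ::
    "('n \<times> ('n, 't) symbol list) set \<Rightarrow> ('n, 't) symbol list \<Rightarrow> ('n, 't) symbol list \<Rightarrow> bool"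
  for P where
  "(X, r) \<in> P \<Longrightarrow> derives_step P (u @ [Nonterminal X] @ v) (u @ r @ v)"

definition grammar_language :: "('n \<times> ('n, 't) symbol list) set \<Rightarrow> 'n \<Rightarrow> 't list set" where
  "grammar_language P S = {w. (derives_step P)\<^sup>*\<^sup>* [Nonterminal S] (map Terminal w)}"

text \<open>A finite set of productions mentions only finitely many nonterminals, so taking
  them from \<^typ>\<open>nat\<close> is no restriction.\<close>

definition context_free_language :: "'t list set \<Rightarrow> bool" where
  "context_free_language L \<longleftrightarrow>
     (\<exists>(P :: (nat \<times> (nat, 't) symbol list) set) S. finite P \<and> L = grammar_language P S)"


section \<open>Labelled graphs over an involutive alphabet\<close>

record ('v, 'e, 'a) labelled_graph =
  skeleton :: "('v, 'e) pre_digraph"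
  edge_inv :: "'e \<Rightarrow> 'e"
  label :: "'e \<Rightarrow> 'a"

text \<open>The locale \<^locale>\<open>bidirected_digraph\<close> says that \<open>edge_inv \<Gamma>\<close> is a fixed-point-free
  involution of the arcs that exchanges their ends (and, as a normalisation, the identity
  outside the arcs).\<close>

locale A_graph = involutive_alphabet A ainv +
    bidirected_digraph "skeleton \<Gamma>" "edge_inv \<Gamma>"
  for A :: "'a set" and ainv :: "'a \<Rightarrow> 'a" and \<Gamma> :: "('v, 'e, 'a) labelled_graph" +
  assumes connected_skeleton: "Digraph_Component.connected (skeleton \<Gamma>)"
    and label_in: "e \<in> arcs (skeleton \<Gamma>) \<Longrightarrow> label \<Gamma> e \<in> A"
    and label_edge_inv:
      "e \<in> arcs (skeleton \<Gamma>) \<Longrightarrow> label \<Gamma> (edge_inv \<Gamma> e) = ainv (label \<Gamma> e)"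
    and deterministic:
      "\<lbrakk>e \<in> arcs (skeleton \<Gamma>); e' \<in> arcs (skeleton \<Gamma>);
        tail (skeleton \<Gamma>) e = tail (skeleton \<Gamma>) e'; label \<Gamma> e = label \<Gamma> e'\<rbrakk> \<Longrightarrow> e = e'"

locale complete_A_graph = A_graph A ainv \<Gamma>
  for A :: "'a set" and ainv :: "'a \<Rightarrow> 'a" and \<Gamma> :: "('v, 'e, 'a) labelled_graph" +
  assumes complete:
    "\<lbrakk>v \<in> verts (skeleton \<Gamma>); a \<in> A\<rbrakk> \<Longrightarrow>
       \<exists>e \<in> arcs (skeleton \<Gamma>). tail (skeleton \<Gamma>) e = v \<and> label \<Gamma> e = a"

definition circuit_language :: "('v, 'e, 'a) labelled_graph \<Rightarrow> 'v \<Rightarrow> 'a list set" where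
  "circuit_language \<Gamma> x = {map (label \<Gamma>) p | p. pre_digraph.awalk (skeleton \<Gamma>) x p x}"

definition context_free_graph :: "('v, 'e, 'a) labelled_graph \<Rightarrow> bool" where
  "context_free_graph \<Gamma> \<longleftrightarrow>
     (\<exists>x0 \<in> verts (skeleton \<Gamma>). context_free_language (circuit_language \<Gamma> x0))"


section \<open>Transition groups\<close>

text \<open>The image in the free group of the words that label a circuit at every vertex of
  every \<open>\<Gamma> i\<close>, \<open>i \<in> I\<close>.\<close>

definition circuit_subgroup ::
    "'a set \<Rightarrow> ('a \<Rightarrow> 'a) \<Rightarrow> 'i set \<Rightarrow> ('i \<Rightarrow> ('v, 'e, 'a) labelled_graph) \<Rightarrow> 'a list set" where
  "circuit_subgroup A ainv I \<Gamma> =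
     reduce ainv `
       {w \<in> lists A. \<forall>i \<in> I. \<forall>p \<in> verts (skeleton (\<Gamma> i)). w \<in> circuit_language (\<Gamma> i) p}"

definition transition_group ::
    "'a set \<Rightarrow> ('a \<Rightarrow> 'a) \<Rightarrow> 'i set \<Rightarrow> ('i \<Rightarrow> ('v, 'e, 'a) labelled_graph) \<Rightarrow> 'a list set monoid" where
  "transition_group A ainv I \<Gamma> = free_group A ainv Mod circuit_subgroup A ainv I \<Gamma>"


section \<open>Sequential transducers and rational groups\<close>

record ('q, 's) transducer =
  states :: "'q set"
  start :: 'q
  trans_fun :: "'q \<Rightarrow> 's \<Rightarrow> 'q"
  out_fun :: "'q \<Rightarrow> 's \<Rightarrow> 's list"

definition sequential_transducer :: "'s set \<Rightarrow> ('q, 's) transducer \<Rightarrow> bool" where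
  "sequential_transducer S T \<longleftrightarrow>
     finite (states T) \<and> start T \<in> states T \<and>
     (\<forall>q \<in> states T. \<forall>s \<in> S. trans_fun T q s \<in> states T \<and> out_fun T q s \<in> lists S)"

primrec output_word :: "('q, 's) transducer \<Rightarrow> 'q \<Rightarrow> 's list \<Rightarrow> 's list" where
  "output_word T q [] = []"
| "output_word T q (s # w) = out_fun T q s @ output_word T (trans_fun T q s) w"

text \<open>Infinite words are functions on \<^typ>\<open>nat\<close>. The output on an infinite word \<open>\<eta>\<close> is the limit
  of the outputs on its finite prefixes. It is the infinite word \<open>\<zeta>\<close> iff these outputs are
  prefixes of \<open>\<zeta>\<close> of unbounded length; since letters may have empty output, the output could
  otherwise be a finite word.\<close>

definition word_prefix :: "(nat \<Rightarrow> 's) \<Rightarrow> nat \<Rightarrow> 's list" where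
  "word_prefix \<eta> n = map \<eta> [0..<n]"

definition has_output :: "('q, 's) transducer \<Rightarrow> (nat \<Rightarrow> 's) \<Rightarrow> (nat \<Rightarrow> 's) \<Rightarrow> bool" where
  "has_output T \<eta> \<zeta> \<longleftrightarrow>
     (\<forall>n. let w = output_word T (start T) (word_prefix \<eta> n) in w = word_prefix \<zeta> (length w)) \<and>
     (\<forall>m. \<exists>n. m \<le> length (output_word T (start T) (word_prefix \<eta> n)))"

definition cantor_space :: "'s set \<Rightarrow> (nat \<Rightarrow> 's) topology" where
  "cantor_space S = product_topology (\<lambda>_. discrete_topology S) UNIV"

text \<open>As states only matter up to renaming, they may be taken from \<^typ>\<open>nat\<close>.\<close>

definition rational_map :: "'s set \<Rightarrow> ((nat \<Rightarrow> 's) \<Rightarrow> (nat \<Rightarrow> 's)) \<Rightarrow> bool" where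
  "rational_map S \<phi> \<longleftrightarrow>
     (\<exists>T :: (nat, 's) transducer. sequential_transducer S T \<and>
        (\<forall>\<eta> \<in> topspace (cantor_space S). has_output T \<eta> (\<phi> \<eta>)))"

text \<open>Inside \<^const>\<open>BijGroup\<close>, maps of the Cantor space are represented by functions that are
  undefined outside it, and the product is composition.\<close>

definition rational_homeos :: "'s set \<Rightarrow> ((nat \<Rightarrow> 's) \<Rightarrow> (nat \<Rightarrow> 's)) set" where
  "rational_homeos S =
     {\<phi> \<in> Bij (topspace (cantor_space S)).
        homeomorphic_map (cantor_space S) (cantor_space S) \<phi> \<and> rational_map S \<phi>}"

definition rational_group :: "'s set \<Rightarrow> ((nat \<Rightarrow> 's) \<Rightarrow> (nat \<Rightarrow> 's)) monoid" where
  "rational_group S = (BijGroup (topspace (cantor_space S)))\<lparr>carrier := rational_homeos S\<rparr>"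

text \<open>Every finite alphabet is in bijection with a finite subset of \<^typ>\<open>nat\<close>.\<close>

definition is_rational_group :: "('g, 'm) monoid_scheme \<Rightarrow> bool" where
  "is_rational_group G \<longleftrightarrow> group G \<and>
     (\<exists>S :: nat set. finite S \<and> 2 \<le> card S \<and> (\<exists>h. h \<in> mon G (rational_group S)))"

end

theory Submission
  imports Defs "HOL-Library.Omega_Words_Fun"
begin

text \<open>
  The free group acts on the disjoint union \<open>U\<close> of the vertex sets, and the transition group is the
  group of permutations of \<open>U\<close> that this induces. The idea is to give every vertex \<open>x\<close> a finite word
  \<open>c x\<close> over a finite alphabet \<open>S\<close>, no code being a prefix of another one, such that each letter \<open>a\<close>
  changes only the end of a code. Then the map that sends \<open>c x \<frown> \<zeta>\<close> to \<open>c (x a) \<frown> \<zeta>\<close> and fixes every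
  infinite word that does not start with a code is a homeomorphism of \<open>S\<^sup>\<omega>\<close>, and all relations of
  the action on \<open>U\<close> hold for these homeomorphisms automatically, while a nontrivial permutation of \<open>U\<close>
  moves some \<open>c x \<frown> \<zeta>\<close>. A transducer reads \<open>c x\<close> from its beginning, copies it, and
  needs to look ahead by one letter only; it has finitely many states if the way in which \<open>a\<close> changes
  the code is controlled by finite information about the prefix read so far.

  Such codes come from the tree-like geometry of a context-free graph. Fix a root \<open>x0\<close>, let the level
  of a vertex be its distance from \<open>x0\<close>, and let the cone of \<open>r\<close> be the set of vertices that can be
  reached from \<open>r\<close> through vertices whose level is at least that of \<open>r\<close>. Cones of one level are equal
  or disjoint, and they form a tree under inclusion. The code of \<open>x\<close> records the descending sequence of
  cones that contain \<open>x\<close>, each named by a word that leads from the base vertex of the previous one to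
  its own, and then the position of \<open>x\<close> on the bottom level of the last one. Neighbours lie in the
  same cone or in a cone and its parent, so a letter affects at most the last two entries
  (\<open>local_map_child\<close>). If all names are chosen as a function of the isomorphism type of the
  cone (\<open>code_transfer\<close>), then the type of the current cone is all that a transducer has to remember.

  It remains to see that there are only finitely many cone types (\<open>finite_cone_types\<close>), and this is where
  the grammar enters. In a parse of a circuit at \<open>x0\<close> the factor derived from a nonterminal joins two
  points of the circuit, and it can be replaced by a shortest word derived from it, since the
  edge labels determine walks; so the parse tree triangulates the circuit by chords of bounded length. Take
  a walk \<open>w\<close> inside the cone of \<open>x\<close> whose end \<open>y\<close> has the level of \<open>x\<close>, and close it up by
  geodesics from \<open>x0\<close> to \<open>x\<close> and to \<open>y\<close>. The chords cut \<open>w\<close> into factors derived from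
  finitely many sentential forms, with all cut points within bounded distance of \<open>x\<close>
  (\<open>frontier\<close>). Hence finite data near \<open>x\<close>, the \<open>profile\<close> of \<open>x\<close>, decide which such walks have the same
  end, and thereby the type of the cone.
\<close>

section \<open>Infinite words and finite-state maps\<close>

definition infinite_words :: "'s set \<Rightarrow> (nat \<Rightarrow> 's) set" where
  "infinite_words S = {\<eta>. range \<eta> \<subseteq> S}"

lemma topspace_cantor_space [simp]: "topspace (cantor_space S) = infinite_words S"
  by (auto simp: cantor_space_def infinite_words_def PiE_def Pi_def extensional_def)

lemma conc_in_infinite_words [simp]:
  "w \<frown> \<eta> \<in> infinite_words S \<longleftrightarrow> w \<in> lists S \<and> \<eta> \<in> infinite_words S"
  by (auto simp: infinite_words_def)

lemma word_prefix_conc: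
  "\<eta> = word_prefix \<eta> n \<frown> suffix n \<eta>"
  by (auto simp: word_prefix_def conc_def suffix_def fun_eq_iff)

lemma suffix_in_infinite_words: "\<eta> \<in> infinite_words S \<Longrightarrow> suffix n \<eta> \<in> infinite_words S"
  by (auto simp: infinite_words_def suffix_def)

lemma word_prefix_in_lists: "\<eta> \<in> infinite_words S \<Longrightarrow> word_prefix \<eta> n \<in> lists S"
  by (force simp: infinite_words_def word_prefix_def)

lemma word_prefix_length_conc: "word_prefix (w \<frown> \<eta>) (length w) = w"
  by (auto simp: word_prefix_def intro: nth_equalityI)

lemma length_word_prefix [simp]: "length (word_prefix \<eta> n) = n"
  by (simp add: word_prefix_def)

lemma infinite_word_ConsE:
  assumes "\<eta> \<in> infinite_words S"
  obtains s \<zeta> where "\<eta> = [s] \<frown> \<zeta>" "s \<in> S" "\<zeta> \<in> infinite_words S"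
proof
  show "\<eta> = [\<eta> 0] \<frown> suffix 1 \<eta>"
    by (auto simp: conc_def suffix_def fun_eq_iff)
  show "\<eta> 0 \<in> S" using assms by (auto simp: infinite_words_def)
  show "suffix 1 \<eta> \<in> infinite_words S" by (rule suffix_in_infinite_words[OF assms])
qed

lemma conc_left_cancel: "w \<frown> \<eta> = w \<frown> \<zeta> \<longleftrightarrow> \<eta> = \<zeta>"
proof
  assume eq: "w \<frown> \<eta> = w \<frown> \<zeta>"
  show "\<eta> = \<zeta>"
  proof
    fix n
    have "(w \<frown> \<eta>) (length w + n) = (w \<frown> \<zeta>) (length w + n)" by (simp add: eq)
    then show "\<eta> n = \<zeta> n" by simp
  qed
qed simp

lemma conc_Cons_eq: "(s # w) \<frown> \<eta> = (t # v) \<frown> \<zeta> \<longleftrightarrow> s = t \<and> w \<frown> \<eta> = v \<frown> \<zeta>"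
proof
  assume eq: "(s # w) \<frown> \<eta> = (t # v) \<frown> \<zeta>"
  have st: "s = t" using fun_cong[OF eq, of 0] by simp
  have "[s] \<frown> (w \<frown> \<eta>) = [s] \<frown> (v \<frown> \<zeta>)" using eq st by simp
  then show "s = t \<and> w \<frown> \<eta> = v \<frown> \<zeta>" using st conc_left_cancel by metis
next
  assume "s = t \<and> w \<frown> \<eta> = v \<frown> \<zeta>"
  then have "[s] \<frown> (w \<frown> \<eta>) = [t] \<frown> (v \<frown> \<zeta>)" by metis
  then show "(s # w) \<frown> \<eta> = (t # v) \<frown> \<zeta>" by simp
qed

text \<open>
  Sequential transducers without named states: a state is the map that the transducer computes from
  there on. The number that accompanies a map bounds by how many letters the output lags behind the input.
  As the set of states is finite, the lag is bounded, which makes the output infinite.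
\<close>

definition residual_closed :: "'s set \<Rightarrow> (((nat \<Rightarrow> 's) \<Rightarrow> (nat \<Rightarrow> 's)) \<times> nat) set \<Rightarrow> bool" where
  "residual_closed S F \<longleftrightarrow>
     (\<forall>(g, d) \<in> F. (\<forall>\<eta> \<in> infinite_words S. g \<eta> \<in> infinite_words S) \<and>
        (\<forall>s \<in> S. \<exists>u \<in> lists S. \<exists>(h, e) \<in> F.
           (\<forall>\<eta> \<in> infinite_words S. g ([s] \<frown> \<eta>) = u \<frown> h \<eta>) \<and> Suc d \<le> length u + e))"

definition finite_state :: "'s set \<Rightarrow> ((nat \<Rightarrow> 's) \<Rightarrow> (nat \<Rightarrow> 's)) \<Rightarrow> bool" where
  "finite_state S f \<longleftrightarrow> (\<exists>F d. finite F \<and> (f, d) \<in> F \<and> residual_closed S F)"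

lemma residual_closedD:
  assumes "residual_closed S F" "(g, d) \<in> F"
  shows "\<And>\<eta>. \<eta> \<in> infinite_words S \<Longrightarrow> g \<eta> \<in> infinite_words S"
    and "\<And>s. s \<in> S \<Longrightarrow> \<exists>u h e. u \<in> lists S \<and> (h, e) \<in> F \<and>
           (\<forall>\<eta> \<in> infinite_words S. g ([s] \<frown> \<eta>) = u \<frown> h \<eta>) \<and> Suc d \<le> length u + e"
  using assms unfolding residual_closed_def by fast+

lemma residual_word:
  assumes F: "residual_closed S F" and "(g, d) \<in> F" "w \<in> lists S"
  shows "\<exists>u h e. u \<in> lists S \<and> (h, e) \<in> F \<and>
           (\<forall>\<eta> \<in> infinite_words S. g (w \<frown> \<eta>) = u \<frown> h \<eta>) \<and> length w + d \<le> length u + e"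
  using assms(2,3)
proof (induction w arbitrary: g d)
  case Nil
  then show ?case by (intro exI[of _ "[]"] exI[of _ g] exI[of _ d]) auto
next
  case (Cons s w)
  from Cons.prems have s: "s \<in> S" and w: "w \<in> lists S" by auto
  obtain u h e where 1: "u \<in> lists S" "(h, e) \<in> F" "Suc d \<le> length u + e"
    "\<forall>\<eta> \<in> infinite_words S. g ([s] \<frown> \<eta>) = u \<frown> h \<eta>"
    using residual_closedD(2)[OF F Cons.prems(1) s] by blast
  obtain u' h' e' where 2: "u' \<in> lists S" "(h', e') \<in> F" "length w + e \<le> length u' + e'"
    "\<forall>\<eta> \<in> infinite_words S. h (w \<frown> \<eta>) = u' \<frown> h' \<eta>"
    using Cons.IH[OF 1(2) w] by blast
  have "g ((s # w) \<frown> \<eta>) = (u @ u') \<frown> h' \<eta>" if "\<eta> \<in> infinite_words S" for \<eta>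
    using 1(4) 2(4) that w by (metis append_Cons append_Nil conc_conc conc_in_infinite_words)
  with 1 2 show ?case
    by (intro exI[of _ "u @ u'"] exI[of _ h'] exI[of _ e']) auto
qed

lemma finite_state_cong:
  assumes "finite_state S f" and eq: "\<And>\<eta>. \<eta> \<in> infinite_words S \<Longrightarrow> f' \<eta> = f \<eta>"
  shows "finite_state S f'"
proof -
  obtain F d where F: "finite F" "(f, d) \<in> F" "residual_closed S F"
    using assms(1) unfolding finite_state_def by blast
  have "residual_closed S (insert (f', d) F)"
    unfolding residual_closed_def
  proof (intro ballI, clarify, intro conjI ballI)
    fix g e \<eta> assume g: "(g, e) \<in> insert (f', d) F" and "\<eta> \<in> infinite_words S"
    then show "g \<eta> \<in> infinite_words S"
      using residual_closedD(1)[OF F(3,2)] residual_closedD(1)[OF F(3), of g e] eq by auto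
  next
    fix g e s assume g: "(g, e) \<in> insert (f', d) F" and s: "s \<in> S"
    obtain g' where g': "(g', e) \<in> F" "\<And>\<eta>. \<eta> \<in> infinite_words S \<Longrightarrow> g \<eta> = g' \<eta>"
      using g F(2) eq by auto
    obtain u h k where 1: "u \<in> lists S" "(h, k) \<in> F" "Suc e \<le> length u + k"
      "\<forall>\<eta> \<in> infinite_words S. g' ([s] \<frown> \<eta>) = u \<frown> h \<eta>"
      using residual_closedD(2)[OF F(3) g'(1) s] by blast
    have gu: "g ([s] \<frown> \<eta>) = u \<frown> h \<eta>" if "\<eta> \<in> infinite_words S" for \<eta>
    proof -
      have "[s] \<frown> \<eta> \<in> infinite_words S" using s that by (subst conc_in_infinite_words) simp
      then show ?thesis using g'(2) 1(4) that by metis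
    qed
    show "\<exists>u\<in>lists S. \<exists>(h, k)\<in>insert (f', d) F.
        (\<forall>\<eta>\<in>infinite_words S. g ([s] \<frown> \<eta>) = u \<frown> h \<eta>) \<and> Suc e \<le> length u + k"
    proof (intro bexI[of _ u] bexI[of _ "(h, k)"])
      show "case (h, k) of (h, k) \<Rightarrow>
          (\<forall>\<eta>\<in>infinite_words S. g ([s] \<frown> \<eta>) = u \<frown> h \<eta>) \<and> Suc e \<le> length u + k"
        using 1(3) gu by blast
    qed (use 1 in auto)
  qed
  with F(1) show ?thesis unfolding finite_state_def by blast
qed

lemma finite_state_id: "finite_state S id"
proof -
  have "residual_closed S {(id, 0)}"
    unfolding residual_closed_def by (auto intro!: bexI[of _ "[_]"])
  then show ?thesis unfolding finite_state_def by blast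
qed

text \<open>
  The residuals of a composition are compositions of residuals, and the lags add up: the second
  map consumes what the first one emits.
\<close>

lemma finite_state_comp:
  assumes "finite_state S f" "finite_state S g"
  shows "finite_state S (g \<circ> f)"
proof -
  obtain F d where F: "finite F" "(f, d) \<in> F" "residual_closed S F"
    using assms(1) unfolding finite_state_def by blast
  obtain G e where G: "finite G" "(g, e) \<in> G" "residual_closed S G"
    using assms(2) unfolding finite_state_def by blast
  let ?H = "(\<lambda>((h, i), (k, j)). (k \<circ> h, i + j)) ` (F \<times> G)"
  have "residual_closed S ?H"
    unfolding residual_closed_def
  proof (intro ballI, clarify, intro conjI ballI)
    fix h i k j \<eta> assume "(h, i) \<in> F" "(k, j) \<in> G" "\<eta> \<in> infinite_words S"
    then show "(k \<circ> h) \<eta> \<in> infinite_words S"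
      using residual_closedD(1)[OF F(3)] residual_closedD(1)[OF G(3)] by auto
  next
    fix h i k j s assume h: "(h, i) \<in> F" and k: "(k, j) \<in> G" and s: "s \<in> S"
    obtain u h' i' where 1: "u \<in> lists S" "(h', i') \<in> F" "Suc i \<le> length u + i'"
      "\<forall>\<eta> \<in> infinite_words S. h ([s] \<frown> \<eta>) = u \<frown> h' \<eta>"
      using residual_closedD(2)[OF F(3) h s] by blast
    obtain v k' j' where 2: "v \<in> lists S" "(k', j') \<in> G" "length u + j \<le> length v + j'"
      "\<forall>\<eta> \<in> infinite_words S. k (u \<frown> \<eta>) = v \<frown> k' \<eta>"
      using residual_word[OF G(3) k 1(1)] by blast
    show "\<exists>u\<in>lists S. \<exists>(h', e)\<in>?H.
        (\<forall>\<eta>\<in>infinite_words S. (k \<circ> h) ([s] \<frown> \<eta>) = u \<frown> h' \<eta>) \<and> Suc (i + j) \<le> length u + e"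
    proof (intro bexI[of _ v] bexI[of _ "(k' \<circ> h', i' + j')"])
      show "(k' \<circ> h', i' + j') \<in> ?H" using 1(2) 2(2) by force
      show "case (k' \<circ> h', i' + j') of (h', e) \<Rightarrow>
          (\<forall>\<eta>\<in>infinite_words S. (k \<circ> h) ([s] \<frown> \<eta>) = v \<frown> h' \<eta>) \<and> Suc (i + j) \<le> length v + e"
        using 1 2 residual_closedD(1)[OF F(3) 1(2)] by auto
    qed (rule 2(1))
  qed
  moreover have "finite ?H" using F(1) G(1) by simp
  moreover have "(g \<circ> f, d + e) \<in> ?H" using F(2) G(2) by force
  ultimately show ?thesis unfolding finite_state_def by blast
qed

lemma finite_state_maps_into:
  assumes "finite_state S f" "\<eta> \<in> infinite_words S"
  shows "f \<eta> \<in> infinite_words S"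
  using assms residual_closedD(1) unfolding finite_state_def by blast

text \<open>
  The pairs in the residual-closed set serve as states, numbered by natural numbers. After an input
  prefix \<open>w\<close>, the output produced so far is a prefix of the value on every continuation of \<open>w\<close>.
\<close>

lemma finite_state_imp_rational_map:
  assumes "finite_state S f"
  shows "rational_map S f"
proof -
  obtain F d where F: "finite F" "(f, d) \<in> F" "residual_closed S F"
    using assms unfolding finite_state_def by blast
  define step where "step p s q \<longleftrightarrow> fst q \<in> lists S \<and> snd q \<in> F \<and>
     (\<forall>\<eta> \<in> infinite_words S. fst p ([s] \<frown> \<eta>) = fst q \<frown> fst (snd q) \<eta>) \<and>
     Suc (snd p) \<le> length (fst q) + snd (snd q)" for p :: "((nat \<Rightarrow> 'a) \<Rightarrow> nat \<Rightarrow> 'a) \<times> nat" and s q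
  have "\<exists>q. step p s q" if "p \<in> F" "s \<in> S" for p s
  proof -
    have "(fst p, snd p) \<in> F" using that by simp
    from residual_closedD(2)[OF F(3) this that(2)] show ?thesis
      unfolding step_def by (metis fst_conv snd_conv)
  qed
  then obtain next_res where nr: "\<And>p s. p \<in> F \<Longrightarrow> s \<in> S \<Longrightarrow> step p s (next_res p s)" by metis
  define code where "code = to_nat_on F"
  define dec where "dec = from_nat_into F"
  have dec: "dec (code p) = p" if "p \<in> F" for p
    using that F(1) by (simp add: code_def dec_def countable_finite)
  define T where "T = \<lparr>states = code ` F, start = code (f, d),
     trans_fun = \<lambda>n s. code (snd (next_res (dec n) s)), out_fun = \<lambda>n s. fst (next_res (dec n) s)\<rparr>"
  have T: "sequential_transducer S T"
    using F(1,2) nr by (auto simp: sequential_transducer_def T_def dec step_def)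
  have run: "\<exists>q \<in> F. (\<forall>\<eta> \<in> infinite_words S. fst p (w \<frown> \<eta>) = output_word T (code p) w \<frown> fst q \<eta>) \<and>
      length w + snd p \<le> length (output_word T (code p) w) + snd q"
    if "p \<in> F" "w \<in> lists S" for p w
    using that
  proof (induction w arbitrary: p)
    case Nil
    then show ?case by (auto intro!: bexI[of _ p])
  next
    case (Cons s w)
    let ?u = "fst (next_res p s)" and ?p' = "snd (next_res p s)"
    have st: "step p s (next_res p s)" using nr Cons.prems by auto
    then have "?p' \<in> F" by (simp add: step_def)
    then obtain q where q: "q \<in> F"
      "\<forall>\<eta> \<in> infinite_words S. fst ?p' (w \<frown> \<eta>) = output_word T (code ?p') w \<frown> fst q \<eta>"
      "length w + snd ?p' \<le> length (output_word T (code ?p') w) + snd q"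
      using Cons.IH[of ?p'] Cons.prems by auto
    have out: "output_word T (code p) (s # w) = ?u @ output_word T (code ?p') w"
      using Cons.prems by (simp add: T_def dec)
    have "fst p ((s # w) \<frown> \<eta>) = output_word T (code p) (s # w) \<frown> fst q \<eta>"
      if \<eta>: "\<eta> \<in> infinite_words S" for \<eta>
    proof -
      have "(s # w) \<frown> \<eta> = [s] \<frown> (w \<frown> \<eta>)" by simp
      moreover have "w \<frown> \<eta> \<in> infinite_words S" using \<eta> Cons.prems by simp
      ultimately have "fst p ((s # w) \<frown> \<eta>) = ?u \<frown> fst ?p' (w \<frown> \<eta>)"
        using st unfolding step_def by metis
      then show ?thesis using q(2) \<eta> out by (metis conc_conc)
    qed
    moreover have "length (s # w) + snd p \<le> length (output_word T (code p) (s # w)) + snd q"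
      using st q(3) out by (simp add: step_def)
    ultimately show ?case using q(1) by blast
  qed
  have "has_output T \<eta> (f \<eta>)" if \<eta>: "\<eta> \<in> infinite_words S" for \<eta>
  proof -
    have start: "start T = code (f, d)" by (simp add: T_def)
    have pref: "let w = output_word T (start T) (word_prefix \<eta> n) in w = word_prefix (f \<eta>) (length w)"
      for n
    proof -
      obtain q where "q \<in> F" "\<forall>\<zeta> \<in> infinite_words S. f (word_prefix \<eta> n \<frown> \<zeta>) =
          output_word T (start T) (word_prefix \<eta> n) \<frown> fst q \<zeta>"
        using run[OF F(2) word_prefix_in_lists[OF \<eta>, of n]] start by auto
      then have "f \<eta> = output_word T (start T) (word_prefix \<eta> n) \<frown> fst q (suffix n \<eta>)"
        using word_prefix_conc[of \<eta> n] suffix_in_infinite_words[OF \<eta>, of n] by metis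
      then show ?thesis by (simp add: word_prefix_length_conc)
    qed
    have "\<exists>n. m \<le> length (output_word T (start T) (word_prefix \<eta> n))" for m
    proof -
      define E where "E = Max (snd ` F)"
      obtain q where q: "q \<in> F" "m + E + d \<le> length (output_word T (start T) (word_prefix \<eta> (m + E))) + snd q"
        using run[OF F(2) word_prefix_in_lists[OF \<eta>, of "m + E"]] start by auto
      have "snd q \<le> E" unfolding E_def using F(1) q(1) by auto
      with q(2) show ?thesis by (intro exI[of _ "m + E"]) auto
    qed
    with pref show ?thesis unfolding has_output_def by blast
  qed
  with T show ?thesis unfolding rational_map_def by auto
qed

text \<open>
  As the lag is bounded by some \<open>E\<close>, the first \<open>k + 1 + E\<close> letters of the argument determine
  the letter of the value at position \<open>k\<close>.
\<close>

lemma finite_state_imp_continuous: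
  assumes "finite_state S f"
  shows "continuous_map (cantor_space S) (cantor_space S) f"
proof -
  obtain F d where F: "finite F" "(f, d) \<in> F" "residual_closed S F"
    using assms unfolding finite_state_def by blast
  define E where "E = Max (snd ` F)"
  have loc: "f \<zeta> k = f \<eta> k" if \<eta>: "\<eta> \<in> infinite_words S" and \<zeta>: "\<zeta> \<in> infinite_words S"
    and agree: "\<And>i. i < Suc k + E \<Longrightarrow> \<zeta> i = \<eta> i" for k \<eta> \<zeta>
  proof -
    let ?n = "Suc k + E"
    obtain u h e where u: "(h, e) \<in> F" "?n + d \<le> length u + e"
      "\<forall>\<xi> \<in> infinite_words S. f (word_prefix \<eta> ?n \<frown> \<xi>) = u \<frown> h \<xi>"
      using residual_word[OF F(3,2) word_prefix_in_lists[OF \<eta>, of ?n]] by auto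
    have "e \<le> E" unfolding E_def using F(1) u(1) by (intro Max_ge) force+
    with u(2) have k: "k < length u" by simp
    have "word_prefix \<zeta> ?n = word_prefix \<eta> ?n" using agree by (simp add: word_prefix_def)
    then have "f \<zeta> = u \<frown> h (suffix ?n \<zeta>)" "f \<eta> = u \<frown> h (suffix ?n \<eta>)"
      using u(3) word_prefix_conc[of \<zeta> ?n] word_prefix_conc[of \<eta> ?n]
        suffix_in_infinite_words[OF \<eta>] suffix_in_infinite_words[OF \<zeta>] by metis+
    with k show ?thesis by simp
  qed
  have "continuous_map (cantor_space S) (discrete_topology S) (\<lambda>\<eta>. f \<eta> k)" for k
    unfolding continuous_map_def
  proof (intro conjI allI impI)
    show "(\<lambda>\<eta>. f \<eta> k) \<in> topspace (cantor_space S) \<rightarrow> topspace (discrete_topology S)"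
      using finite_state_maps_into[OF assms] by (auto simp: infinite_words_def)
    fix U assume "openin (discrete_topology S) U"
    show "openin (cantor_space S) {\<eta> \<in> topspace (cantor_space S). f \<eta> k \<in> U}"
    proof (subst openin_subopen, intro ballI)
      fix \<eta> assume "\<eta> \<in> {\<eta> \<in> topspace (cantor_space S). f \<eta> k \<in> U}"
      then have \<eta>: "\<eta> \<in> infinite_words S" "f \<eta> k \<in> U" by auto
      define B where "B i = (if i < Suc k + E then {\<eta> i} else S)" for i
      have BS: "B i \<subseteq> S" for i using \<eta>(1) by (auto simp: B_def infinite_words_def)
      have "finite {i. B i \<noteq> S}"
        by (rule finite_subset[of _ "{..<Suc k + E}"]) (auto simp: B_def)
      then have "openin (cantor_space S) (Pi\<^sub>E UNIV B)"
        using BS unfolding cantor_space_def by (subst openin_PiE_gen) auto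
      moreover have "\<eta> \<in> Pi\<^sub>E UNIV B" using \<eta>(1) by (auto simp: B_def infinite_words_def)
      moreover have "Pi\<^sub>E UNIV B \<subseteq> {\<eta> \<in> topspace (cantor_space S). f \<eta> k \<in> U}"
      proof
        fix \<zeta> assume \<zeta>: "\<zeta> \<in> Pi\<^sub>E UNIV B"
        then have z: "\<zeta> i \<in> B i" for i by auto
        then have "\<zeta> \<in> infinite_words S" using BS by (auto simp: infinite_words_def)
        moreover have "\<zeta> i = \<eta> i" if "i < Suc k + E" for i using z[of i] that by (simp add: B_def)
        ultimately show "\<zeta> \<in> {\<eta> \<in> topspace (cantor_space S). f \<eta> k \<in> U}"
          using loc[OF \<eta>(1)] \<eta>(2) by auto
      qed
      ultimately show "\<exists>T. openin (cantor_space S) T \<and> \<eta> \<in> T \<and>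
          T \<subseteq> {\<eta> \<in> topspace (cantor_space S). f \<eta> k \<in> U}" by blast
    qed
  qed
  then show ?thesis
    by (subst (2) cantor_space_def) (simp add: continuous_map_componentwise_UNIV)
qed

section \<open>Permutations of coded sets as maps of infinite words\<close>

text \<open>
  Stated on infinite words, where it is used; it says that \<open>c\<close> is injective on \<open>U\<close> and that its
  values form a prefix code.
\<close>

definition prefix_code :: "'u set \<Rightarrow> ('u \<Rightarrow> 's list) \<Rightarrow> bool" where
  "prefix_code U c \<longleftrightarrow> (\<forall>x \<in> U. \<forall>y \<in> U. \<forall>\<eta> \<zeta>. c x \<frown> \<eta> = c y \<frown> \<zeta> \<longrightarrow> x = y)"

definition code_map ::
    "'u set \<Rightarrow> ('u \<Rightarrow> 's list) \<Rightarrow> ('u \<Rightarrow> 'u) \<Rightarrow> (nat \<Rightarrow> 's) \<Rightarrow> (nat \<Rightarrow> 's)" where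
  "code_map U c \<pi> \<eta> =
     (if \<exists>x \<in> U. \<exists>\<zeta>. \<eta> = c x \<frown> \<zeta>
      then let x = (SOME x. x \<in> U \<and> (\<exists>\<zeta>. \<eta> = c x \<frown> \<zeta>)) in c (\<pi> x) \<frown> suffix (length (c x)) \<eta>
      else \<eta>)"

lemma prefix_codeD: "prefix_code U c \<Longrightarrow> x \<in> U \<Longrightarrow> y \<in> U \<Longrightarrow> c x \<frown> \<eta> = c y \<frown> \<zeta> \<Longrightarrow> x = y"
  unfolding prefix_code_def by blast

lemma code_map_code:
  assumes "prefix_code U c" "x \<in> U"
  shows "code_map U c \<pi> (c x \<frown> \<zeta>) = c (\<pi> x) \<frown> \<zeta>"
proof -
  have "(SOME y. y \<in> U \<and> (\<exists>\<xi>. c x \<frown> \<zeta> = c y \<frown> \<xi>)) = x"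
    using assms prefix_codeD[OF assms(1)] by (intro some_equality) blast+
  moreover have "suffix (length (c x)) (c x \<frown> \<zeta>) = \<zeta>"
    by (simp add: suffix_def fun_eq_iff)
  ultimately show ?thesis using assms(2) unfolding code_map_def by (auto simp: Let_def)
qed

lemma code_map_other:
  "(\<And>x \<zeta>. x \<in> U \<Longrightarrow> \<eta> \<noteq> c x \<frown> \<zeta>) \<Longrightarrow> code_map U c \<pi> \<eta> = \<eta>"
  unfolding code_map_def by auto

lemma code_map_comp:
  assumes "prefix_code U c" and "\<And>x. x \<in> U \<Longrightarrow> \<rho> x \<in> U"
  shows "code_map U c (\<pi> \<circ> \<rho>) = code_map U c \<pi> \<circ> code_map U c \<rho>"
proof
  fix \<eta>
  show "code_map U c (\<pi> \<circ> \<rho>) \<eta> = (code_map U c \<pi> \<circ> code_map U c \<rho>) \<eta>"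
  proof (cases "\<exists>x \<in> U. \<exists>\<zeta>. \<eta> = c x \<frown> \<zeta>")
    case True
    then show ?thesis using assms by (auto simp: code_map_code)
  next
    case False
    then show ?thesis by (auto simp: code_map_other)
  qed
qed

lemma code_map_id: 
  assumes "prefix_code U c" "\<And>x. x \<in> U \<Longrightarrow> \<pi> x = x"
  shows "code_map U c \<pi> = id"
proof
  fix \<eta>
  show "code_map U c \<pi> \<eta> = id \<eta>"
  proof (cases "\<exists>x \<in> U. \<exists>\<zeta>. \<eta> = c x \<frown> \<zeta>")
    case True
    then show ?thesis using assms by (auto simp: code_map_code)
  next
    case False
    then show ?thesis by (auto simp: code_map_other)
  qed
qed

lemma code_map_in_infinite_words:
  assumes "prefix_code U c" "\<And>x. x \<in> U \<Longrightarrow> c (\<pi> x) \<in> lists S" "\<eta> \<in> infinite_words S"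
  shows "code_map U c \<pi> \<eta> \<in> infinite_words S"
proof (cases "\<exists>x \<in> U. \<exists>\<zeta>. \<eta> = c x \<frown> \<zeta>")
  case True
  then show ?thesis using assms by (auto simp: code_map_code)
next
  case False
  then show ?thesis using assms by (auto simp: code_map_other)
qed

section \<open>Words derived from a sentential form\<close>

text \<open>
  Derivability of a terminal word, arranged as a parse: induction on it splits a sentential form into its
  first symbol and the rest, so that every parse node is binary. Only terminals in \<open>A\<close> are admitted.
\<close>

inductive yields ::
    "'a set \<Rightarrow> ('n \<times> ('n, 'a) symbol list) set \<Rightarrow> ('n, 'a) symbol list \<Rightarrow> 'a list \<Rightarrow> bool"
  for A P where
  yields_Nil: "yields A P [] []"
| yields_Terminal: "a \<in> A \<Longrightarrow> yields A P \<alpha> w \<Longrightarrow> yields A P (Terminal a # \<alpha>) (a # w)"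
| yields_Nonterminal: "(X, \<beta>) \<in> P \<Longrightarrow> yields A P \<beta> u \<Longrightarrow> yields A P \<alpha> v \<Longrightarrow>
    yields A P (Nonterminal X # \<alpha>) (u @ v)"

lemma yields_in_lists: "yields A P \<alpha> w \<Longrightarrow> w \<in> lists A"
  by (induction rule: yields.induct) auto

lemma yields_map_Terminal: "w \<in> lists A \<Longrightarrow> yields A P (map Terminal w) w"
  by (induction w) (auto intro: yields.intros)

lemma yields_Nil_iff: "yields A P [] w \<longleftrightarrow> w = []"
proof
  assume "yields A P [] w"
  then show "w = []" by cases auto
qed (simp add: yields_Nil)

lemma yields_letterD: "yields A P [Terminal a] w \<Longrightarrow> w = [a]"
  by (erule yields.cases) (auto simp: yields_Nil_iff)

lemma yields_append:
  "yields A P \<alpha> u \<Longrightarrow> yields A P \<beta> v \<Longrightarrow> yields A P (\<alpha> @ \<beta>) (u @ v)"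
proof (induction rule: yields.induct)
  case (yields_Nonterminal X \<gamma> u \<alpha> w)
  then show ?case using yields.yields_Nonterminal[of X \<gamma> P A u "\<alpha> @ \<beta>" "w @ v"] by simp
qed (auto intro: yields.intros)

lemma yields_appendD:
  "yields A P (\<alpha> @ \<beta>) w \<Longrightarrow> \<exists>u v. w = u @ v \<and> yields A P \<alpha> u \<and> yields A P \<beta> v"
proof (induction \<alpha> arbitrary: w)
  case Nil
  then show ?case by (auto intro: yields.intros)
next
  case (Cons x \<alpha>)
  from Cons.prems have "yields A P (x # (\<alpha> @ \<beta>)) w" by simp
  then show ?case
  proof (cases rule: yields.cases)
    case (yields_Terminal a w')
    with Cons.IH obtain u v where "w' = u @ v" "yields A P \<alpha> u" "yields A P \<beta> v" by blast
    with yields_Terminal show ?thesis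
      by (intro exI[of _ "a # u"] exI[of _ v]) (auto intro: yields.intros)
  next
    case (yields_Nonterminal X \<gamma> u' v')
    with Cons.IH obtain u v where "v' = u @ v" "yields A P \<alpha> u" "yields A P \<beta> v" by blast
    with yields_Nonterminal show ?thesis
      by (intro exI[of _ "u' @ u"] exI[of _ v]) (auto intro: yields.intros)
  qed
qed

lemma derives_step_context:
  "derives_step P \<alpha> \<beta> \<Longrightarrow> derives_step P (u @ \<alpha> @ v) (u @ \<beta> @ v)"
proof (induction rule: derives_step.induct)
  case (1 X r u' v')
  then show ?case using derives_step.intros[of X r P "u @ u'" "v' @ v"] by simp
qed

lemma derives_context:
  "(derives_step P)\<^sup>*\<^sup>* \<alpha> \<beta> \<Longrightarrow> (derives_step P)\<^sup>*\<^sup>* (u @ \<alpha> @ v) (u @ \<beta> @ v)"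
  by (induction rule: rtranclp_induct) (auto intro: rtranclp.rtrancl_into_rtrancl derives_step_context)

lemma derives_iff_yields:
  assumes "w \<in> lists A"
  shows "(derives_step P)\<^sup>*\<^sup>* \<alpha> (map Terminal w) \<longleftrightarrow> yields A P \<alpha> w"
proof
  assume "(derives_step P)\<^sup>*\<^sup>* \<alpha> (map Terminal w)"
  then show "yields A P \<alpha> w"
  proof (induction rule: converse_rtranclp_induct)
    case base
    show ?case by (rule yields_map_Terminal[OF assms])
  next
    case (step \<alpha> \<beta>)
    from step.hyps(1) step.IH show ?case
    proof (cases rule: derives_step.cases)
      case (1 X r u v)
      with step.IH obtain w1 w2 w3 where "w = w1 @ w2 @ w3"
        "yields A P u w1" "yields A P r w2" "yields A P v w3"
        by (metis yields_appendD)
      then show ?thesis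
        using 1 yields_append[of A P u w1 "Nonterminal X # v" "w2 @ w3"]
        by (simp add: yields_Nonterminal)
    qed
  qed
next
  assume "yields A P \<alpha> w"
  then show "(derives_step P)\<^sup>*\<^sup>* \<alpha> (map Terminal w)"
  proof (induction rule: yields.induct)
    case (yields_Terminal a \<alpha> w)
    then show ?case using derives_context[of P \<alpha> "map Terminal w" "[Terminal a]" "[]"] by simp
  next
    case (yields_Nonterminal X \<beta> u \<alpha> v)
    have "derives_step P (Nonterminal X # \<alpha>) (\<beta> @ \<alpha>)"
      using derives_step.intros[of X \<beta> P "[]" \<alpha>] yields_Nonterminal.hyps(1) by simp
    also have "(derives_step P)\<^sup>*\<^sup>* (\<beta> @ \<alpha>) (map Terminal u @ \<alpha>)"
      using derives_context[OF yields_Nonterminal.IH(1), of "[]" \<alpha>] by simp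
    also have "(derives_step P)\<^sup>*\<^sup>* (map Terminal u @ \<alpha>) (map Terminal u @ map Terminal v)"
      using derives_context[OF yields_Nonterminal.IH(2), of "map Terminal u" "[]"] by simp
    finally show ?case by simp
  qed simp
qed

text \<open>
  The sentential forms that label the nodes of such binary parses: suffixes of right-hand sides. The single
  letters are added so that a factor of length one is always derived from an item.
\<close>

definition items :: "'a set \<Rightarrow> ('n \<times> ('n, 'a) symbol list) set \<Rightarrow> 'n \<Rightarrow> ('n, 'a) symbol list set" where
  "items A P S = {\<alpha>. \<exists>\<beta> \<in> insert [Nonterminal S] (snd ` P \<union> (\<lambda>a. [Terminal a]) ` A). \<exists>\<gamma>. \<beta> = \<gamma> @ \<alpha>}"

lemma finite_items: "finite A \<Longrightarrow> finite P \<Longrightarrow> finite (items A P S)"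
proof -
  assume "finite A" "finite P"
  moreover have "items A P S \<subseteq> (\<Union>\<beta> \<in> insert [Nonterminal S] (snd ` P \<union> (\<lambda>a. [Terminal a]) ` A). (\<lambda>n. drop n \<beta>) ` {..length \<beta>})"
  proof
    fix \<alpha> assume "\<alpha> \<in> items A P S"
    then obtain \<beta> \<gamma> where \<beta>: "\<beta> \<in> insert [Nonterminal S] (snd ` P \<union> (\<lambda>a. [Terminal a]) ` A)"
      and eq: "\<beta> = \<gamma> @ \<alpha>" unfolding items_def by blast
    have "\<alpha> \<in> (\<lambda>n. drop n \<beta>) ` {..length \<beta>}"
      by (rule image_eqI[of _ _ "length \<gamma>"]) (auto simp: eq)
    with \<beta> show "\<alpha> \<in> (\<Union>\<beta> \<in> insert [Nonterminal S] (snd ` P \<union> (\<lambda>a. [Terminal a]) ` A).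
        (\<lambda>n. drop n \<beta>) ` {..length \<beta>})" by blast
  qed
  ultimately show ?thesis by (rule_tac finite_subset) auto
qed

lemma start_in_items: "[Nonterminal S] \<in> items A P S"
  and Nil_in_items: "[] \<in> items A P S"
  and production_in_items: "(X, \<beta>) \<in> P \<Longrightarrow> \<beta> \<in> items A P S"
  and letter_in_items: "a \<in> A \<Longrightarrow> [Terminal a] \<in> items A P S"
  and items_tl: "x # \<alpha> \<in> items A P S \<Longrightarrow> \<alpha> \<in> items A P S"
proof -
  show "[Nonterminal S] \<in> items A P S" "[] \<in> items A P S"
    unfolding items_def by auto
  show "\<beta> \<in> items A P S" if "(X, \<beta>) \<in> P" 
    using imageI[OF that, of snd] unfolding items_def by (auto intro!: exI[of _ "[]"])
  show "[Terminal a] \<in> items A P S" if "a \<in> A"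
    using that unfolding items_def by (auto intro!: exI[of _ "[]"])
  show "\<alpha> \<in> items A P S" if "x # \<alpha> \<in> items A P S"
  proof -
    from that obtain \<beta> \<gamma> where \<beta>: "\<beta> \<in> insert [Nonterminal S] (snd ` P \<union> (\<lambda>a. [Terminal a]) ` A)"
      and "\<beta> = \<gamma> @ x # \<alpha>"
      unfolding items_def by blast
    then have "\<beta> = (\<gamma> @ [x]) @ \<alpha>" by simp
    with \<beta> show ?thesis unfolding items_def by blast
  qed
qed

section \<open>Actions of words, levels and cones\<close>

locale word_action = involutive_alphabet A ainv for A :: "'a set" and ainv +
  fixes V :: "'v set" and act :: "'v \<Rightarrow> 'a \<Rightarrow> 'v"
  assumes act_in: "v \<in> V \<Longrightarrow> a \<in> A \<Longrightarrow> act v a \<in> V"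
    and act_ainv: "v \<in> V \<Longrightarrow> a \<in> A \<Longrightarrow> act (act v a) (ainv a) = v"
begin

abbreviation run :: "'v \<Rightarrow> 'a list \<Rightarrow> 'v" (infixl \<open>\<triangleright>\<close> 80) where
  "v \<triangleright> w \<equiv> foldl act v w"

definition winv :: "'a list \<Rightarrow> 'a list" where
  "winv w = rev (map ainv w)"

lemma winv_in [simp]: "w \<in> lists A \<Longrightarrow> winv w \<in> lists A"
  by (auto simp: winv_def ainv_closed)

lemma length_winv [simp]: "length (winv w) = length w"
  by (simp add: winv_def)

lemma winv_append: "winv (u @ v) = winv v @ winv u"
  by (simp add: winv_def)

lemma winv_winv: "w \<in> lists A \<Longrightarrow> winv (winv w) = w"
  by (induction w) (auto simp: winv_def ainv_ainv)

lemma run_in [simp]: "v \<in> V \<Longrightarrow> w \<in> lists A \<Longrightarrow> v \<triangleright> w \<in> V"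
  by (induction w arbitrary: v) (auto simp: act_in)

lemma run_winv: "v \<in> V \<Longrightarrow> w \<in> lists A \<Longrightarrow> v \<triangleright> w \<triangleright> winv w = v"
proof (induction w arbitrary: v)
  case (Cons a w)
  then have "act v a \<triangleright> w \<triangleright> winv w = act v a" by (simp add: act_in)
  with Cons.prems show ?case by (simp add: winv_def act_ainv)
qed (simp add: winv_def)

lemma run_winv': "v \<in> V \<Longrightarrow> w \<in> lists A \<Longrightarrow> v \<triangleright> winv w \<triangleright> w = v"
  using run_winv[of v "winv w"] by (simp add: winv_winv)

lemma run_inj: "v \<in> V \<Longrightarrow> v' \<in> V \<Longrightarrow> w \<in> lists A \<Longrightarrow> v \<triangleright> w = v' \<triangleright> w \<longleftrightarrow> v = v'"
  by (metis run_winv)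

end

locale rooted_action = word_action A ainv V act
  for A :: "'a set" and ainv and V :: "'v set" and act +
  fixes x0 :: 'v
  assumes root_in: "x0 \<in> V"
    and reachable: "v \<in> V \<Longrightarrow> \<exists>w \<in> lists A. x0 \<triangleright> w = v"
begin

definition level :: "'v \<Rightarrow> nat" where
  "level v = (LEAST n. \<exists>w \<in> lists A. length w = n \<and> x0 \<triangleright> w = v)"

lemma ex_geodesic:
  assumes "v \<in> V"
  shows "\<exists>w \<in> lists A. length w = level v \<and> x0 \<triangleright> w = v"
  using reachable[OF assms] unfolding level_def
  by (rule_tac LeastI_ex[of "\<lambda>n. \<exists>w \<in> lists A. length w = n \<and> x0 \<triangleright> w = v"]) auto

lemma level_root_run: "w \<in> lists A \<Longrightarrow> level (x0 \<triangleright> w) \<le> length w"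
  unfolding level_def by (rule Least_le) auto

lemma level_run_le: "v \<in> V \<Longrightarrow> w \<in> lists A \<Longrightarrow> level (v \<triangleright> w) \<le> level v + length w"
proof -
  assume v: "v \<in> V" and w: "w \<in> lists A"
  obtain u where "u \<in> lists A" "length u = level v" "x0 \<triangleright> u = v" using ex_geodesic[OF v] by blast
  then show ?thesis using level_root_run[of "u @ w"] w by auto
qed

lemma level_le_run: "v \<in> V \<Longrightarrow> w \<in> lists A \<Longrightarrow> level v \<le> level (v \<triangleright> w) + length w"
  using level_run_le[of "v \<triangleright> w" "winv w"] by (simp add: run_winv)

lemma level_root [simp]: "level x0 = 0"
  using level_root_run[of "[]"] by simp

lemma geodesic_prefix:
  assumes "x0 \<triangleright> (u @ v) = y" "length (u @ v) = level y" "u \<in> lists A" "v \<in> lists A"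
  shows "level (x0 \<triangleright> u) = length u"
proof -
  have "level y \<le> level (x0 \<triangleright> u) + length v"
    using level_run_le[of "x0 \<triangleright> u" v] assms root_in by auto
  with level_root_run[of u] assms show ?thesis by auto
qed

lemma finite_sphere: "finite {v \<in> V. level v = n}"
proof (rule finite_subset)
  show "{v \<in> V. level v = n} \<subseteq> (\<lambda>w. x0 \<triangleright> w) ` {w. set w \<subseteq> A \<and> length w = n}"
  proof
    fix v assume "v \<in> {v \<in> V. level v = n}"
    then obtain w where "w \<in> lists A" "length w = n" "x0 \<triangleright> w = v" using ex_geodesic[of v] by auto
    then show "v \<in> (\<lambda>w. x0 \<triangleright> w) ` {w. set w \<subseteq> A \<and> length w = n}" by auto
  qed
  show "finite ((\<lambda>w. x0 \<triangleright> w) ` {w. set w \<subseteq> A \<and> length w = n})"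
    using finite_lists_length_eq[OF finite_alphabet] by blast
qed

definition cone_words :: "'v \<Rightarrow> 'a list set" where
  "cone_words r = {w \<in> lists A. \<forall>u v. w = u @ v \<longrightarrow> level r \<le> level (r \<triangleright> u)}"

definition cone :: "'v \<Rightarrow> 'v set" where
  "cone r = (\<lambda>w. r \<triangleright> w) ` cone_words r"

text \<open>
  The cone of \<open>r\<close> as a labelled graph with base vertex \<open>r\<close> and with its levels, up to isomorphism:
  a vertex is a class of words in \<open>cone_words r\<close>, two words being identified when they lead to the same vertex.
\<close>

definition cone_type :: "'v \<Rightarrow> ('a list \<times> nat) set \<times> ('a list \<times> 'a list) set" where
  "cone_type r = ({(w, level (r \<triangleright> w) - level r) | w. w \<in> cone_words r},
     {(u, v). u \<in> cone_words r \<and> v \<in> cone_words r \<and> r \<triangleright> u = r \<triangleright> v})"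

lemma cone_words_in_lists: "w \<in> cone_words r \<Longrightarrow> w \<in> lists A"
  by (simp add: cone_words_def)

lemma cone_words_level: "w \<in> cone_words r \<Longrightarrow> level r \<le> level (r \<triangleright> w)"
  by (simp add: cone_words_def)

lemma Nil_cone_words [simp]: "[] \<in> cone_words r"
  by (simp add: cone_words_def)

lemma cone_words_append_iff:
  "u @ v \<in> cone_words r \<longleftrightarrow> u \<in> cone_words r \<and> v \<in> lists A \<and>
     (\<forall>v1 v2. v = v1 @ v2 \<longrightarrow> level r \<le> level (r \<triangleright> u \<triangleright> v1))" (is "?L \<longleftrightarrow> ?R")
proof
  assume L: ?L
  have "level r \<le> level (r \<triangleright> u1)" if "u = u1 @ u2" for u1 u2
    using L that unfolding cone_words_def by auto
  moreover have "level r \<le> level (r \<triangleright> u \<triangleright> v1)" if "v = v1 @ v2" for v1 v2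
    using L that unfolding cone_words_def by (auto dest!: spec[of _ "u @ v1"])
  ultimately show ?R using L unfolding cone_words_def by auto
next
  assume R: ?R
  have "level r \<le> level (r \<triangleright> w1)" if eq: "u @ v = w1 @ w2" for w1 w2
  proof -
    from eq obtain t where "u = w1 @ t \<and> t @ v = w2 \<or> u @ t = w1 \<and> v = t @ w2"
      by (auto simp: append_eq_append_conv2)
    then show ?thesis using R unfolding cone_words_def by auto
  qed
  then show ?L using R unfolding cone_words_def by auto
qed

lemma cone_words_snoc_iff:
  "u @ [a] \<in> cone_words r \<longleftrightarrow> u \<in> cone_words r \<and> a \<in> A \<and> level r \<le> level (r \<triangleright> u \<triangleright> [a])"
proof -
  have "(\<forall>v1 v2. [a] = v1 @ v2 \<longrightarrow> level r \<le> level (r \<triangleright> u \<triangleright> v1)) \<longleftrightarrow>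
      level r \<le> level (r \<triangleright> u) \<and> level r \<le> level (r \<triangleright> u \<triangleright> [a])"
  proof
    assume *: "\<forall>v1 v2. [a] = v1 @ v2 \<longrightarrow> level r \<le> level (r \<triangleright> u \<triangleright> v1)"
    show "level r \<le> level (r \<triangleright> u) \<and> level r \<le> level (r \<triangleright> u \<triangleright> [a])"
      using spec[OF spec[OF *, of "[]"], of "[a]"] spec[OF spec[OF *, of "[a]"], of "[]"] by simp
  qed (auto simp: Cons_eq_append_conv)
  then show ?thesis unfolding cone_words_append_iff using cone_words_level by auto
qed

lemma cone_subset: "r \<in> V \<Longrightarrow> x \<in> cone r \<Longrightarrow> x \<in> V"
  unfolding cone_def using cone_words_in_lists run_in by blast

text \<open>
  A walk in a cone can be walked backwards, so one can change from the base vertex \<open>r'\<close> to another base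
  vertex \<open>r\<close> of the same level through a common vertex of their cones.
\<close>

lemma cone_words_reverse:
  assumes r: "r \<in> V" and r': "r' \<in> V" and lev: "level r' = level r"
    and w: "w \<in> cone_words r" and v: "v \<in> cone_words r'" and eq: "r' \<triangleright> v = r \<triangleright> w"
  shows "v @ winv w \<in> cone_words r'"
  unfolding cone_words_append_iff
proof (intro conjI allI impI)
  show "v \<in> cone_words r'" by (rule v)
  have wA: "w \<in> lists A" using w by (rule cone_words_in_lists)
  then show "winv w \<in> lists A" by simp
  fix v1 v2 assume v12: "winv w = v1 @ v2"
  have "w = winv v2 @ winv v1" using v12 wA by (metis winv_append winv_winv)
  moreover have "v1 \<in> lists A" "v2 \<in> lists A" using v12 wA winv_in by (metis append_in_lists_conv)+
  ultimately have "r \<triangleright> w \<triangleright> v1 = r \<triangleright> winv v2"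
    using r by (simp add: run_winv')
  moreover have "level r \<le> level (r \<triangleright> winv v2)"
    using w \<open>w = winv v2 @ winv v1\<close> cone_words_append_iff cone_words_level by metis
  ultimately show "level r' \<le> level (r' \<triangleright> v \<triangleright> v1)" using eq lev by simp
qed

end

section \<open>Chords of circuits\<close>

locale context_free_action = rooted_action A ainv V act x0
  for A :: "'a set" and ainv and V :: "'v set" and act and x0 +
  fixes P :: "('n \<times> ('n, 'a) symbol list) set" and S :: 'n
  assumes finite_productions: "finite P"
    and circuits: "{w \<in> lists A. x0 \<triangleright> w = x0} = grammar_language P S"
begin

text \<open>
  The form \<open>\<alpha>\<close> spans a chord from \<open>p\<close>: where it leads does not depend on the word derived from it.
  Every node in the parse of a circuit at \<open>x0\<close> is consistent at the point where its factor starts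
  (\<open>consistent_start\<close>, \<open>consistent_split\<close>), because the rest of the circuit acts injectively on
  vertices.
\<close>

definition consistent :: "('n, 'a) symbol list \<Rightarrow> 'v \<Rightarrow> bool" where
  "consistent \<alpha> p \<longleftrightarrow> (\<forall>u v. yields A P \<alpha> u \<longrightarrow> yields A P \<alpha> v \<longrightarrow> p \<triangleright> u = p \<triangleright> v)"

lemma consistentD: "consistent \<alpha> p \<Longrightarrow> yields A P \<alpha> u \<Longrightarrow> yields A P \<alpha> v \<Longrightarrow> p \<triangleright> u = p \<triangleright> v"
  unfolding consistent_def by blast

lemma consistent_start: "consistent [Nonterminal S] x0"
  and circuit_yields: "w \<in> lists A \<Longrightarrow> x0 \<triangleright> w = x0 \<Longrightarrow> yields A P [Nonterminal S] w"
proof -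
  have iff: "yields A P [Nonterminal S] w \<longleftrightarrow> x0 \<triangleright> w = x0" if "w \<in> lists A" for w
  proof -
    have "x0 \<triangleright> w = x0 \<longleftrightarrow> w \<in> grammar_language P S"
      unfolding circuits[symmetric] using that by simp
    also have "\<dots> \<longleftrightarrow> (derives_step P)\<^sup>*\<^sup>* [Nonterminal S] (map Terminal w)"
      by (simp add: grammar_language_def)
    also have "\<dots> \<longleftrightarrow> yields A P [Nonterminal S] w" by (rule derives_iff_yields[OF that])
    finally show ?thesis by simp
  qed
  have to_root: "x0 \<triangleright> u = x0" if "yields A P [Nonterminal S] u" for u
    using iffD1[OF iff[OF yields_in_lists[OF that]] that] .
  show "consistent [Nonterminal S] x0"
    unfolding consistent_def
  proof (intro allI impI)
    fix u v assume "yields A P [Nonterminal S] u" "yields A P [Nonterminal S] v"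
    then show "x0 \<triangleright> u = x0 \<triangleright> v" using to_root[of u] to_root[of v] by simp
  qed
  show "yields A P [Nonterminal S] w" if "w \<in> lists A" "x0 \<triangleright> w = x0"
    by (rule iffD2[OF iff[OF that(1)] that(2)])
qed

lemma consistent_split:
  assumes "p \<in> V" "consistent (Nonterminal X # \<alpha>) p" "(X, \<beta>) \<in> P"
    and u: "yields A P \<beta> u" and v: "yields A P \<alpha> v"
  shows "consistent \<beta> p" "consistent \<alpha> (p \<triangleright> u)"
proof -
  have *: "p \<triangleright> (u' @ v') = p \<triangleright> (u @ v)" if "yields A P \<beta> u'" "yields A P \<alpha> v'" for u' v'
    using assms that by (intro consistentD[OF assms(2)] yields_Nonterminal[OF assms(3)])
  show "consistent \<beta> p"
    unfolding consistent_def
  proof (intro allI impI)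
    fix s t assume st: "yields A P \<beta> s" "yields A P \<beta> t"
    then have "p \<triangleright> s \<triangleright> v = p \<triangleright> t \<triangleright> v" using *[OF _ v] by (metis foldl_append)
    then show "p \<triangleright> s = p \<triangleright> t"
      using run_inj[of "p \<triangleright> s" "p \<triangleright> t" v] st v assms(1) yields_in_lists by (metis run_in)
  qed
  show "consistent \<alpha> (p \<triangleright> u)"
    unfolding consistent_def using *[OF u] by (metis foldl_append)
qed

lemma consistent_tl:
  assumes "a \<in> A" "consistent (Terminal a # \<alpha>) p"
  shows "consistent \<alpha> (act p a)"
  unfolding consistent_def
proof (intro allI impI)
  fix u v assume "yields A P \<alpha> u" "yields A P \<alpha> v"
  then have "p \<triangleright> (a # u) = p \<triangleright> (a # v)"
    using assms(1) by (intro consistentD[OF assms(2)] yields_Terminal)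
  then show "act p a \<triangleright> u = act p a \<triangleright> v" by simp
qed

text \<open>
  A bound for the length of shortest words derived from the finitely many items.
\<close>

definition chord_length :: nat where
  "chord_length = (SOME K. \<forall>\<alpha> \<in> items A P S. \<forall>w. yields A P \<alpha> w \<longrightarrow> (\<exists>v. yields A P \<alpha> v \<and> length v \<le> K))"

lemma chord_length:
  assumes "\<alpha> \<in> items A P S" "yields A P \<alpha> w"
  shows "\<exists>v. yields A P \<alpha> v \<and> length v \<le> chord_length"
proof -
  have "\<exists>K. \<forall>\<alpha> \<in> items A P S. \<forall>w. yields A P \<alpha> w \<longrightarrow> (\<exists>v. yields A P \<alpha> v \<and> length v \<le> K)"
  proof (rule exI, intro ballI allI impI)
    fix \<alpha> w assume a: "\<alpha> \<in> items A P S" "yields A P \<alpha> w"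
    let ?v = "\<lambda>\<alpha>. SOME v. yields A P \<alpha> v"
    have "length (?v \<alpha>) \<le> Max ((\<lambda>\<alpha>. length (?v \<alpha>)) ` items A P S)"
      using a(1) finite_items[OF finite_alphabet finite_productions] by (intro Max_ge) auto
    then show "\<exists>v. yields A P \<alpha> v \<and> length v \<le> Max ((\<lambda>\<alpha>. length (?v \<alpha>)) ` items A P S)"
      using someI[of "yields A P \<alpha>", OF a(2)] by blast
  qed
  from someI_ex[OF this] show ?thesis unfolding chord_length_def using assms by blast
qed

definition near :: "'v \<Rightarrow> 'v \<Rightarrow> bool" where
  "near p q \<longleftrightarrow> (\<exists>y \<in> lists A. length y \<le> chord_length \<and> p \<triangleright> y = q)"

lemma near_refl: "near p p"
  unfolding near_def by (intro bexI[of _ "[]"]) auto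

lemma near_sym: "p \<in> V \<Longrightarrow> near p q \<Longrightarrow> near q p"
  unfolding near_def using run_winv winv_in length_winv by metis

lemma near_yields:
  assumes "\<alpha> \<in> items A P S" "consistent \<alpha> p" "yields A P \<alpha> w"
  shows "near p (p \<triangleright> w)"
proof -
  obtain v where "yields A P \<alpha> v" "length v \<le> chord_length" using chord_length[OF assms(1,3)] by blast
  then show ?thesis
    unfolding near_def using consistentD[OF assms(2,3)] yields_in_lists by metis
qed

text \<open>
  The walk from \<open>p\<close> labelled \<open>w\<close> is cut into chords, all cut points strictly between its ends lying in \<open>N\<close>.
  The ends are left free so that chains can be concatenated at a point of \<open>N\<close>.
\<close>

inductive chain :: "'v set \<Rightarrow> 'v \<Rightarrow> 'a list \<Rightarrow> bool" for N where
  chain_one: "\<alpha> \<in> items A P S \<Longrightarrow> consistent \<alpha> p \<Longrightarrow> yields A P \<alpha> w \<Longrightarrow> chain N p w"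
| chain_step: "\<alpha> \<in> items A P S \<Longrightarrow> consistent \<alpha> p \<Longrightarrow> yields A P \<alpha> u \<Longrightarrow> p \<triangleright> u \<in> N \<Longrightarrow>
    chain N (p \<triangleright> u) v \<Longrightarrow> chain N p (u @ v)"

lemma chain_append:
  "chain N p u \<Longrightarrow> p \<triangleright> u \<in> N \<Longrightarrow> chain N (p \<triangleright> u) v \<Longrightarrow> chain N p (u @ v)"
proof (induction rule: chain.induct)
  case (chain_one \<alpha> p w)
  then show ?case by (intro chain_step)
next
  case (chain_step \<alpha> p u w)
  then show ?case using chain.chain_step[of \<alpha> p u N "w @ v"] by simp
qed

lemma chain_restrict:
  "chain N p w \<Longrightarrow> (\<And>u v. w = u @ v \<Longrightarrow> p \<triangleright> u \<in> N \<Longrightarrow> p \<triangleright> u \<in> M) \<Longrightarrow> chain M p w"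
proof (induction rule: chain.induct)
  case (chain_one \<alpha> p w)
  then show ?case by (intro chain.chain_one)
next
  case (chain_step \<alpha> p u v)
  have "chain M (p \<triangleright> u) v"
  proof (rule chain_step.IH)
    fix v1 v2 assume "v = v1 @ v2" "p \<triangleright> u \<triangleright> v1 \<in> N"
    then show "p \<triangleright> u \<triangleright> v1 \<in> M" using chain_step.prems[of "u @ v1" v2] by simp
  qed
  moreover have "p \<triangleright> u \<in> M" using chain_step.prems[of u v] chain_step.hyps by simp
  ultimately show ?case using chain_step.hyps by (intro chain.chain_step)
qed

text \<open>
  If a node of the parse covers \<open>u @ w\<close>, then the maximal nodes inside \<open>w\<close> hang off the path of nodes that
  contain the boundary between \<open>u\<close> and \<open>w\<close>. The nodes of this path start on \<open>u\<close>, so their subnodes cut \<open>w\<close> at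
  points that a chord joins to \<open>u\<close>.
\<close>

lemma chain_left:
  assumes "yields A P \<alpha> z" "\<alpha> \<in> items A P S" "consistent \<alpha> p" "p \<in> V" "z = u @ w"
    and "\<And>u1 u2 b. u = u1 @ u2 \<Longrightarrow> near (p \<triangleright> u1) b \<Longrightarrow> b \<in> N"
  shows "chain N (p \<triangleright> u) w"
  using assms
proof (induction arbitrary: p u w rule: yields.induct)
  case yields_Nil
  from yields_Nil.prems(1-4) show ?case by (auto intro!: chain_one[of "[]"] yields.yields_Nil)
next
  case (yields_Terminal a \<alpha> z)
  show ?case
  proof (cases u)
    case Nil
    then show ?thesis
      using yields_Terminal.prems(1,2,4) yields_Terminal.hyps
      by (auto intro!: chain_one yields.yields_Terminal)
  next
    case (Cons b u')
    with yields_Terminal.prems(4) have u: "u = a # u'" "z = u' @ w" by auto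
    have "chain N (act p a \<triangleright> u') w"
    proof (rule yields_Terminal.IH[OF _ _ _ u(2)])
      show "\<alpha> \<in> items A P S" by (rule items_tl[OF yields_Terminal.prems(1)])
      show "consistent \<alpha> (act p a)"
        by (rule consistent_tl[OF yields_Terminal.hyps(1) yields_Terminal.prems(2)])
      show "act p a \<in> V" by (rule act_in[OF yields_Terminal.prems(3) yields_Terminal.hyps(1)])
      fix u1 u2 b assume "u' = u1 @ u2" "near (act p a \<triangleright> u1) b"
      then show "b \<in> N" using yields_Terminal.prems(5)[of "a # u1" u2 b] u by simp
    qed
    with u show ?thesis by simp
  qed
next
  case (yields_Nonterminal X \<beta> z1 \<alpha> z2)
  note split = consistent_split[OF yields_Nonterminal.prems(3,2) yields_Nonterminal.hyps]
  have \<beta>: "\<beta> \<in> items A P S" and \<alpha>: "\<alpha> \<in> items A P S"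
    using production_in_items[OF yields_Nonterminal.hyps(1)] items_tl[OF yields_Nonterminal.prems(1)] .
  from yields_Nonterminal.prems(4) consider
    (left) t where "z1 = u @ t" "w = t @ z2" | (right) t where "u = z1 @ t" "z2 = t @ w"
    by (auto simp: append_eq_append_conv2)
  then show ?case
  proof cases
    case left
    have 1: "chain N (p \<triangleright> u) t"
      by (rule yields_Nonterminal.IH(1)[OF \<beta> split(1) yields_Nonterminal.prems(3) left(1)
            yields_Nonterminal.prems(5)])
    have "near p (p \<triangleright> z1)" by (rule near_yields[OF \<beta> split(1) yields_Nonterminal.hyps(2)])
    then have 2: "p \<triangleright> z1 \<in> N" using yields_Nonterminal.prems(5)[of "[]" u] by simp
    have 3: "chain N (p \<triangleright> z1) z2" by (rule chain_one[OF \<alpha> split(2) yields_Nonterminal.hyps(3)])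
    show ?thesis using chain_append[OF 1] 2 3 left by simp
  next
    case right
    have "chain N (p \<triangleright> z1 \<triangleright> t) w"
    proof (rule yields_Nonterminal.IH(2)[OF \<alpha> split(2) _ right(2)])
      show "p \<triangleright> z1 \<in> V" 
    by (rule run_in[OF yields_Nonterminal.prems(3) yields_in_lists[OF yields_Nonterminal.hyps(2)]])
      fix u1 u2 b assume "t = u1 @ u2" "near (p \<triangleright> z1 \<triangleright> u1) b"
      then show "b \<in> N" using yields_Nonterminal.prems(5)[of "z1 @ u1" u2 b] right by simp
    qed
    with right show ?thesis by simp
  qed
qed

text \<open>
  The mirror image of \<open>chain_left\<close>: cut points are joined by a chord to a point of \<open>v\<close>.
\<close>

lemma chain_right:
  assumes "yields A P \<alpha> z" "\<alpha> \<in> items A P S" "consistent \<alpha> p" "p \<in> V" "z = w @ v"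
    and "\<And>v1 v2 b. v = v1 @ v2 \<Longrightarrow> near (p \<triangleright> w \<triangleright> v1) b \<Longrightarrow> b \<in> N"
  shows "chain N p w"
  using assms
proof (induction arbitrary: p v w rule: yields.induct)
  case yields_Nil
  from yields_Nil.prems(1-4) show ?case by (auto intro!: chain_one[of "[]"] yields.yields_Nil)
next
  case (yields_Terminal a \<alpha> z)
  show ?case
  proof (cases w)
    case Nil
    then show ?thesis
      by (auto intro!: chain_one[of "[]"] Nil_in_items simp: consistent_def yields_Nil_iff)
  next
    case (Cons b w')
    with yields_Terminal.prems(4) have w: "w = a # w'" "z = w' @ v" by auto
    have \<alpha>: "\<alpha> \<in> items A P S" "consistent \<alpha> (act p a)" "act p a \<in> V"
      using items_tl[OF yields_Terminal.prems(1)]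
        consistent_tl[OF yields_Terminal.hyps(1) yields_Terminal.prems(2)]
        act_in[OF yields_Terminal.prems(3) yields_Terminal.hyps(1)] .
    have "chain N (act p a) w'"
    proof (rule yields_Terminal.IH[OF \<alpha> w(2)])
      fix v1 v2 b assume "v = v1 @ v2" "near (act p a \<triangleright> w' \<triangleright> v1) b"
      then show "b \<in> N" using yields_Terminal.prems(5)[of v1 v2 b] w by simp
    qed
    moreover have "chain N p [a]"
    proof (rule chain_one)
      show "[Terminal a] \<in> items A P S" by (rule letter_in_items[OF yields_Terminal.hyps(1)])
      show "yields A P [Terminal a] [a]"
        by (rule yields.yields_Terminal[OF yields_Terminal.hyps(1) yields.yields_Nil])
      show "consistent [Terminal a] p"
        unfolding consistent_def by (auto dest!: yields_letterD)
    qed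
    moreover have "act p a \<in> N"
    proof -
      have "near (act p a) (act p a \<triangleright> z)" by (rule near_yields[OF \<alpha>(1,2) yields_Terminal.hyps(2)])
      then have "near (act p a \<triangleright> w' \<triangleright> v) (act p a)" using w near_sym[OF \<alpha>(3)] by simp
      then show ?thesis using yields_Terminal.prems(5)[of v "[]"] w by simp
    qed
    ultimately show ?thesis using chain_append[of N p "[a]" w'] w by simp
  qed
next
  case (yields_Nonterminal X \<beta> z1 \<alpha> z2)
  note split = consistent_split[OF yields_Nonterminal.prems(3,2) yields_Nonterminal.hyps]
  have \<beta>: "\<beta> \<in> items A P S" and \<alpha>: "\<alpha> \<in> items A P S"
    using production_in_items[OF yields_Nonterminal.hyps(1)] items_tl[OF yields_Nonterminal.prems(1)] .
  have z1V: "p \<triangleright> z1 \<in> V" 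
    by (rule run_in[OF yields_Nonterminal.prems(3) yields_in_lists[OF yields_Nonterminal.hyps(2)]])
  from yields_Nonterminal.prems(4) consider
    (left) t where "z1 = w @ t" "v = t @ z2" | (right) t where "w = z1 @ t" "z2 = t @ v"
    by (auto simp: append_eq_append_conv2)
  then show ?case
  proof cases
    case left
    show ?thesis
    proof (rule yields_Nonterminal.IH(1)[OF \<beta> split(1) yields_Nonterminal.prems(3) left(1)])
      fix v1 v2 b assume "t = v1 @ v2" "near (p \<triangleright> w \<triangleright> v1) b"
      then show "b \<in> N" using yields_Nonterminal.prems(5)[of v1 "v2 @ z2" b] left by simp
    qed
  next
    case right
    have 1: "chain N (p \<triangleright> z1) t"
    proof (rule yields_Nonterminal.IH(2)[OF \<alpha> split(2) z1V right(2)])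
      fix v1 v2 b assume "v = v1 @ v2" "near (p \<triangleright> z1 \<triangleright> t \<triangleright> v1) b"
      then show "b \<in> N" using yields_Nonterminal.prems(5)[of v1 v2 b] right by simp
    qed
    have "near (p \<triangleright> z1) (p \<triangleright> z1 \<triangleright> z2)" by (rule near_yields[OF \<alpha> split(2) yields_Nonterminal.hyps(3)])
    then have "near (p \<triangleright> w \<triangleright> v) (p \<triangleright> z1)" using right near_sym[OF z1V] by simp
    then have 2: "p \<triangleright> z1 \<in> N" using yields_Nonterminal.prems(5)[of v "[]"] by simp
    have "chain N p z1" by (rule chain_one[OF \<beta> split(1) yields_Nonterminal.hyps(2)])
    from chain_append[OF this 2 1] right show ?thesis by simp
  qed
qed

text \<open>
  Some point of the middle part \<open>w\<close> of the walk from \<open>p\<close> labelled \<open>u @ w @ v\<close> is joined by short chords to both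
  outer parts.
\<close>

definition touches_both :: "'v \<Rightarrow> 'a list \<Rightarrow> 'a list \<Rightarrow> 'a list \<Rightarrow> bool" where
  "touches_both p u w v \<longleftrightarrow> (\<exists>u1 u2 w1 w2 v1 v2. u = u1 @ u2 \<and> w = w1 @ w2 \<and> v = v1 @ v2 \<and>
     near (p \<triangleright> u1) (p \<triangleright> (u @ w1)) \<and> near (p \<triangleright> (u @ w @ v1)) (p \<triangleright> (u @ w1)))"

lemma touches_bothI:
  "u = u1 @ u2 \<Longrightarrow> w = w1 @ w2 \<Longrightarrow> v = v1 @ v2 \<Longrightarrow> near (p \<triangleright> u1) (p \<triangleright> (u @ w1)) \<Longrightarrow>
   near (p \<triangleright> (u @ w @ v1)) (p \<triangleright> (u @ w1)) \<Longrightarrow> touches_both p u w v"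
  unfolding touches_both_def by blast

lemma touches_both_extend:
  assumes "touches_both (p \<triangleright> x) u w v"
  shows "touches_both p (x @ u) w (v @ y)"
proof -
  from assms obtain u1 u2 w1 w2 v1 v2 where
    "u = u1 @ u2" "w = w1 @ w2" "v = v1 @ v2"
    "near (p \<triangleright> x \<triangleright> u1) (p \<triangleright> x \<triangleright> (u @ w1))" "near (p \<triangleright> x \<triangleright> (u @ w @ v1)) (p \<triangleright> x \<triangleright> (u @ w1))"
    unfolding touches_both_def by blast
  then show ?thesis
    by (intro touches_bothI[of _ "x @ u1" u2 _ w1 w2 _ v1 "v2 @ y"]) simp_all
qed

text \<open>
  Descend in the parse to the last node that still covers all of \<open>w\<close>. A cut between its children that falls
  inside \<open>w\<close> yields the point near both sides; to the left of it \<open>chain_left\<close> applies, to the right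
  of it \<open>chain_right\<close>. If the descent instead exhausts \<open>u\<close> (or \<open>v\<close>), the node begins where \<open>w\<close> begins
  (ends where \<open>w\<close> ends), and its own chord joins that end of \<open>w\<close> to the other side.
\<close>

lemma chain_middle:
  assumes "yields A P \<alpha> z" "\<alpha> \<in> items A P S" "consistent \<alpha> p" "p \<in> V" "z = u @ w @ v"
    and "\<And>u1 u2 b. u = u1 @ u2 \<Longrightarrow> near (p \<triangleright> u1) b \<Longrightarrow> b \<in> N"
    and "\<And>v1 v2 b. v = v1 @ v2 \<Longrightarrow> near (p \<triangleright> (u @ w @ v1)) b \<Longrightarrow> b \<in> N"
  shows "chain N (p \<triangleright> u) w \<and> touches_both p u w v"
  using assms
proof (induction arbitrary: p u w v rule: yields.induct)
  case yields_Nil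
  from yields_Nil.prems(1-4) show ?case
    by (auto intro!: chain_one[of "[]"] yields.yields_Nil touches_bothI near_refl)
next
  case (yields_Terminal a \<alpha> z)
  have near_end: "near p (p \<triangleright> (a # z))"
    by (rule near_yields[OF yields_Terminal.prems(1,2) yields.yields_Terminal[OF yields_Terminal.hyps]])
  show ?case
  proof (cases u)
    case Nil
    have "chain N p w"
    proof (rule chain_right[OF yields.yields_Terminal[OF yields_Terminal.hyps] yields_Terminal.prems(1-3)])
      show "a # z = w @ v" using yields_Terminal.prems(4) Nil by simp
      fix v1 v2 b assume "v = v1 @ v2" "near (p \<triangleright> w \<triangleright> v1) b"
      then show "b \<in> N" using yields_Terminal.prems(6)[of v1 v2 b] Nil by simp
    qed
    moreover have "touches_both p [] w v"
      using yields_Terminal.prems(4) Nil near_sym[OF yields_Terminal.prems(3) near_end] near_refl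
      by (intro touches_bothI[of _ "[]" "[]" _ "[]" w _ v "[]"]) simp_all
    ultimately show ?thesis using Nil by simp
  next
    case (Cons b u')
    with yields_Terminal.prems(4) have u: "u = a # u'" "z = u' @ w @ v" by auto
    have \<alpha>: "\<alpha> \<in> items A P S" "consistent \<alpha> (act p a)" "act p a \<in> V"
      using items_tl[OF yields_Terminal.prems(1)]
        consistent_tl[OF yields_Terminal.hyps(1) yields_Terminal.prems(2)]
        act_in[OF yields_Terminal.prems(3) yields_Terminal.hyps(1)] .
    have "chain N (act p a \<triangleright> u') w \<and> touches_both (act p a) u' w v"
    proof (rule yields_Terminal.IH[OF \<alpha> u(2)])
      fix u1 u2 b assume "u' = u1 @ u2" "near (act p a \<triangleright> u1) b"
      then show "b \<in> N" using yields_Terminal.prems(5)[of "a # u1" u2 b] u by simp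
    next
      fix v1 v2 b assume "v = v1 @ v2" "near (act p a \<triangleright> (u' @ w @ v1)) b"
      then show "b \<in> N" using yields_Terminal.prems(6)[of v1 v2 b] u by simp
    qed
    then show ?thesis using touches_both_extend[of p "[a]" u' w v "[]"] u by simp
  qed
next
  case (yields_Nonterminal X \<beta> z1 \<alpha> z2)
  note split = consistent_split[OF yields_Nonterminal.prems(3,2) yields_Nonterminal.hyps]
  have \<beta>: "\<beta> \<in> items A P S" and \<alpha>: "\<alpha> \<in> items A P S"
    using production_in_items[OF yields_Nonterminal.hyps(1)] items_tl[OF yields_Nonterminal.prems(1)] .
  have z1V: "p \<triangleright> z1 \<in> V" 
    by (rule run_in[OF yields_Nonterminal.prems(3) yields_in_lists[OF yields_Nonterminal.hyps(2)]])
  from yields_Nonterminal.prems(4) consider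
    (outer_left) t where "u = z1 @ t" "z2 = t @ w @ v"
    | (outer_right) t where "z1 = u @ w @ t" "v = t @ z2"
    | (across) s t where "w = s @ t" "z1 = u @ s" "z2 = t @ v"
    by (auto simp: append_eq_append_conv2)
  then show ?case
  proof cases
    case outer_left
    have "chain N (p \<triangleright> z1 \<triangleright> t) w \<and> touches_both (p \<triangleright> z1) t w v"
    proof (rule yields_Nonterminal.IH(2)[OF \<alpha> split(2) z1V outer_left(2)])
      fix u1 u2 b assume "t = u1 @ u2" "near (p \<triangleright> z1 \<triangleright> u1) b"
      then show "b \<in> N" using yields_Nonterminal.prems(5)[of "z1 @ u1" u2 b] outer_left by simp
    next
      fix v1 v2 b assume "v = v1 @ v2" "near (p \<triangleright> z1 \<triangleright> (t @ w @ v1)) b"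
      then show "b \<in> N" using yields_Nonterminal.prems(6)[of v1 v2 b] outer_left by simp
    qed
    then show ?thesis using touches_both_extend[of p z1 t w v "[]"] outer_left by simp
  next
    case outer_right
    have "chain N (p \<triangleright> u) w \<and> touches_both p u w t"
    proof (rule yields_Nonterminal.IH(1)[OF \<beta> split(1) yields_Nonterminal.prems(3) outer_right(1)
          yields_Nonterminal.prems(5)])
      fix v1 v2 b assume "t = v1 @ v2" "near (p \<triangleright> (u @ w @ v1)) b"
      then show "b \<in> N" using yields_Nonterminal.prems(6)[of v1 "v2 @ z2" b] outer_right by simp
    qed
    then show ?thesis using touches_both_extend[of p "[]" u w t z2] outer_right by simp
  next
    case across
    have left: "chain N (p \<triangleright> u) s"
      by (rule chain_left[OF yields_Nonterminal.hyps(2) \<beta> split(1) yields_Nonterminal.prems(3) across(2)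
            yields_Nonterminal.prems(5)])
    have right: "chain N (p \<triangleright> z1) t"
    proof (rule chain_right[OF yields_Nonterminal.hyps(3) \<alpha> split(2) z1V across(3)])
      fix v1 v2 b assume "v = v1 @ v2" "near (p \<triangleright> z1 \<triangleright> t \<triangleright> v1) b"
      then show "b \<in> N" using yields_Nonterminal.prems(6)[of v1 v2 b] across by simp
    qed
    have n1: "near p (p \<triangleright> z1)" by (rule near_yields[OF \<beta> split(1) yields_Nonterminal.hyps(2)])
    have n2: "near (p \<triangleright> z1 \<triangleright> z2) (p \<triangleright> z1)"
      by (rule near_sym[OF z1V near_yields[OF \<alpha> split(2) yields_Nonterminal.hyps(3)]])
    have "p \<triangleright> z1 \<in> N" using yields_Nonterminal.prems(5)[of "[]" u] n1 by simp
    then have "chain N (p \<triangleright> u) w" using chain_append[OF left] right across by simp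
    moreover have "touches_both p u w v"
      using n1 n2 across by (intro touches_bothI[of _ "[]" u _ s t _ v "[]"]) simp_all
    ultimately show ?thesis by simp
  qed
qed

text \<open>
  A point \<open>b\<close> that is not below \<open>y\<close> can be close to a geodesic from the root to \<open>y\<close> only near the end of
  that geodesic.
\<close>

lemma geodesic_near:
  assumes y: "y \<in> V" and t: "x0 \<triangleright> (t1 @ t2) = y" "length (t1 @ t2) = level y" "t1 \<in> lists A" "t2 \<in> lists A"
    and b: "near (x0 \<triangleright> t1) b" "level y \<le> level b"
  shows "\<exists>s \<in> lists A. length s \<le> 2 * chord_length \<and> y \<triangleright> s = b"
proof -
  obtain s where s: "s \<in> lists A" "length s \<le> chord_length" "x0 \<triangleright> t1 \<triangleright> s = b"
    using b(1) unfolding near_def by blast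
  have "level b \<le> length t1 + length s"
    using level_root_run[of "t1 @ s"] s t(3) by auto
  with b(2) t(2) s(2) have len: "length t2 \<le> chord_length" by simp
  have "y \<triangleright> winv t2 = x0 \<triangleright> t1" using t(1,3,4) run_winv[of "x0 \<triangleright> t1" t2] root_in by simp
  then show ?thesis using s t len by (intro bexI[of _ "winv t2 @ s"]) auto
qed

text \<open>
  A walk inside a cone between two vertices of its bottom level, closed up by two geodesics from the
  root. Its points are not below \<open>x\<close>, so chords to the geodesics end near \<open>x\<close> or near the end \<open>y\<close> of the walk
  (\<open>geodesic_near\<close>), each at distance at most twice the length of a chord. The point near both sides then bounds
  the distance of \<open>x\<close> and \<open>y\<close> by four chords, and every cut point is within six chords of \<open>x\<close>.
\<close>

lemma frontier:
  assumes x: "x \<in> V" and w: "w \<in> cone_words x" and lev: "level (x \<triangleright> w) = level x"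
  shows "chain {x \<triangleright> y | y. y \<in> lists A \<and> length y \<le> 6 * chord_length} x w"
    and "\<exists>y \<in> lists A. length y \<le> 4 * chord_length \<and> x \<triangleright> w = x \<triangleright> y"
proof -
  let ?y = "x \<triangleright> w"
  have wA: "w \<in> lists A" using w by (rule cone_words_in_lists)
  with x have y: "?y \<in> V" by (rule run_in)
  obtain u where u: "u \<in> lists A" "length u = level x" "x0 \<triangleright> u = x" using ex_geodesic[OF x] by blast
  obtain t where t: "t \<in> lists A" "length t = level ?y" "x0 \<triangleright> t = ?y" using ex_geodesic[OF y] by blast
  define v where "v = winv t"
  have tv: "t = winv v" using t(1) by (simp add: v_def winv_winv)
  have vA: "v \<in> lists A" using t(1) by (simp add: v_def)
  \<comment> \<open>a prefix of the return path ends where a prefix of the geodesic to the end of the walk does\<close>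
  have split_v: "x \<triangleright> w \<triangleright> v1 = x0 \<triangleright> winv v2 \<and> t = winv v2 @ winv v1 \<and> winv v1 \<in> lists A \<and> winv v2 \<in> lists A"
    if "v = v1 @ v2" for v1 v2
  proof -
    have A: "v1 \<in> lists A" "v2 \<in> lists A" using that vA by auto
    have teq: "t = winv v2 @ winv v1" using tv that by (simp add: winv_append)
    then have "x0 \<triangleright> winv v2 \<triangleright> winv v1 = ?y" using t(3) by simp
    then have "?y \<triangleright> v1 = x0 \<triangleright> winv v2"
      using run_winv'[of "x0 \<triangleright> winv v2" v1] A root_in by (metis run_in winv_in)
    with teq A show ?thesis by (auto intro: winv_in)
  qed
  have "x0 \<triangleright> (u @ w @ v) = x0" using split_v[of v "[]"] u(3) by (simp add: winv_def)
  then have "yields A P [Nonterminal S] (u @ w @ v)"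
    using u(1) wA vA by (intro circuit_yields) auto
  \<comment> \<open>the points joined by a chord to one of the two geodesics\<close>
  define N where "N = {b. \<exists>u1 u2. u = u1 @ u2 \<and> near (x0 \<triangleright> u1) b} \<union>
     {b. \<exists>v1 v2. v = v1 @ v2 \<and> near (x \<triangleright> w \<triangleright> v1) b}"
  have main: "chain N (x0 \<triangleright> u) w \<and> touches_both x0 u w v"
    using u(3) by (intro chain_middle[OF \<open>yields A P _ _\<close> start_in_items consistent_start root_in refl])
      (auto simp: N_def)
  have above: "level x \<le> level (x \<triangleright> w1)" if "w = w1 @ w2" for w1 w2
    using w that unfolding cone_words_def by blast
  have near_u: "\<exists>s \<in> lists A. length s \<le> 2 * chord_length \<and> x \<triangleright> s = b"
    if "u = u1 @ u2" "near (x0 \<triangleright> u1) b" "level x \<le> level b" for u1 u2 b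
    using geodesic_near[OF x, of u1 u2 b] that u by auto
  have near_v: "\<exists>s \<in> lists A. length s \<le> 2 * chord_length \<and> ?y \<triangleright> s = b"
    if "v = v1 @ v2" "near (x \<triangleright> w \<triangleright> v1) b" "level x \<le> level b" for v1 v2 b
    using geodesic_near[OF y, of "winv v2" "winv v1" b] split_v[OF that(1)] that t lev by auto
  show short: "\<exists>y \<in> lists A. length y \<le> 4 * chord_length \<and> x \<triangleright> w = x \<triangleright> y"
  proof -
    from main obtain u1 u2 w1 w2 v1 v2 where b: "u = u1 @ u2" "w = w1 @ w2" "v = v1 @ v2"
      "near (x0 \<triangleright> u1) (x \<triangleright> w1)" "near (x \<triangleright> w \<triangleright> v1) (x \<triangleright> w1)"
      unfolding touches_both_def using u(3) by auto
    obtain s where s: "s \<in> lists A" "length s \<le> 2 * chord_length" "x \<triangleright> s = x \<triangleright> w1"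
      using near_u[OF b(1,4) above[OF b(2)]] by blast
    obtain s' where s': "s' \<in> lists A" "length s' \<le> 2 * chord_length" "?y \<triangleright> s' = x \<triangleright> w1"
      using near_v[OF b(3,5) above[OF b(2)]] by blast
    have "x \<triangleright> w1 \<triangleright> winv s' = ?y" using run_winv[OF y s'(1)] s'(3) by simp
    then show ?thesis using s s' by (intro bexI[of _ "s @ winv s'"]) auto
  qed
  show "chain {x \<triangleright> y | y. y \<in> lists A \<and> length y \<le> 6 * chord_length} x w"
  proof -
    obtain y where y4: "y \<in> lists A" "length y \<le> 4 * chord_length" "x \<triangleright> w = x \<triangleright> y" using short by blast
    have "x \<triangleright> w1 \<in> {x \<triangleright> y | y. y \<in> lists A \<and> length y \<le> 6 * chord_length}"
      if eq: "w = w1 @ w2" and "x \<triangleright> w1 \<in> N" for w1 w2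
    proof -
      from \<open>x \<triangleright> w1 \<in> N\<close> consider (u) u1 u2 where "u = u1 @ u2" "near (x0 \<triangleright> u1) (x \<triangleright> w1)"
        | (v) v1 v2 where "v = v1 @ v2" "near (x \<triangleright> w \<triangleright> v1) (x \<triangleright> w1)"
        unfolding N_def by blast
      then show ?thesis
      proof cases
        case u
        obtain s where "s \<in> lists A" "length s \<le> 2 * chord_length" "x \<triangleright> s = x \<triangleright> w1"
          using near_u[OF u above[OF eq]] by blast
        then show ?thesis by (intro CollectI exI[of _ s]) auto
      next
        case v
        obtain s where "s \<in> lists A" "length s \<le> 2 * chord_length" "?y \<triangleright> s = x \<triangleright> w1"
          using near_v[OF v above[OF eq]] by blast
        then show ?thesis using y4 by (intro CollectI exI[of _ "y @ s"]) auto
      qed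
    qed
    then show ?thesis using chain_restrict[OF conjunct1[OF main]] u(3) by simp
  qed
qed

section \<open>Finitely many cone types\<close>

text \<open>
  What the transfer lemmas below need to know about the ball around \<open>x\<close>: which short words lead to the same vertex,
  which items are consistent at their ends, and how the levels of these ends compare with that of \<open>x\<close>. The
  radius covers a cut point of \<open>frontier\<close> (six chords) followed by one more chord or one more letter.
\<close>

definition profile where
  "profile x = (let B = {w \<in> lists A. length w \<le> 7 * chord_length + 1} in
     ({(y, z). y \<in> B \<and> z \<in> B \<and> x \<triangleright> y = x \<triangleright> z},
      {(y, \<alpha>). y \<in> B \<and> \<alpha> \<in> items A P S \<and> consistent \<alpha> (x \<triangleright> y)},
      {y \<in> B. level x \<le> level (x \<triangleright> y)}, {y \<in> B. level (x \<triangleright> y) = level x}))"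

lemma finite_profiles: "finite (profile ` V)"
proof (rule finite_subset)
  define B where "B = {w \<in> lists A. length w \<le> 7 * chord_length + 1}"
  have "B = {w. set w \<subseteq> A \<and> length w \<le> 7 * chord_length + 1}" by (auto simp: B_def)
  then have "finite B" using finite_lists_length_le[OF finite_alphabet] by simp
  then show "finite (Pow (B \<times> B) \<times> Pow (B \<times> items A P S) \<times> Pow B \<times> Pow B)"
    using finite_items[OF finite_alphabet finite_productions] by simp
  show "profile ` V \<subseteq> Pow (B \<times> B) \<times> Pow (B \<times> items A P S) \<times> Pow B \<times> Pow B"
    unfolding profile_def Let_def B_def[symmetric] by blast
qed

lemma profileD:
  assumes "profile x = profile x'" "y \<in> lists A" "length y \<le> 7 * chord_length + 1"
  shows profile_eqD: "z \<in> lists A \<Longrightarrow> length z \<le> 7 * chord_length + 1 \<Longrightarrow> x \<triangleright> y = x \<triangleright> z \<Longrightarrow> x' \<triangleright> y = x' \<triangleright> z"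
    and profile_consistentD: "\<alpha> \<in> items A P S \<Longrightarrow> consistent \<alpha> (x \<triangleright> y) \<Longrightarrow> consistent \<alpha> (x' \<triangleright> y)"
    and profile_leD: "level x \<le> level (x \<triangleright> y) \<Longrightarrow> level x' \<le> level (x' \<triangleright> y)"
    and profile_levelD: "level (x \<triangleright> y) = level x \<Longrightarrow> level (x' \<triangleright> y) = level x'"
proof -
  define B where "B = {w \<in> lists A. length w \<le> 7 * chord_length + 1}"
  have y: "y \<in> B" using assms by (simp add: B_def)
  note eq = assms(1)[unfolded profile_def Let_def B_def[symmetric] prod.inject]
  show "x' \<triangleright> y = x' \<triangleright> z" if "z \<in> lists A" "length z \<le> 7 * chord_length + 1" "x \<triangleright> y = x \<triangleright> z"
  proof -
    have "(y, z) \<in> {(y, z). y \<in> B \<and> z \<in> B \<and> x \<triangleright> y = x \<triangleright> z}" using y that by (simp add: B_def)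
    then show ?thesis unfolding conjunct1[OF eq] by simp
  qed
  show "consistent \<alpha> (x' \<triangleright> y)" if "\<alpha> \<in> items A P S" "consistent \<alpha> (x \<triangleright> y)"
  proof -
    have "(y, \<alpha>) \<in> {(y, \<alpha>). y \<in> B \<and> \<alpha> \<in> items A P S \<and> consistent \<alpha> (x \<triangleright> y)}" using y that by simp
    then show ?thesis unfolding conjunct1[OF conjunct2[OF eq]] by simp
  qed
  show "level x' \<le> level (x' \<triangleright> y)" if "level x \<le> level (x \<triangleright> y)"
  proof -
    have "y \<in> {y \<in> B. level x \<le> level (x \<triangleright> y)}" using y that by simp
    then show ?thesis unfolding conjunct1[OF conjunct2[OF conjunct2[OF eq]]] by simp
  qed
  show "level (x' \<triangleright> y) = level x'" if "level (x \<triangleright> y) = level x"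
  proof -
    have "y \<in> {y \<in> B. level (x \<triangleright> y) = level x}" using y that by simp
    then show ?thesis unfolding conjunct2[OF conjunct2[OF conjunct2[OF eq]]] by simp
  qed
qed

text \<open>
  Consistency allows to replace the word derived from \<open>\<alpha>\<close>, of any length, by one that the profile sees.
\<close>

lemma segment_transfer:
  assumes eq: "profile x = profile x'"
    and \<alpha>: "\<alpha> \<in> items A P S" "consistent \<alpha> (x \<triangleright> y)" "yields A P \<alpha> u"
    and y: "y \<in> lists A" "length y \<le> 6 * chord_length" and z: "z \<in> lists A" "length z \<le> 6 * chord_length"
    and xu: "x \<triangleright> y \<triangleright> u = x \<triangleright> z"
  shows "x' \<triangleright> y \<triangleright> u = x' \<triangleright> z"
proof -
  obtain v where v: "yields A P \<alpha> v" "length v \<le> chord_length" using chord_length[OF \<alpha>(1,3)] by blast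
  have vA: "v \<in> lists A" using v(1) by (rule yields_in_lists)
  have "x \<triangleright> (y @ v) = x \<triangleright> z" using consistentD[OF \<alpha>(2,3) v(1)] xu by simp
  then have "x' \<triangleright> (y @ v) = x' \<triangleright> z"
    using y z v(2) vA by (intro profile_eqD[OF eq]) auto
  moreover have "consistent \<alpha> (x' \<triangleright> y)"
    using y \<alpha> by (intro profile_consistentD[OF eq]) auto
  ultimately show ?thesis using consistentD[OF _ \<alpha>(3) v(1), of "x' \<triangleright> y"] by simp
qed

lemma chain_transfer:
  assumes "chain N p w" and eq: "profile x = profile x'"
    and N: "\<And>b. b \<in> N \<Longrightarrow> \<exists>y \<in> lists A. length y \<le> 6 * chord_length \<and> b = x \<triangleright> y"
    and "p = x \<triangleright> y" "y \<in> lists A" "length y \<le> 6 * chord_length"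
    and "p \<triangleright> w = x \<triangleright> z" "z \<in> lists A" "length z \<le> 6 * chord_length"
  shows "x' \<triangleright> y \<triangleright> w = x' \<triangleright> z"
  using assms(1,4-)
proof (induction arbitrary: y rule: chain.induct)
  case (chain_one \<alpha> p w)
  then show ?case by (intro segment_transfer[OF eq]) auto
next
  case (chain_step \<alpha> p u v)
  obtain y' where y': "y' \<in> lists A" "length y' \<le> 6 * chord_length" "p \<triangleright> u = x \<triangleright> y'"
    using N chain_step.hyps by blast
  have "x' \<triangleright> y \<triangleright> u = x' \<triangleright> y'"
    using chain_step y' by (intro segment_transfer[OF eq chain_step.hyps(1)]) auto
  moreover have "x' \<triangleright> y' \<triangleright> v = x' \<triangleright> z"
    using chain_step.prems y' by (intro chain_step.IH) auto
  ultimately show ?case by simp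
qed

lemma frontier_transfer:
  assumes eq: "profile x = profile x'" and x: "x \<in> V" and w: "w \<in> cone_words x"
    and lev: "level (x \<triangleright> w) = level x"
    and z: "z \<in> lists A" "length z \<le> 6 * chord_length" "x \<triangleright> w = x \<triangleright> z"
  shows "x' \<triangleright> w = x' \<triangleright> z"
proof -
  have "x' \<triangleright> [] \<triangleright> w = x' \<triangleright> z"
    using z by (intro chain_transfer[OF frontier(1)[OF x w lev] eq]) auto
  then show ?thesis by simp
qed

text \<open>
  A walk can leave the cone only from its bottom level, and there \<open>frontier\<close> provides a short
  word with the same end, for which the profile knows the level after one more letter.
\<close>

lemma cone_words_transfer:
  assumes eq: "profile x = profile x'" and x: "x \<in> V" and x': "x' \<in> V"
  shows "w \<in> cone_words x \<Longrightarrow> w \<in> cone_words x'"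
proof (induction w rule: rev_induct)
  case (snoc a w)
  then have w: "w \<in> cone_words x" "a \<in> A" "level x \<le> level (x \<triangleright> w \<triangleright> [a])" and w': "w \<in> cone_words x'"
    using cone_words_snoc_iff by blast+
  have wA: "w \<in> lists A" using w(1) by (rule cone_words_in_lists)
  have "level x' \<le> level (x' \<triangleright> w \<triangleright> [a])"
  proof (cases "level (x' \<triangleright> w) = level x'")
    case True
    obtain y where y: "y \<in> lists A" "length y \<le> 4 * chord_length" "x' \<triangleright> w = x' \<triangleright> y"
      using frontier(2)[OF x' w' True] by blast
    have "x \<triangleright> w = x \<triangleright> y"
      using frontier_transfer[OF eq[symmetric] x' w' True] y by simp
    then have "level x \<le> level (x \<triangleright> (y @ [a]))" using w(3) by simp
    then have "level x' \<le> level (x' \<triangleright> (y @ [a]))"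
      using y w(2) by (intro profile_leD[OF eq]) auto
    then show ?thesis using y(3) by simp
  next
    case False
    then have "level x' < level (x' \<triangleright> w)" using cone_words_level[OF w'] by simp
    moreover have "level (x' \<triangleright> w) \<le> level (x' \<triangleright> w \<triangleright> [a]) + length [a]"
      using x' wA w(2) by (intro level_le_run) (auto intro: run_in)
    ultimately show ?thesis by simp
  qed
  with w' w(2) show ?case using cone_words_snoc_iff by blast
qed simp

text \<open>
  From a vertex of the cone, go down along a geodesic towards the root until the level of \<open>x\<close> is reached. This walk
  stays in the cone, so that it ends on the bottom level of the cone of \<open>x'\<close> as well.
\<close>

lemma level_transfer:
  assumes eq: "profile x = profile x'" and x: "x \<in> V" and x': "x' \<in> V" and w: "w \<in> cone_words x"
  shows "level (x' \<triangleright> w) - level x' \<le> level (x \<triangleright> w) - level x"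
proof -
  have wA: "w \<in> lists A" using w by (rule cone_words_in_lists)
  have z: "x \<triangleright> w \<in> V" by (rule run_in[OF x wA])
  obtain t where t: "t \<in> lists A" "length t = level (x \<triangleright> w)" "x0 \<triangleright> t = x \<triangleright> w" using ex_geodesic[OF z] by blast
  \<comment> \<open>a geodesic to the end of the walk, cut where it passes the level of the base vertex\<close>
  define t1 t2 where "t1 = take (level x) t" and "t2 = drop (level x) t"
  have tt: "t = t1 @ t2" by (simp add: t1_def t2_def)
  have len: "length t1 = level x" "length t2 = level (x \<triangleright> w) - level x"
    using t(2) cone_words_level[OF w] by (auto simp: t1_def t2_def)
  have tA: "t1 \<in> lists A" "t2 \<in> lists A" using t(1) tt by auto
  have lev: "x \<triangleright> w \<triangleright> v1 = x0 \<triangleright> (t1 @ winv v2) \<and> level (x0 \<triangleright> (t1 @ winv v2)) = length (t1 @ winv v2)"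
    if "winv t2 = v1 @ v2" for v1 v2
  proof -
    have A: "v1 \<in> lists A" "v2 \<in> lists A" using that tA winv_in by (metis append_in_lists_conv)+
    have t2: "t2 = winv v2 @ winv v1" using that tA(2) by (metis winv_append winv_winv)
    then have "x0 \<triangleright> (t1 @ winv v2) \<triangleright> winv v1 = x \<triangleright> w" using t(3) tt by simp
    moreover have tvA: "t1 @ winv v2 \<in> lists A" using A tA by (auto intro: winv_in)
    ultimately have "x \<triangleright> w \<triangleright> v1 = x0 \<triangleright> (t1 @ winv v2)"
      using run_winv'[of "x0 \<triangleright> (t1 @ winv v2)" v1] A root_in by (metis run_in)
    moreover have "level (x0 \<triangleright> (t1 @ winv v2)) = length (t1 @ winv v2)"
      using t tt t2 A tvA by (intro geodesic_prefix[of _ "winv v1"]) (auto intro: winv_in)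
    ultimately show ?thesis by blast
  qed
  have v: "w @ winv t2 \<in> cone_words x"
    unfolding cone_words_append_iff
  proof (intro conjI allI impI)
    fix v1 v2 assume "winv t2 = v1 @ v2"
    from lev[OF this] show "level x \<le> level (x \<triangleright> w \<triangleright> v1)" using len by simp
  qed (use w tA in auto)
  have "level (x \<triangleright> (w @ winv t2)) = level x"
    using lev[of "winv t2" "[]"] len by (simp add: winv_def)
  note fr = frontier(2)[OF x v this] and tr = frontier_transfer[OF eq x v this]
  obtain y where y: "y \<in> lists A" "length y \<le> 4 * chord_length" "x \<triangleright> (w @ winv t2) = x \<triangleright> y"
    using fr by blast
  have "level (x' \<triangleright> y) = level x'"
    using y \<open>level (x \<triangleright> (w @ winv t2)) = level x\<close> by (intro profile_levelD[OF eq]) auto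
  then have "level (x' \<triangleright> w \<triangleright> winv t2) = level x'" using tr[of y] y by simp
  moreover have "level (x' \<triangleright> w) \<le> level (x' \<triangleright> w \<triangleright> winv t2) + length (winv t2)"
    by (rule level_le_run[OF run_in[OF x' wA] winv_in[OF tA(2)]])
  ultimately show ?thesis using len by simp
qed

text \<open>
  Walk along \<open>v\<close> and back along \<open>w\<close>: the question whether both words have the same end becomes whether a walk in
  the cone returns to \<open>x\<close>, which is a bottom-level question.
\<close>

lemma endpoints_transfer:
  assumes eq: "profile x = profile x'" and x: "x \<in> V" and x': "x' \<in> V"
    and v: "v \<in> cone_words x" and w: "w \<in> cone_words x" and vw: "x \<triangleright> v = x \<triangleright> w"
  shows "x' \<triangleright> v = x' \<triangleright> w"
proof -
  have A: "v \<in> lists A" "w \<in> lists A" using v w cone_words_in_lists by blast+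
  have c: "v @ winv w \<in> cone_words x" by (rule cone_words_reverse[OF x x refl w v vw])
  have "x \<triangleright> (v @ winv w) = x" using vw run_winv[OF x A(2)] by simp
  then have "x' \<triangleright> (v @ winv w) = x' \<triangleright> []" by (intro frontier_transfer[OF eq x c]) auto
  then have "x' \<triangleright> v \<triangleright> winv w = x' \<triangleright> w \<triangleright> winv w" using run_winv[OF x' A(2)] by simp
  then show ?thesis using run_inj[of "x' \<triangleright> v" "x' \<triangleright> w" "winv w"] x' A by (metis run_in winv_in)
qed

lemma cone_type_eqI:
  assumes eq: "profile x = profile x'" and x: "x \<in> V" and x': "x' \<in> V"
  shows "cone_type x = cone_type x'"
proof -
  have words: "cone_words x = cone_words x'"
    using cone_words_transfer[OF eq x x'] cone_words_transfer[OF eq[symmetric] x' x] by blast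
  have "level (x \<triangleright> w) - level x = level (x' \<triangleright> w) - level x'" if "w \<in> cone_words x'" for w
    using level_transfer[OF eq x x', of w] level_transfer[OF eq[symmetric] x' x, of w] that words
    by (intro antisym) auto
  moreover have "x \<triangleright> v = x \<triangleright> w \<longleftrightarrow> x' \<triangleright> v = x' \<triangleright> w" if "v \<in> cone_words x'" "w \<in> cone_words x'" for v w
    using endpoints_transfer[OF eq x x', of v w] endpoints_transfer[OF eq[symmetric] x' x, of v w]
      that words by auto
  ultimately show ?thesis unfolding cone_type_def words by (intro arg_cong2[where f=Pair]) auto
qed

lemma finite_cone_types: "finite (cone_type ` V)"
proof -
  define rep where "rep p = (SOME x. x \<in> V \<and> profile x = p)" for p
  have "cone_type x = cone_type (rep (profile x))" if "x \<in> V" for x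
  proof -
    have "rep (profile x) \<in> V \<and> profile (rep (profile x)) = profile x"
      unfolding rep_def by (rule someI[of _ x]) (use that in simp)
    then show ?thesis using cone_type_eqI that by metis
  qed
  then have "cone_type ` V \<subseteq> (\<lambda>p. cone_type (rep p)) ` profile ` V" by blast
  then show ?thesis using finite_profiles finite_subset by blast
qed

end

section \<open>The tree of cones\<close>

context rooted_action begin

lemma cone_self [simp]: "r \<in> cone r"
  unfolding cone_def by (rule image_eqI[of _ _ "[]"]) auto

lemma cone_wordsI: "w \<in> cone_words r \<Longrightarrow> r \<triangleright> w \<in> cone r"
  unfolding cone_def by blast

lemma coneE:
  assumes "x \<in> cone r" obtains w where "w \<in> cone_words r" "x = r \<triangleright> w"
  using assms unfolding cone_def by blast

lemma cone_level: "x \<in> cone r \<Longrightarrow> level r \<le> level x"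
  by (erule coneE) (simp add: cone_words_level)

lemma cone_root: "cone x0 = V"
proof
  show "cone x0 \<subseteq> V" using cone_subset[OF root_in] by blast
  show "V \<subseteq> cone x0"
  proof
    fix v assume "v \<in> V"
    then obtain w where "w \<in> lists A" "x0 \<triangleright> w = v" using reachable by blast
    then show "v \<in> cone x0" unfolding cone_def cone_words_def by auto
  qed
qed

lemma cone_words_trans:
  assumes "u \<in> cone_words r" "v \<in> cone_words (r \<triangleright> u)"
  shows "u @ v \<in> cone_words r"
  unfolding cone_words_append_iff
proof (intro conjI allI impI)
  fix v1 v2 assume "v = v1 @ v2"
  then have "level (r \<triangleright> u) \<le> level (r \<triangleright> u \<triangleright> v1)" using assms(2) unfolding cone_words_def by blast
  then show "level r \<le> level (r \<triangleright> u \<triangleright> v1)" using cone_words_level[OF assms(1)] by simp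
qed (use assms cone_words_in_lists in auto)

lemma cone_trans: "y \<in> cone r \<Longrightarrow> x \<in> cone y \<Longrightarrow> x \<in> cone r"
  using cone_words_trans cone_wordsI by (metis coneE foldl_append)

lemma cone_eqI:
  assumes "r \<in> V" "r' \<in> V" "level r' = level r" "x \<in> cone r" "x \<in> cone r'"
  shows "cone r = cone r'"
proof -
  have "s' \<in> cone s" if s: "s \<in> V" "s' \<in> V" "level s' = level s" "x \<in> cone s" "x \<in> cone s'" for s s'
  proof -
    obtain w v where w: "w \<in> cone_words s'" "x = s' \<triangleright> w" and v: "v \<in> cone_words s" "x = s \<triangleright> v"
      using s(4,5) coneE by metis
    have "v @ winv w \<in> cone_words s"
      using s w v by (intro cone_words_reverse[of s']) auto
    moreover have "s \<triangleright> (v @ winv w) = s'"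
      using w v run_winv[OF s(2) cone_words_in_lists[OF w(1)]] by simp
    ultimately show ?thesis using cone_wordsI by metis
  qed
  from this[OF assms] this[OF assms(2,1) assms(3)[symmetric] assms(5,4)] show ?thesis
    using cone_trans by blast
qed

lemma cone_step:
  assumes "x \<in> cone r" "a \<in> A" "level r \<le> level (act x a)"
  shows "act x a \<in> cone r"
proof -
  obtain w where w: "w \<in> cone_words r" "x = r \<triangleright> w" using assms(1) by (rule coneE)
  then have "w @ [a] \<in> cone_words r" using assms(2,3) by (simp add: cone_words_snoc_iff)
  from cone_wordsI[OF this] w show ?thesis by simp
qed

lemma level_act: "x \<in> V \<Longrightarrow> a \<in> A \<Longrightarrow> level x \<le> Suc (level (act x a))"
  and level_act': "x \<in> V \<Longrightarrow> a \<in> A \<Longrightarrow> level (act x a) \<le> Suc (level x)"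
  using level_le_run[of x "[a]"] level_run_le[of x "[a]"] by auto

text \<open>
  On the way from \<open>r\<close> to \<open>x\<close>, the last step that rises from the level of \<open>r\<close> enters the child cone of \<open>x\<close>.
\<close>

lemma ex_child:
  assumes r: "r \<in> V" and "x \<in> cone r" "level r < level x"
  shows "\<exists>w \<in> cone_words r. level (r \<triangleright> w) = Suc (level r) \<and> x \<in> cone (r \<triangleright> w)"
proof -
  have "\<exists>w \<in> cone_words r. level (r \<triangleright> w) = Suc (level r) \<and> r \<triangleright> v \<in> cone (r \<triangleright> w)"
    if "v \<in> cone_words r" "level r < level (r \<triangleright> v)" for v
    using that
  proof (induction v rule: rev_induct)
    case (snoc a v)
    then have v: "v \<in> cone_words r" "a \<in> A" using cone_words_snoc_iff by blast+
    have rv: "r \<triangleright> v \<in> V" using r cone_words_in_lists[OF v(1)] by (rule run_in)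
    show ?case
    proof (cases "level r < level (r \<triangleright> v)")
      case True
      then obtain w where w: "w \<in> cone_words r" "level (r \<triangleright> w) = Suc (level r)" "r \<triangleright> v \<in> cone (r \<triangleright> w)"
        using snoc.IH v(1) by blast
      have "act (r \<triangleright> v) a \<in> cone (r \<triangleright> w)"
        using snoc.prems(2) w by (intro cone_step[OF _ v(2)]) auto
      with w show ?thesis by auto
    next
      case False
      then have "level (r \<triangleright> v) = level r" using cone_words_level[OF v(1)] by simp
      then have "level (r \<triangleright> (v @ [a])) = Suc (level r)"
        using level_act'[OF rv v(2)] snoc.prems(2) by simp
      then show ?thesis using snoc.prems(1) cone_self by blast
    qed
  qed simp
  then show ?thesis using assms(2,3) coneE by metis
qed

lemma cone_type_words:
  assumes "cone_type r = cone_type r'"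
  shows "cone_words r = cone_words r'"
proof -
  have "cone_words s = fst ` fst (cone_type s)" for s
    unfolding cone_type_def by force
  then show ?thesis using assms by simp
qed

lemma cone_type_level:
  assumes "cone_type r = cone_type r'" "w \<in> cone_words r"
  shows "level (r \<triangleright> w) - level r = level (r' \<triangleright> w) - level r'"
proof -
  have "(w, level (r \<triangleright> w) - level r) \<in> fst (cone_type r)"
    using assms(2) unfolding cone_type_def by auto
  then show ?thesis unfolding assms(1) unfolding cone_type_def by auto
qed

lemma cone_type_run_eq:
  assumes "cone_type r = cone_type r'" "u \<in> cone_words r" "v \<in> cone_words r"
  shows "r \<triangleright> u = r \<triangleright> v \<longleftrightarrow> r' \<triangleright> u = r' \<triangleright> v"
proof -
  have "(u, v) \<in> snd (cone_type s) \<longleftrightarrow> s \<triangleright> u = s \<triangleright> v"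
    if "u \<in> cone_words s" "v \<in> cone_words s" for s
    using that unfolding cone_type_def by auto
  then show ?thesis using assms cone_type_words by metis
qed

text \<open>
  Describes the words of a smaller cone by data that belong to the type of the larger one; truncated
  subtraction is harmless because all levels involved are at least \<open>level r\<close>.
\<close>

lemma cone_words_run_iff:
  assumes "w \<in> cone_words r"
  shows "v \<in> cone_words (r \<triangleright> w) \<longleftrightarrow> w @ v \<in> cone_words r \<and>
    (\<forall>v1 v2. v = v1 @ v2 \<longrightarrow> level (r \<triangleright> w) - level r \<le> level (r \<triangleright> (w @ v1)) - level r)"
    (is "?L \<longleftrightarrow> ?R")
proof
  assume L: ?L
  have "level (r \<triangleright> w) \<le> level (r \<triangleright> (w @ v1))" if "v = v1 @ v2" for v1 v2
    using L that unfolding cone_words_def by simp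
  then show ?R using cone_words_trans[OF assms L] by (auto intro: diff_le_mono)
next
  assume R: ?R
  have "level (r \<triangleright> w) \<le> level (r \<triangleright> w \<triangleright> v1)" if v: "v = v1 @ v2" for v1 v2
  proof -
    have "w @ v1 \<in> cone_words r" using R v cone_words_append_iff[of "w @ v1" v2 r] by simp
    then have "level r \<le> level (r \<triangleright> (w @ v1))" by (rule cone_words_level)
    moreover have "level (r \<triangleright> w) - level r \<le> level (r \<triangleright> (w @ v1)) - level r" using R v by blast
    ultimately show ?thesis by simp
  qed
  moreover have "v \<in> lists A" using R cone_words_in_lists by fastforce
  ultimately show ?L unfolding cone_words_def by blast
qed

lemma cone_type_run:
  assumes eq: "cone_type r = cone_type r'" and w: "w \<in> cone_words r"
  shows "cone_type (r \<triangleright> w) = cone_type (r' \<triangleright> w)"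
proof -
  note words = cone_type_words[OF eq]
  have w': "w \<in> cone_words r'" using w words by simp
  have cw: "cone_words (r \<triangleright> w) = cone_words (r' \<triangleright> w)"
  proof (rule Set.set_eqI)
    fix v
    have "level (r \<triangleright> (w @ v1)) - level r = level (r' \<triangleright> (w @ v1)) - level r'"
      if "w @ v \<in> cone_words r" "v = v1 @ v2" for v1 v2
      using that cone_words_append_iff[of "w @ v1" v2 r] by (intro cone_type_level[OF eq]) simp
    then show "v \<in> cone_words (r \<triangleright> w) \<longleftrightarrow> v \<in> cone_words (r' \<triangleright> w)"
      unfolding cone_words_run_iff[OF w] cone_words_run_iff[OF w'] words[symmetric]
        cone_type_level[OF eq w] by metis
  qed
  have lev: "level (r \<triangleright> w \<triangleright> v) - level (r \<triangleright> w) = level (r' \<triangleright> w \<triangleright> v) - level (r' \<triangleright> w)"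
    if v: "v \<in> cone_words (r' \<triangleright> w)" for v
  proof -
    have "w @ v \<in> cone_words r" using cone_words_trans[OF w] v cw by simp
    from cone_type_level[OF eq this] cone_type_level[OF eq w] cone_words_level[OF w] cone_words_level[OF w']
    show ?thesis by simp
  qed
  have "r \<triangleright> w \<triangleright> u = r \<triangleright> w \<triangleright> v \<longleftrightarrow> r' \<triangleright> w \<triangleright> u = r' \<triangleright> w \<triangleright> v"
    if "u \<in> cone_words (r' \<triangleright> w)" "v \<in> cone_words (r' \<triangleright> w)" for u v
    using cone_type_run_eq[OF eq cone_words_trans[OF w] cone_words_trans[OF w], of u v] that cw by simp
  with lev show ?thesis
    unfolding cone_type_def[of "r \<triangleright> w"] cone_type_def[of "r' \<triangleright> w"] cw
    by (intro arg_cong2[where f=Pair]) auto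
qed

text \<open>
  Names for child cones and for bottom-level vertices. An arbitrary choice is good enough: the set from which it is
  made depends only on the type of the cone and on the class of words that lead to \<open>x\<close>, so that cones of the same
  type make the same choice (\<open>child_word_transfer\<close>, \<open>final_word_transfer\<close>).
\<close>

definition child_word :: "'v \<Rightarrow> 'v \<Rightarrow> 'a list" where
  "child_word r x = (SOME w. w \<in> cone_words r \<and> level (r \<triangleright> w) = Suc (level r) \<and> x \<in> cone (r \<triangleright> w))"

definition final_word :: "'v \<Rightarrow> 'v \<Rightarrow> 'a list" where
  "final_word r x = (SOME w. w \<in> cone_words r \<and> r \<triangleright> w = x)"

lemma final_word:
  assumes "x \<in> cone r"
  shows "final_word r x \<in> cone_words r" "r \<triangleright> final_word r x = x"
proof -
  have "\<exists>w. w \<in> cone_words r \<and> r \<triangleright> w = x" using assms coneE by metis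
  from someI_ex[OF this] show "final_word r x \<in> cone_words r" "r \<triangleright> final_word r x = x"
    unfolding final_word_def by blast+
qed

lemma child_word:
  assumes "r \<in> V" "x \<in> cone r" "level r < level x"
  shows "child_word r x \<in> cone_words r" "level (r \<triangleright> child_word r x) = Suc (level r)"
    "x \<in> cone (r \<triangleright> child_word r x)"
proof -
  have "\<exists>w. w \<in> cone_words r \<and> level (r \<triangleright> w) = Suc (level r) \<and> x \<in> cone (r \<triangleright> w)"
    using ex_child[OF assms] by blast
  from someI_ex[OF this] show "child_word r x \<in> cone_words r" "level (r \<triangleright> child_word r x) = Suc (level r)"
    "x \<in> cone (r \<triangleright> child_word r x)"
    unfolding child_word_def by blast+
qed

definition child_words :: "'v \<Rightarrow> 'a list set" where
  "child_words r = {child_word r x | x. x \<in> cone r \<and> level r < level x}"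

definition final_words :: "'v \<Rightarrow> 'a list set" where
  "final_words r = {final_word r x | x. x \<in> cone r \<and> level x = level r}"

lemma child_words:
  assumes "r \<in> V" "w \<in> child_words r"
  shows "w \<in> cone_words r" "level (r \<triangleright> w) = Suc (level r)" "r \<triangleright> w \<in> V" "r \<triangleright> w \<in> cone r" "w \<in> lists A"
proof -
  obtain x where "x \<in> cone r" "level r < level x" "w = child_word r x"
    using assms(2) unfolding child_words_def by blast
  then show w: "w \<in> cone_words r" and "level (r \<triangleright> w) = Suc (level r)" using child_word[OF assms(1)] by auto
  show A: "w \<in> lists A" using w by (rule cone_words_in_lists)
  show "r \<triangleright> w \<in> V" using assms(1) A by (rule run_in)
  show "r \<triangleright> w \<in> cone r" using w by (rule cone_wordsI)
qed

text \<open>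
  The name of a child cone does not depend on the vertex of it by which it is addressed, as two cones of the same
  level that meet are equal.
\<close>

lemma child_word_cong:
  assumes r: "r \<in> V" and x: "x \<in> cone r" "level r < level x" and y: "y \<in> cone (r \<triangleright> child_word r x)"
  shows "child_word r y = child_word r x"
proof -
  note c = child_word[OF r x]
  have cV: "r \<triangleright> w \<in> V" if "w \<in> cone_words r" for w using r cone_words_in_lists[OF that] by (rule run_in)
  have "y \<in> cone (r \<triangleright> w) \<longleftrightarrow> x \<in> cone (r \<triangleright> w)"
    if w: "w \<in> cone_words r" "level (r \<triangleright> w) = Suc (level r)" for w
    using cone_eqI[OF cV[OF w(1)] cV[OF c(1)], of x] cone_eqI[OF cV[OF w(1)] cV[OF c(1)], of y] w c y by auto
  then have "(\<lambda>w. w \<in> cone_words r \<and> level (r \<triangleright> w) = Suc (level r) \<and> y \<in> cone (r \<triangleright> w)) =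
      (\<lambda>w. w \<in> cone_words r \<and> level (r \<triangleright> w) = Suc (level r) \<and> x \<in> cone (r \<triangleright> w))"
    by blast
  then show ?thesis unfolding child_word_def by (rule arg_cong)
qed

lemma child_words_word:
  assumes r: "r \<in> V" and w: "w \<in> child_words r" and x: "x \<in> cone (r \<triangleright> w)"
  shows "child_word r x = w" "level r < level x" "x \<in> cone r"
proof -
  obtain z where z: "z \<in> cone r" "level r < level z" "w = child_word r z"
    using w unfolding child_words_def by blast
  then show "child_word r x = w" using child_word_cong[OF r] x by simp
  show "level r < level x" using cone_level[OF x] child_words(2)[OF r w] by simp
  show "x \<in> cone r" by (rule cone_trans[OF child_words(4)[OF r w] x])
qed

lemma final_word_transfer:
  assumes eq: "cone_type r = cone_type r'" and v: "v \<in> cone_words r"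
  shows "final_word r (r \<triangleright> v) = final_word r' (r' \<triangleright> v)"
proof -
  have "(\<lambda>w. w \<in> cone_words r \<and> r \<triangleright> w = r \<triangleright> v) = (\<lambda>w. w \<in> cone_words r' \<and> r' \<triangleright> w = r' \<triangleright> v)"
    using cone_type_run_eq[OF eq _ v] cone_type_words[OF eq] by auto
  then show ?thesis unfolding final_word_def by (rule arg_cong)
qed

lemma cone_run_transfer:
  assumes eq: "cone_type r = cone_type r'" and v: "v \<in> cone_words r" and w: "w \<in> cone_words r"
    and x: "r \<triangleright> v \<in> cone (r \<triangleright> w)"
  shows "\<exists>u \<in> cone_words (r \<triangleright> w). r \<triangleright> w \<triangleright> u = r \<triangleright> v \<and> r' \<triangleright> w \<triangleright> u = r' \<triangleright> v"
proof -
  obtain u where u: "u \<in> cone_words (r \<triangleright> w)" "r \<triangleright> v = r \<triangleright> w \<triangleright> u" using x by (rule coneE)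
  then have "r' \<triangleright> v = r' \<triangleright> (w @ u)"
    using cone_type_run_eq[OF eq v cone_words_trans[OF w u(1)]] by simp
  with u show ?thesis by (intro bexI[of _ u]) auto
qed

lemma child_word_transfer:
  assumes eq: "cone_type r = cone_type r'" and v: "v \<in> cone_words r"
  shows "child_word r (r \<triangleright> v) = child_word r' (r' \<triangleright> v)"
proof -
  have words: "cone_words r = cone_words r'" by (rule cone_type_words[OF eq])
  have lev: "level (r \<triangleright> w) = Suc (level r) \<longleftrightarrow> level (r' \<triangleright> w) = Suc (level r')" if "w \<in> cone_words r" for w
    using cone_type_level[OF eq that] cone_words_level[OF that] cone_words_level[of w r'] that words by auto
  have half: "s' \<triangleright> v \<in> cone (s' \<triangleright> w)"
    if s: "cone_type s = cone_type s'" "v \<in> cone_words s" "w \<in> cone_words s" "s \<triangleright> v \<in> cone (s \<triangleright> w)" for s s' w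
  proof -
    obtain u where "u \<in> cone_words (s \<triangleright> w)" "s' \<triangleright> w \<triangleright> u = s' \<triangleright> v"
      using cone_run_transfer[OF s] by blast
    then show ?thesis using cone_type_words[OF cone_type_run[OF s(1,3)]] cone_wordsI by metis
  qed
  have "(\<lambda>w. w \<in> cone_words r \<and> level (r \<triangleright> w) = Suc (level r) \<and> r \<triangleright> v \<in> cone (r \<triangleright> w)) =
      (\<lambda>w. w \<in> cone_words r' \<and> level (r' \<triangleright> w) = Suc (level r') \<and> r' \<triangleright> v \<in> cone (r' \<triangleright> w))"
    using half[OF eq v] half[OF eq[symmetric]] v words lev by blast
  then show ?thesis unfolding child_word_def by (rule arg_cong)
qed

lemma child_words_transfer:
  assumes eq: "cone_type r = cone_type r'"
  shows "child_words r = child_words r'"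
proof -
  have "child_words s \<subseteq> child_words s'" if s: "cone_type s = cone_type s'" for s s'
  proof
    fix c assume "c \<in> child_words s"
    then obtain v where v: "v \<in> cone_words s" "level s < level (s \<triangleright> v)" "c = child_word s (s \<triangleright> v)"
      unfolding child_words_def cone_def by blast
    then have "level s' < level (s' \<triangleright> v)" using cone_type_level[OF s v(1)] by simp
    moreover have "s' \<triangleright> v \<in> cone s'" using v(1) cone_type_words[OF s] cone_wordsI by simp
    moreover have "c = child_word s' (s' \<triangleright> v)" using child_word_transfer[OF s v(1)] v(3) by simp
    ultimately show "c \<in> child_words s'" unfolding child_words_def by blast
  qed
  from this[OF eq] this[OF eq[symmetric]] show ?thesis by blast
qed

lemma final_words_transfer:
  assumes eq: "cone_type r = cone_type r'"
  shows "final_words r = final_words r'"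
proof -
  have "final_words s \<subseteq> final_words s'" if s: "cone_type s = cone_type s'" for s s'
  proof
    fix c assume "c \<in> final_words s"
    then obtain v where v: "v \<in> cone_words s" "level (s \<triangleright> v) = level s" "c = final_word s (s \<triangleright> v)"
      unfolding final_words_def cone_def by blast
    have v': "v \<in> cone_words s'" using v(1) cone_type_words[OF s] by simp
    then have "level (s' \<triangleright> v) = level s'"
      using cone_type_level[OF s v(1)] v(2) cone_words_level[OF v'] by simp
    moreover have "s' \<triangleright> v \<in> cone s'" using v' by (rule cone_wordsI)
    moreover have "c = final_word s' (s' \<triangleright> v)" using final_word_transfer[OF s v(1)] v(3) by simp
    ultimately show "c \<in> final_words s'" unfolding final_words_def by blast
  qed
  from this[OF eq] this[OF eq[symmetric]] show ?thesis by blast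
qed

lemma finite_child_words:
  assumes r: "r \<in> V"
  shows "finite (child_words r)"
proof (rule finite_subset)
  show "child_words r \<subseteq> child_word r ` {y \<in> V. level y = Suc (level r)}"
  proof
    fix w assume w: "w \<in> child_words r"
    have "child_word r (r \<triangleright> w) = w" by (rule child_words_word[OF r w cone_self])
    then show "w \<in> child_word r ` {y \<in> V. level y = Suc (level r)}"
      using child_words[OF r w] by (intro image_eqI[of _ _ "r \<triangleright> w"]) auto
  qed
qed (simp add: finite_sphere)

lemma finite_final_words:
  assumes r: "r \<in> V"
  shows "finite (final_words r)"
proof (rule finite_subset)
  show "final_words r \<subseteq> final_word r ` {y \<in> V. level y = level r}"
    unfolding final_words_def using cone_subset[OF r] by blast
qed (simp add: finite_sphere)

end

section \<open>Codes of vertices\<close>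

text \<open>
  The letter \<open>cl w\<close> stands for entering the child cone named \<open>w\<close>, the letter \<open>fl w\<close> for stopping at the bottom-level
  vertex named \<open>w\<close>. The latter occurs only at the end of a code, which makes the codes prefix-free.
\<close>

locale coded_action = rooted_action A ainv V act x0
  for A :: "'a set" and ainv and V :: "'v set" and act and x0 +
  fixes cl fl :: "'a list \<Rightarrow> 's"
  assumes finite_types: "finite (cone_type ` V)"
    and inj_cl: "inj_on cl (lists A)" and inj_fl: "inj_on fl (lists A)"
    and cl_neq_fl: "u \<in> lists A \<Longrightarrow> v \<in> lists A \<Longrightarrow> cl u \<noteq> fl v"
begin

primrec code_upto :: "nat \<Rightarrow> 'v \<Rightarrow> 'v \<Rightarrow> 's list" where
  "code_upto 0 r x = [fl (final_word r x)]"
| "code_upto (Suc n) r x = cl (child_word r x) # code_upto n (r \<triangleright> child_word r x) x"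

definition code :: "'v \<Rightarrow> 'v \<Rightarrow> 's list" where
  "code r x = code_upto (level x - level r) r x"

lemma code_final: "level x = level r \<Longrightarrow> code r x = [fl (final_word r x)]"
  by (simp add: code_def)

lemma code_child:
  assumes "r \<in> V" "x \<in> cone r" "level r < level x"
  shows "code r x = cl (child_word r x) # code (r \<triangleright> child_word r x) x"
proof -
  have "level x - level r = Suc (level x - level (r \<triangleright> child_word r x))"
    using child_word(2)[OF assms] assms(3) by simp
  then show ?thesis by (simp add: code_def)
qed

text \<open>
  Cones of the same type choose the same name for the child cone of corresponding vertices, and the child cones so named have
  the same type again.
\<close>

lemma code_transfer:
  assumes "cone_type r = cone_type r'" "r \<in> V" "r' \<in> V" "v \<in> cone_words r"
  shows "code r (r \<triangleright> v) = code r' (r' \<triangleright> v)"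
proof -
  have "code_upto n r (r \<triangleright> v) = code_upto n r' (r' \<triangleright> v)"
    if "level (r \<triangleright> v) - level r = n" for n
    using assms that
  proof (induction n arbitrary: r r' v)
    case 0
    then show ?case using final_word_transfer by simp
  next
    case (Suc n)
    let ?w = "child_word r (r \<triangleright> v)"
    have lt: "level r < level (r \<triangleright> v)" using Suc.prems(5) by simp
    note w = child_word[OF Suc.prems(2) cone_wordsI[OF Suc.prems(4)] lt]
    have same: "child_word r' (r' \<triangleright> v) = ?w"
      using child_word_transfer[OF Suc.prems(1,4)] by simp
    have w': "?w \<in> cone_words r'" using w(1) cone_type_words[OF Suc.prems(1)] by simp
    obtain u where u: "u \<in> cone_words (r \<triangleright> ?w)" "r \<triangleright> ?w \<triangleright> u = r \<triangleright> v" "r' \<triangleright> ?w \<triangleright> u = r' \<triangleright> v"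
      using cone_run_transfer[OF Suc.prems(1,4) w(1,3)] by blast
    have "code_upto n (r \<triangleright> ?w) (r \<triangleright> ?w \<triangleright> u) = code_upto n (r' \<triangleright> ?w) (r' \<triangleright> ?w \<triangleright> u)"
    proof (rule Suc.IH[OF cone_type_run[OF Suc.prems(1) w(1)] _ _ u(1)])
      show "r \<triangleright> ?w \<in> V" by (rule run_in[OF Suc.prems(2) cone_words_in_lists[OF w(1)]])
      show "r' \<triangleright> ?w \<in> V" by (rule run_in[OF Suc.prems(3) cone_words_in_lists[OF w(1)]])
      show "level (r \<triangleright> ?w \<triangleright> u) - level (r \<triangleright> ?w) = n"
        unfolding u(2) using Suc.prems(5) w(2) by simp
    qed
    then show ?case unfolding code_upto.simps same u(2,3) by simp
  qed
  moreover have "level (r \<triangleright> v) - level r = level (r' \<triangleright> v) - level r'"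
    by (rule cone_type_level[OF assms(1,4)])
  ultimately show ?thesis by (simp add: code_def)
qed

lemma code_starts_final:
  assumes r: "r \<in> V" and x: "x \<in> cone r" and eq: "code r x \<frown> \<zeta> = (fl u # v) \<frown> \<eta>" and u: "u \<in> lists A"
  shows "level x = level r" "final_word r x = u" "v \<frown> \<eta> = \<zeta>"
proof -
  show lev: "level x = level r"
  proof (rule ccontr)
    assume "level x \<noteq> level r"
    then have lt: "level r < level x" using cone_level[OF x] by simp
    from eq have "cl (child_word r x) = fl u" unfolding code_child[OF r x lt] conc_Cons_eq by simp
    then show False using cl_neq_fl[OF cone_words_in_lists[OF child_word(1)[OF r x lt]] u] by simp
  qed
  from eq have *: "fl (final_word r x) = fl u \<and> [] \<frown> \<zeta> = v \<frown> \<eta>"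
    unfolding code_final[OF lev] conc_Cons_eq .
  then show "final_word r x = u"
    using inj_onD[OF inj_fl] u cone_words_in_lists[OF final_word(1)[OF x]] by blast
  from * show "v \<frown> \<eta> = \<zeta>" by simp
qed

lemma code_starts_child:
  assumes r: "r \<in> V" and x: "x \<in> cone r" and eq: "code r x \<frown> \<zeta> = (cl w # v) \<frown> \<eta>" and w: "w \<in> lists A"
  shows "level r < level x" "child_word r x = w" "code (r \<triangleright> w) x \<frown> \<zeta> = v \<frown> \<eta>" "w \<in> child_words r"
proof -
  show lt: "level r < level x"
  proof (rule ccontr)
    assume "\<not> level r < level x"
    then have lev: "level x = level r" using cone_level[OF x] by simp
    from eq have "fl (final_word r x) = cl w" unfolding code_final[OF lev] conc_Cons_eq by simp
    then show False using cl_neq_fl[OF w cone_words_in_lists[OF final_word(1)[OF x]]] by simp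
  qed
  from eq have *: "cl (child_word r x) = cl w \<and> code (r \<triangleright> child_word r x) x \<frown> \<zeta> = v \<frown> \<eta>"
    unfolding code_child[OF r x lt] conc_Cons_eq .
  then show cw: "child_word r x = w"
    using inj_onD[OF inj_cl] w cone_words_in_lists[OF child_word(1)[OF r x lt]] by blast
  from * show "code (r \<triangleright> w) x \<frown> \<zeta> = v \<frown> \<eta>" unfolding cw by simp
  show "w \<in> child_words r" unfolding child_words_def using cw x lt by blast
qed

lemma prefix_code_cone:
  assumes "r \<in> V"
  shows "prefix_code (cone r) (code r)"
proof -
  have "x = y" if "level x - level r = n" "r \<in> V" "x \<in> cone r" "y \<in> cone r" "code r x \<frown> \<eta> = code r y \<frown> \<zeta>"
    for n x y \<eta> \<zeta> r
    using that
  proof (induction n arbitrary: r)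
    case 0
    then have lev: "level x = level r" using cone_level[of x r] by simp
    have "code r y \<frown> \<zeta> = (fl (final_word r x) # []) \<frown> \<eta>"
      using 0(5) code_final[OF lev] by simp
    from code_starts_final(2)[OF 0(2,4) this cone_words_in_lists[OF final_word(1)[OF 0(3)]]]
    show ?case using final_word(2)[OF 0(3)] final_word(2)[OF 0(4)] by metis
  next
    case (Suc n)
    have lt: "level r < level x" using Suc.prems(1) by simp
    let ?w = "child_word r x"
    note w = child_word[OF Suc.prems(2,3) lt]
    have eq: "code r y \<frown> \<zeta> = (cl ?w # code (r \<triangleright> ?w) x) \<frown> \<eta>"
      using Suc.prems(5) code_child[OF Suc.prems(2,3) lt] by simp
    note y = code_starts_child[OF Suc.prems(2,4) eq cone_words_in_lists[OF w(1)]]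
    show ?case
    proof (rule Suc.IH[OF _ _ w(3)])
      show "level x - level (r \<triangleright> ?w) = n" using Suc.prems(1) w(2) by simp
      show "r \<triangleright> ?w \<in> V" by (rule run_in[OF Suc.prems(2) cone_words_in_lists[OF w(1)]])
      show "y \<in> cone (r \<triangleright> ?w)" using child_word(3)[OF Suc.prems(2,4) y(1)] y(2) by simp
      show "code (r \<triangleright> ?w) x \<frown> \<eta> = code (r \<triangleright> ?w) y \<frown> \<zeta>" using y(3) by simp
    qed
  qed
  then show ?thesis using assms unfolding prefix_code_def by blast
qed

definition code_letters :: "'s set" where
  "code_letters = (\<Union>r \<in> V. cl ` child_words r \<union> fl ` final_words r)"

lemma finite_by_type:
  assumes "\<And>r r'. r \<in> V \<Longrightarrow> r' \<in> V \<Longrightarrow> cone_type r = cone_type r' \<Longrightarrow> h r = h r'"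
  shows "finite (h ` V)"
proof -
  define rep where "rep t = (SOME r. r \<in> V \<and> cone_type r = t)" for t
  have "h r = h (rep (cone_type r))" if "r \<in> V" for r
  proof -
    have "rep (cone_type r) \<in> V \<and> cone_type (rep (cone_type r)) = cone_type r"
      unfolding rep_def by (rule someI[of _ r]) (use that in simp)
    then show ?thesis using assms that by metis
  qed
  then have "h ` V \<subseteq> (\<lambda>t. h (rep t)) ` cone_type ` V" by blast
  then show ?thesis using finite_types finite_subset by blast
qed

lemma finite_all_child_words: "finite (\<Union>r \<in> V. child_words r)"
proof -
  have "finite (child_words ` V)" by (rule finite_by_type) (rule child_words_transfer)
  then show ?thesis using finite_child_words by auto
qed

lemma finite_code_letters: "finite code_letters"
proof -
  have "finite (\<Union>r \<in> V. final_words r)"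
  proof -
    have "finite (final_words ` V)" by (rule finite_by_type) (rule final_words_transfer)
    then show ?thesis using finite_final_words by auto
  qed
  moreover have "code_letters = cl ` (\<Union>r \<in> V. child_words r) \<union> fl ` (\<Union>r \<in> V. final_words r)"
    unfolding code_letters_def by blast
  ultimately show ?thesis using finite_all_child_words by simp
qed

lemma code_in_lists:
  assumes "r \<in> V" "x \<in> cone r"
  shows "code r x \<in> lists code_letters"
proof -
  have "code r x \<in> lists code_letters" if "level x - level r = n" "r \<in> V" "x \<in> cone r" for n r
    using that
  proof (induction n arbitrary: r)
    case 0
    then have lev: "level x = level r" using cone_level[of x r] by simp
    then have "fl (final_word r x) \<in> code_letters"
      using 0 unfolding code_letters_def final_words_def by blast
    then show ?case by (simp add: code_final[OF lev])
  next
    case (Suc n)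
    have lt: "level r < level x" using Suc.prems(1) by simp
    let ?w = "child_word r x"
    note w = child_word[OF Suc.prems(2,3) lt]
    have "cl ?w \<in> code_letters"
      using Suc.prems lt unfolding code_letters_def child_words_def by blast
    moreover have "code (r \<triangleright> ?w) x \<in> lists code_letters"
      using Suc.prems(1) w(2) run_in[OF Suc.prems(2) cone_words_in_lists[OF w(1)]]
      by (intro Suc.IH[OF _ _ w(3)]) auto
    ultimately show ?case unfolding code_child[OF Suc.prems(2,3) lt] by simp
  qed
  then show ?thesis using assms by blast
qed

definition inner :: "'a \<Rightarrow> 'v \<Rightarrow> 'v set" where
  "inner a r = {x \<in> cone r. act x a \<in> cone r}"

text \<open>
  The action of \<open>a\<close> as seen from \<open>r\<close>, on codes relative to \<open>r\<close>. These are the states of the transducer for \<open>a\<close>, and as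
  they depend only on the type of the cone of \<open>r\<close> (\<open>local_map_transfer\<close>), there are finitely many of them.
\<close>

definition local_map :: "'a \<Rightarrow> 'v \<Rightarrow> (nat \<Rightarrow> 's) \<Rightarrow> (nat \<Rightarrow> 's)" where
  "local_map a r = code_map (inner a r) (code r) (\<lambda>x. act x a)"

lemma prefix_code_inner: "r \<in> V \<Longrightarrow> prefix_code (inner a r) (code r)"
  using prefix_code_cone unfolding prefix_code_def inner_def by blast

lemma local_map_code:
  "r \<in> V \<Longrightarrow> x \<in> inner a r \<Longrightarrow> local_map a r (code r x \<frown> \<zeta>) = code r (act x a) \<frown> \<zeta>"
  unfolding local_map_def by (rule code_map_code[OF prefix_code_inner])

lemma local_map_other:
  "(\<And>x \<zeta>. x \<in> inner a r \<Longrightarrow> code r x \<frown> \<zeta> \<noteq> \<eta>) \<Longrightarrow> local_map a r \<eta> = \<eta>"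
  unfolding local_map_def by (rule code_map_other) metis

lemma local_map_transfer:
  assumes a: "a \<in> A" and r: "r \<in> V" "r' \<in> V" and eq: "cone_type r = cone_type r'"
  shows "local_map a r = local_map a r'"
proof
  fix \<eta>
  have move: "\<exists>x' \<in> inner a s'. code s' x' = code s x \<and> code s' (act x' a) = code s (act x a)"
    if s: "s \<in> V" "s' \<in> V" "cone_type s = cone_type s'" and x: "x \<in> inner a s" for s s' x
  proof -
    obtain v where v: "v \<in> cone_words s" "x = s \<triangleright> v" using x unfolding inner_def by (blast elim: coneE)
    have va: "v @ [a] \<in> cone_words s"
      using v x a cone_level unfolding cone_words_snoc_iff inner_def by auto
    note words = cone_type_words[OF s(3)]
    have "s' \<triangleright> v \<in> cone s'" "s' \<triangleright> (v @ [a]) \<in> cone s'"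
      using v(1) va words cone_wordsI by blast+
    then show ?thesis
      using code_transfer[OF s(3,1,2) v(1)] code_transfer[OF s(3,1,2) va] v(2)
      by (intro bexI[of _ "s' \<triangleright> v"]) (auto simp: inner_def)
  qed
  show "local_map a r \<eta> = local_map a r' \<eta>"
  proof (cases "\<exists>x \<in> inner a r. \<exists>\<zeta>. code r x \<frown> \<zeta> = \<eta>")
    case True
    then obtain x \<zeta> where x: "x \<in> inner a r" "code r x \<frown> \<zeta> = \<eta>" by blast
    obtain x' where x': "x' \<in> inner a r'" "code r' x' = code r x" "code r' (act x' a) = code r (act x a)"
      using move[OF r eq x(1)] by blast
    show ?thesis using local_map_code[OF r(1) x(1), of \<zeta>] local_map_code[OF r(2) x'(1), of \<zeta>] x(2) x' by simp
  next
    case False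
    have "\<not> (\<exists>x \<in> inner a r'. \<exists>\<zeta>. code r' x \<frown> \<zeta> = \<eta>)"
      using False move[OF r(2,1) eq[symmetric]] by metis
    with False show ?thesis using local_map_other[of a r \<eta>] local_map_other[of a r' \<eta>] by auto
  qed
qed

text \<open>
  A code that starts with two child letters belongs to a vertex at least two levels above \<open>r\<close>. One step cannot take it
  out of the first child cone, so the first letter is safe to output.
\<close>

lemma local_map_child:
  assumes a: "a \<in> A" and r: "r \<in> V" and w: "w \<in> child_words r" and w': "w' \<in> lists A"
  shows "local_map a r ([cl w, cl w'] \<frown> \<eta>) = [cl w] \<frown> local_map a (r \<triangleright> w) ([cl w'] \<frown> \<eta>)"
proof -
  note c = child_words[OF r w]
  have code_in: "code r x = cl w # code (r \<triangleright> w) x" if "x \<in> cone (r \<triangleright> w)" for x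
    using code_child[OF r] child_words_word[OF r w that] by simp
  show ?thesis
  proof (cases "\<exists>x \<in> inner a r. \<exists>\<zeta>. code r x \<frown> \<zeta> = [cl w, cl w'] \<frown> \<eta>")
    case True
    then obtain x \<zeta> where x: "x \<in> cone r" "act x a \<in> cone r" "code r x \<frown> \<zeta> = [cl w, cl w'] \<frown> \<eta>"
      unfolding inner_def by blast
    have xV: "x \<in> V" by (rule cone_subset[OF r x(1)])
    note s = code_starts_child[OF r x(1) x(3) c(5)]
    have x1: "x \<in> cone (r \<triangleright> w)" using child_word(3)[OF r x(1) s(1)] s(2) by simp
    note s' = code_starts_child[OF c(3) x1 s(3) w']
    have ax1: "act x a \<in> cone (r \<triangleright> w)"
      using level_act[OF xV a] s'(1) by (intro cone_step[OF x1 a]) simp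
    have "local_map a (r \<triangleright> w) ([cl w'] \<frown> \<eta>) = code (r \<triangleright> w) (act x a) \<frown> \<zeta>"
      using local_map_code[OF c(3), of x a \<zeta>] x1 ax1 s(3) by (simp add: inner_def)
    moreover have "local_map a r ([cl w, cl w'] \<frown> \<eta>) = code r (act x a) \<frown> \<zeta>"
      using local_map_code[OF r, of x a \<zeta>] x by (simp add: inner_def)
    ultimately show ?thesis unfolding code_in[OF ax1] by simp
  next
    case False
    have "local_map a (r \<triangleright> w) ([cl w'] \<frown> \<eta>) = [cl w'] \<frown> \<eta>"
    proof (rule local_map_other)
      fix x \<zeta> assume "x \<in> inner a (r \<triangleright> w)"
      then have x: "x \<in> cone (r \<triangleright> w)" "act x a \<in> cone (r \<triangleright> w)" by (auto simp: inner_def)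
      then have "x \<in> inner a r" using cone_trans[OF c(4)] by (simp add: inner_def)
      then have "code r x \<frown> \<zeta> \<noteq> [cl w, cl w'] \<frown> \<eta>" using False by blast
      then show "code (r \<triangleright> w) x \<frown> \<zeta> \<noteq> [cl w'] \<frown> \<eta>"
        unfolding code_in[OF x(1)] conc_Cons_eq by simp
    qed
    moreover have "local_map a r ([cl w, cl w'] \<frown> \<eta>) = [cl w, cl w'] \<frown> \<eta>"
      using False by (intro local_map_other) blast
    ultimately show ?thesis by simp
  qed
qed

section \<open>The letters act by finite-state maps\<close>

text \<open>
  Either nothing is pending, or one child letter has been read and is withheld, because the next letter may
  be a final one from which \<open>a\<close> leads back to the parent cone. In the end the identity takes over. The lag of the identity is
  \<open>1\<close> since on the way down to the parent two letters are replaced by one.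
\<close>

definition residuals :: "'a \<Rightarrow> (((nat \<Rightarrow> 's) \<Rightarrow> (nat \<Rightarrow> 's)) \<times> nat) set" where
  "residuals a = {(local_map a r, 0) | r. r \<in> V} \<union>
     {(\<lambda>\<eta>. local_map a r ([cl w] \<frown> \<eta>), 1) | r w. r \<in> V \<and> w \<in> child_words r} \<union> {(id, 1)}"

lemma finite_residuals:
  assumes a: "a \<in> A"
  shows "finite (residuals a)"
proof -
  have fin: "finite (local_map a ` V)"
    by (rule finite_by_type) (rule local_map_transfer[OF a])
  have "residuals a \<subseteq> (\<lambda>h. (h, 0)) ` local_map a ` V \<union>
      (\<lambda>(h, w). (\<lambda>\<eta>. h ([cl w] \<frown> \<eta>), 1)) ` (local_map a ` V \<times> (\<Union>r \<in> V. child_words r)) \<union> {(id, 1)}"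
    unfolding residuals_def by force
  moreover have "finite \<dots>" using fin finite_all_child_words by simp
  ultimately show ?thesis by (rule finite_subset)
qed

lemma local_map_in:
  assumes "r \<in> V" "code_letters \<subseteq> S" "\<eta> \<in> infinite_words S"
  shows "local_map a r \<eta> \<in> infinite_words S"
  unfolding local_map_def
proof (rule code_map_in_infinite_words[OF prefix_code_inner[OF assms(1)] _ assms(3)])
  fix x assume "x \<in> inner a r"
  then show "code r (act x a) \<in> lists S"
    using code_in_lists[OF assms(1)] lists_mono[OF assms(2)] unfolding inner_def by blast
qed

lemma residual_fresh:
  assumes a: "a \<in> A" and r: "r \<in> V" and S: "code_letters \<subseteq> S" and s: "s \<in> S"
  shows "\<exists>u h e. u \<in> lists S \<and> (h, e) \<in> residuals a \<and>
    (\<forall>\<eta> \<in> infinite_words S. local_map a r ([s] \<frown> \<eta>) = u \<frown> h \<eta>) \<and> Suc 0 \<le> length u + e"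
proof -
  consider (child) w where "w \<in> child_words r" "s = cl w"
    | (final) x where "x \<in> inner a r" "code r x = [s]"
    | (other) "\<And>w. w \<in> child_words r \<Longrightarrow> s \<noteq> cl w" "\<And>x. x \<in> inner a r \<Longrightarrow> code r x \<noteq> [s]"
    by blast
  then show ?thesis
  proof cases
    case child
    then have "(\<lambda>\<eta>. local_map a r ([cl w] \<frown> \<eta>), 1) \<in> residuals a"
      using r unfolding residuals_def by blast
    with child show ?thesis
      by (intro exI[of _ "[]"] exI[of _ "\<lambda>\<eta>. local_map a r ([cl w] \<frown> \<eta>)"] exI[of _ "Suc 0"]) auto
  next
    case final
    have "code r (act x a) \<in> lists S"
      using code_in_lists[OF r] lists_mono[OF S] final(1) unfolding inner_def by blast
    then show ?thesis
      using local_map_code[OF r final(1)] final(2) unfolding residuals_def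
      by (intro exI[of _ "code r (act x a)"] exI[of _ id] exI[of _ "Suc 0"]) auto
  next
    case other
    have "local_map a r ([s] \<frown> \<eta>) = [s] \<frown> \<eta>" for \<eta>
    proof (rule local_map_other)
      fix x \<zeta> assume x: "x \<in> inner a r"
      then have xr: "x \<in> cone r" by (simp add: inner_def)
      show "code r x \<frown> \<zeta> \<noteq> [s] \<frown> \<eta>"
      proof (cases "level x = level r")
        case True
        then show ?thesis using other(2)[OF x] code_final[OF True] by (auto simp: conc_Cons_eq)
      next
        case False
        then have lt: "level r < level x" using cone_level[OF xr] by simp
        then have "child_word r x \<in> child_words r" using xr unfolding child_words_def by blast
        then show ?thesis unfolding code_child[OF r xr lt] conc_Cons_eq using other(1) by metis
      qed
    qed
    then show ?thesis
      using s unfolding residuals_def by (intro exI[of _ "[s]"] exI[of _ id] exI[of _ "Suc 0"]) auto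
  qed
qed

lemma residual_delayed:
  assumes a: "a \<in> A" and r: "r \<in> V" and w: "w \<in> child_words r" and S: "code_letters \<subseteq> S" and s: "s \<in> S"
  shows "\<exists>u h e. u \<in> lists S \<and> (h, e) \<in> residuals a \<and>
    (\<forall>\<eta> \<in> infinite_words S. local_map a r ([cl w] \<frown> ([s] \<frown> \<eta>)) = u \<frown> h \<eta>) \<and> Suc 1 \<le> length u + e"
proof -
  note c = child_words[OF r w]
  have clS: "cl w \<in> S" using r w S unfolding code_letters_def by blast
  consider (child) w' where "w' \<in> child_words (r \<triangleright> w)" "s = cl w'"
    | (final) x where "x \<in> inner a r" "code r x = [cl w, s]"
    | (other) "\<And>w'. w' \<in> child_words (r \<triangleright> w) \<Longrightarrow> s \<noteq> cl w'" "\<And>x. x \<in> inner a r \<Longrightarrow> code r x \<noteq> [cl w, s]"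
    by blast
  then show ?thesis
  proof cases
    case child
    have "(\<lambda>\<eta>. local_map a (r \<triangleright> w) ([cl w'] \<frown> \<eta>), 1) \<in> residuals a"
      using c(3) child(1) unfolding residuals_def by blast
    then show ?thesis
      using local_map_child[OF a r w child_words(5)[OF c(3) child(1)]] child(2) clS
      by (intro exI[of _ "[cl w]"] exI[of _ "\<lambda>\<eta>. local_map a (r \<triangleright> w) ([cl w'] \<frown> \<eta>)"] exI[of _ "Suc 0"])
        auto
  next
    case final
    have "code r (act x a) \<in> lists S"
      using code_in_lists[OF r] lists_mono[OF S] final(1) unfolding inner_def by blast
    moreover have "code r (act x a) \<noteq> []" by (cases "level (act x a) - level r") (auto simp: code_def)
    ultimately show ?thesis
      using local_map_code[OF r final(1)] final(2) unfolding residuals_def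
      by (intro exI[of _ "code r (act x a)"] exI[of _ id] exI[of _ "Suc 0"]) (auto simp: Suc_le_eq)
  next
    case other
    have "local_map a r ([cl w, s] \<frown> \<eta>) = [cl w, s] \<frown> \<eta>" for \<eta>
    proof (rule local_map_other, rule notI)
      fix x \<zeta> assume x: "x \<in> inner a r" and eq: "code r x \<frown> \<zeta> = [cl w, s] \<frown> \<eta>"
      from x have xr: "x \<in> cone r" by (simp add: inner_def)
      note st = code_starts_child[OF r xr eq c(5)]
      have x1: "x \<in> cone (r \<triangleright> w)" using child_word(3)[OF r xr st(1)] st(2) by simp
      show False
      proof (cases "level x = level (r \<triangleright> w)")
        case True
        have "fl (final_word (r \<triangleright> w) x) = s"
          using st(3) unfolding code_final[OF True] conc_Cons_eq by simp
        then have "code r x = [cl w, s]"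
          using code_child[OF r xr st(1)] st(2) code_final[OF True] by simp
        then show False using other(2)[OF x] by simp
      next
        case False
        then have lt: "level (r \<triangleright> w) < level x" using cone_level[OF x1] by simp
        have "cl (child_word (r \<triangleright> w) x) = s"
          using st(3) unfolding code_child[OF c(3) x1 lt] conc_Cons_eq by simp
        moreover have "child_word (r \<triangleright> w) x \<in> child_words (r \<triangleright> w)"
          using x1 lt unfolding child_words_def by blast
        ultimately show False using other(1) by blast
      qed
    qed
    then show ?thesis
      using s clS unfolding residuals_def
      by (intro exI[of _ "[cl w, s]"] exI[of _ id] exI[of _ "Suc 0"]) auto
  qed
qed

lemma residuals_closed:
  assumes a: "a \<in> A" and S: "code_letters \<subseteq> S"
  shows "residual_closed S (residuals a)"
proof -
  have "(\<forall>\<eta> \<in> infinite_words S. g \<eta> \<in> infinite_words S) \<and>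
      (\<forall>s \<in> S. \<exists>u h e. u \<in> lists S \<and> (h, e) \<in> residuals a \<and>
         (\<forall>\<eta> \<in> infinite_words S. g ([s] \<frown> \<eta>) = u \<frown> h \<eta>) \<and> Suc d \<le> length u + e)"
    if g: "(g, d) \<in> residuals a" for g d
  proof -
    from g consider (fresh) r where "r \<in> V" "g = local_map a r" "d = 0"
      | (delayed) r w where "r \<in> V" "w \<in> child_words r" "g = (\<lambda>\<eta>. local_map a r ([cl w] \<frown> \<eta>))" "d = 1"
      | (idle) "g = id" "d = 1"
      unfolding residuals_def by blast
    then show ?thesis
    proof cases
      case fresh
      then show ?thesis using local_map_in[OF _ S] residual_fresh[OF a _ S] by simp
    next
      case delayed
      have "cl w \<in> S" using delayed S unfolding code_letters_def by blast
      then have "g \<eta> \<in> infinite_words S" if "\<eta> \<in> infinite_words S" for \<eta>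
        unfolding delayed(3) using that
        by (intro local_map_in[OF delayed(1) S]) (subst conc_in_infinite_words, simp)
      then show ?thesis using residual_delayed[OF a delayed(1,2) S] delayed(3,4) by blast
    next
      case idle
      then show ?thesis
        unfolding residuals_def by (auto intro!: exI[of _ "[_]"] exI[of _ id] exI[of _ "Suc 0"])
    qed
  qed
  then show ?thesis unfolding residual_closed_def by fast
qed

theorem letter_finite_state:
  assumes a: "a \<in> A" and S: "code_letters \<subseteq> S"
  shows "finite_state S (code_map V (code x0) (\<lambda>x. act x a))"
proof -
  have "inner a x0 = V" unfolding inner_def cone_root using act_in[OF _ a] by blast
  then have "(code_map V (code x0) (\<lambda>x. act x a), 0) \<in> residuals a"
    using root_in unfolding residuals_def local_map_def by force
  then show ?thesis
    using finite_residuals[OF a] residuals_closed[OF a S] unfolding finite_state_def by blast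
qed

end

section \<open>Disjoint unions of coded actions\<close>

lemma code_map_union:
  assumes pc: "\<And>i. i \<in> I \<Longrightarrow> prefix_code (V i) (c i)" and gl: "inj_on gl I"
  shows "prefix_code (Sigma I V) (\<lambda>(i, x). gl i # c i x)" (is "prefix_code _ ?c")
    and "i \<in> I \<Longrightarrow> code_map (Sigma I V) (\<lambda>(i, x). gl i # c i x) (\<lambda>(i, x). (i, \<pi> i x)) ([gl i] \<frown> \<eta>) =
      [gl i] \<frown> code_map (V i) (c i) (\<pi> i) \<eta>"
    and "s \<notin> gl ` I \<Longrightarrow>
      code_map (Sigma I V) (\<lambda>(i, x). gl i # c i x) (\<lambda>(i, x). (i, \<pi> i x)) ([s] \<frown> \<eta>) = [s] \<frown> \<eta>"
proof -
  show pcU: "prefix_code (Sigma I V) ?c"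
    unfolding prefix_code_def
  proof (clarify, goal_cases)
    case (1 i x j y \<eta> \<zeta>)
    then have "gl i = gl j \<and> c i x \<frown> \<eta> = c j y \<frown> \<zeta>" by (simp add: conc_Cons_eq)
    with 1 gl have "j = i" "c i x \<frown> \<eta> = c i y \<frown> \<zeta>" by (auto dest: inj_onD)
    with 1 pc show ?case using prefix_codeD by metis
  qed
  show "code_map (Sigma I V) ?c (\<lambda>(i, x). (i, \<pi> i x)) ([gl i] \<frown> \<eta>) =
      [gl i] \<frown> code_map (V i) (c i) (\<pi> i) \<eta>" if i: "i \<in> I"
  proof (cases "\<exists>x \<in> V i. \<exists>\<zeta>. \<eta> = c i x \<frown> \<zeta>")
    case True
    then obtain x \<zeta> where x: "x \<in> V i" "\<eta> = c i x \<frown> \<zeta>" by blast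
    have "[gl i] \<frown> \<eta> = ?c (i, x) \<frown> \<zeta>" by (simp add: x(2))
    then have "code_map (Sigma I V) ?c (\<lambda>(i, x). (i, \<pi> i x)) ([gl i] \<frown> \<eta>) = ?c (i, \<pi> i x) \<frown> \<zeta>"
      using code_map_code[OF pcU, of "(i, x)"] i x(1) by simp
    then show ?thesis using code_map_code[OF pc[OF i] x(1), of "\<pi> i" \<zeta>] x(2) by simp
  next
    case False
    have "[gl i] \<frown> \<eta> \<noteq> ?c y \<frown> \<zeta>" if y: "y \<in> Sigma I V" for y \<zeta>
    proof
      assume eq: "[gl i] \<frown> \<eta> = ?c y \<frown> \<zeta>"
      obtain j x where j: "y = (j, x)" "j \<in> I" "x \<in> V j" using y by blast
      have "gl i = gl j \<and> [] \<frown> \<eta> = c j x \<frown> \<zeta>"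
        using eq unfolding j(1) prod.case conc_Cons_eq .
      with i j gl False show False by (auto dest: inj_onD)
    qed
    then show ?thesis
      using code_map_other[of "Sigma I V" "[gl i] \<frown> \<eta>" ?c "\<lambda>(i, x). (i, \<pi> i x)"]
        code_map_other[of "V i" \<eta> "c i" "\<pi> i"] False by simp
  qed
  show "code_map (Sigma I V) ?c (\<lambda>(i, x). (i, \<pi> i x)) ([s] \<frown> \<eta>) = [s] \<frown> \<eta>" if s: "s \<notin> gl ` I"
  proof (rule code_map_other)
    fix y \<zeta> assume "y \<in> Sigma I V"
    then obtain j x where "y = (j, x)" "j \<in> I" by blast
    with s show "[s] \<frown> \<eta> \<noteq> ?c y \<frown> \<zeta>" unfolding prod.case conc_Cons_eq by (auto simp: conc_Cons_eq simp del: conc_empty)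
  qed
qed

text \<open>
  The transducer reads the index of the component and continues with the transducer of that component.
\<close>

lemma finite_state_union:
  assumes I: "finite I" and pc: "\<And>i. i \<in> I \<Longrightarrow> prefix_code (V i) (c i)"
    and gl: "inj_on gl I" "gl ` I \<subseteq> S"
    and fs: "\<And>i. i \<in> I \<Longrightarrow> finite_state S (code_map (V i) (c i) (\<pi> i))"
  shows "finite_state S (code_map (Sigma I V) (\<lambda>(i, x). gl i # c i x) (\<lambda>(i, x). (i, \<pi> i x)))"
proof -
  let ?f = "\<lambda>i. code_map (V i) (c i) (\<pi> i)"
  let ?\<Phi> = "code_map (Sigma I V) (\<lambda>(i, x). gl i # c i x) (\<lambda>(i, x). (i, \<pi> i x))"
  from fs obtain F d where F: "\<And>i. i \<in> I \<Longrightarrow> finite (F i)" "\<And>i. i \<in> I \<Longrightarrow> (?f i, d i) \<in> F i"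
    "\<And>i. i \<in> I \<Longrightarrow> residual_closed S (F i)"
    unfolding finite_state_def by metis
  define G where "G = insert (?\<Phi>, 0) (insert (id, 0) (\<Union>i \<in> I. F i))"
  have step: "\<exists>u h e. u \<in> lists S \<and> (h, e) \<in> G \<and>
      (\<forall>\<eta> \<in> infinite_words S. ?\<Phi> ([s] \<frown> \<eta>) = u \<frown> h \<eta> \<and> h \<eta> \<in> infinite_words S) \<and> Suc 0 \<le> length u + e"
    if s: "s \<in> S" for s
  proof (cases "s \<in> gl ` I")
    case True
    then obtain i where i: "i \<in> I" "s = gl i" by blast
    then have "(?f i, d i) \<in> G" using F(2) unfolding G_def by blast
    moreover have "?\<Phi> ([s] \<frown> \<eta>) = [s] \<frown> ?f i \<eta>" for \<eta>
      unfolding i(2) by (rule code_map_union(2)[OF pc gl(1) i(1)])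
    moreover have "?f i \<eta> \<in> infinite_words S" if "\<eta> \<in> infinite_words S" for \<eta>
      by (rule finite_state_maps_into[OF fs[OF i(1)] that])
    ultimately show ?thesis
      using s by (intro exI[of _ "[s]"] exI[of _ "?f i"] exI[of _ "d i"]) auto
  next
    case False
    have "?\<Phi> ([s] \<frown> \<eta>) = [s] \<frown> \<eta>" for \<eta> by (rule code_map_union(3)[OF pc gl(1) False])
    then show ?thesis
      using s unfolding G_def by (intro exI[of _ "[s]"] exI[of _ id] exI[of _ 0]) auto
  qed
  have "(\<forall>\<eta> \<in> infinite_words S. g \<eta> \<in> infinite_words S) \<and>
      (\<forall>s \<in> S. \<exists>u h e. u \<in> lists S \<and> (h, e) \<in> G \<and>
         (\<forall>\<eta> \<in> infinite_words S. g ([s] \<frown> \<eta>) = u \<frown> h \<eta>) \<and> Suc j \<le> length u + e)"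
    if g: "(g, j) \<in> G" for g j
  proof -
    from g consider (top) "g = ?\<Phi>" "j = 0" | (idle) "g = id" "j = 0" | (part) i where "i \<in> I" "(g, j) \<in> F i"
      unfolding G_def by blast
    then show ?thesis
    proof cases
      case top
      have "g \<eta> \<in> infinite_words S" if \<eta>: "\<eta> \<in> infinite_words S" for \<eta>
      proof -
        obtain s \<zeta> where s: "\<eta> = [s] \<frown> \<zeta>" "s \<in> S" "\<zeta> \<in> infinite_words S"
          using infinite_word_ConsE[OF \<eta>] by blast
        then obtain u h where "u \<in> lists S" "g \<eta> = u \<frown> h \<zeta>" "h \<zeta> \<in> infinite_words S"
          using step[OF s(2)] top(1) by blast
        then show ?thesis by simp
      qed
      moreover have "\<exists>u h e. u \<in> lists S \<and> (h, e) \<in> G \<and>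
          (\<forall>\<eta> \<in> infinite_words S. g ([s] \<frown> \<eta>) = u \<frown> h \<eta>) \<and> Suc j \<le> length u + e" if s: "s \<in> S" for s
      proof -
        obtain u h e where "u \<in> lists S" "(h, e) \<in> G" "Suc 0 \<le> length u + e"
          "\<forall>\<eta> \<in> infinite_words S. ?\<Phi> ([s] \<frown> \<eta>) = u \<frown> h \<eta> \<and> h \<eta> \<in> infinite_words S"
          using step[OF s] by blast
        then show ?thesis unfolding top by (intro exI[of _ u] exI[of _ h] exI[of _ e]) simp
      qed
      ultimately show ?thesis by simp
    next
      case idle
      then show ?thesis
        unfolding G_def by (auto intro!: exI[of _ "[_]"] exI[of _ id] exI[of _ 0])
    next
      case part
      have "F i \<subseteq> G" using part(1) unfolding G_def by blast
      then have "\<exists>u h e. u \<in> lists S \<and> (h, e) \<in> G \<and>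
          (\<forall>\<eta> \<in> infinite_words S. g ([s] \<frown> \<eta>) = u \<frown> h \<eta>) \<and> Suc j \<le> length u + e" if "s \<in> S" for s
        using residual_closedD(2)[OF F(3)[OF part(1)] part(2) that] by blast
      then show ?thesis using residual_closedD(1)[OF F(3)[OF part(1)] part(2)] by simp
    qed
  qed
  then have "residual_closed S G" unfolding residual_closed_def by fast
  moreover have "finite G" using I F(1) unfolding G_def by simp
  moreover have "(?\<Phi>, 0) \<in> G" unfolding G_def by simp
  ultimately show ?thesis unfolding finite_state_def by blast
qed

section \<open>The free group of reduced words\<close>

lemma reduced_Nil [simp]: "reduced ainv []"
  by (simp add: reduced_def)

lemma reduced_Cons: "reduced ainv (a # w) \<longleftrightarrow> (w = [] \<or> hd w \<noteq> ainv a) \<and> reduced ainv w"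
  by (cases w) (auto simp: reduced_def)

lemma reduced_push_letter: "reduced ainv w \<Longrightarrow> reduced ainv (push_letter ainv a w)"
  by (cases w) (auto simp: reduced_Cons)

lemma reduced_foldr_push: "reduced ainv t \<Longrightarrow> reduced ainv (foldr (push_letter ainv) w t)"
  by (induction w) (auto simp: reduced_push_letter)

lemma reduced_reduce: "reduced ainv (reduce ainv w)"
  unfolding reduce_def by (simp add: reduced_foldr_push)

lemma push_letter_reduced: "reduced ainv (a # w) \<Longrightarrow> push_letter ainv a w = a # w"
  by (cases w) (auto simp: reduced_Cons)

lemma reduce_reduced: "reduced ainv w \<Longrightarrow> reduce ainv w = w"
  by (induction w) (auto simp: reduce_def push_letter_reduced reduced_Cons)

lemma reduce_append: "reduce ainv (u @ v) = foldr (push_letter ainv) u (reduce ainv v)"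
  by (simp add: reduce_def)

context involutive_alphabet begin

lemma push_letter_in_lists: "a \<in> A \<Longrightarrow> w \<in> lists A \<Longrightarrow> push_letter ainv a w \<in> lists A"
  by (cases w) auto

lemma foldr_push_in_lists: "u \<in> lists A \<Longrightarrow> t \<in> lists A \<Longrightarrow> foldr (push_letter ainv) u t \<in> lists A"
proof (induction u)
  case (Cons a u)
  then show ?case using push_letter_in_lists[of a "foldr (push_letter ainv) u t"] by auto
qed simp

lemma reduce_in_lists: "w \<in> lists A \<Longrightarrow> reduce ainv w \<in> lists A"
  unfolding reduce_def by (rule foldr_push_in_lists) auto

text \<open>
  On reduced words, pushing a letter is a permutation whose inverse pushes the inverse letter. Thus \<open>reduce\<close> is
  the action of a word on the reduced words, applied to the empty word, and associativity follows from this action.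
\<close>

lemma push_letter_inverse:
  assumes "a \<in> A" "reduced ainv w"
  shows "push_letter ainv (ainv a) (push_letter ainv a w) = w"
proof (cases w)
  case Nil
  then show ?thesis using assms by (simp add: ainv_ainv)
next
  case (Cons b v)
  show ?thesis
  proof (cases "b = ainv a")
    case True
    then show ?thesis using assms Cons push_letter_reduced[of ainv "ainv a" v] by simp
  next
    case False
    then show ?thesis using assms Cons by (simp add: ainv_ainv)
  qed
qed

lemma push_letter_inverse':
  "a \<in> A \<Longrightarrow> reduced ainv w \<Longrightarrow> push_letter ainv a (push_letter ainv (ainv a) w) = w"
  using push_letter_inverse[of "ainv a" w] by (simp add: ainv_closed ainv_ainv)

lemma foldr_push_push_letter:
  assumes "a \<in> A" "reduced ainv t"
  shows "foldr (push_letter ainv) (push_letter ainv a s) t =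
    push_letter ainv a (foldr (push_letter ainv) s t)"
proof (cases s)
  case (Cons b s')
  then show ?thesis
    using push_letter_inverse'[OF assms(1) reduced_foldr_push[OF assms(2)]] by auto
qed simp

lemma foldr_push_reduce:
  "u \<in> lists A \<Longrightarrow> reduced ainv t \<Longrightarrow>
    foldr (push_letter ainv) (reduce ainv u) t = foldr (push_letter ainv) u t"
proof (induction u)
  case Nil
  then show ?case by (simp add: reduce_def)
next
  case (Cons a u)
  then have "foldr (push_letter ainv) (push_letter ainv a (reduce ainv u)) t =
      push_letter ainv a (foldr (push_letter ainv) u t)"
    by (subst foldr_push_push_letter) auto
  then show ?case by (simp add: reduce_def)
qed

lemma foldr_push_inverse_word:
  "w \<in> lists A \<Longrightarrow> foldr (push_letter ainv) (rev (map ainv w)) (reduce ainv w) = []"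
proof (induction w)
  case (Cons a w)
  have "reduce ainv (a # w) = push_letter ainv a (reduce ainv w)" by (simp add: reduce_def)
  with Cons show ?case by (simp add: push_letter_inverse reduced_reduce)
qed (simp add: reduce_def)

lemma group_free_group: "group (free_group A ainv)"
proof (rule groupI, goal_cases)
  case (1 x y)
  then show ?case by (auto simp: free_group_def reduced_reduce intro!: reduce_in_lists)
next
  case 2
  then show ?case by (simp add: free_group_def)
next
  case (3 x y z)
  then have "x \<in> lists A" "y \<in> lists A" "z \<in> lists A" "reduced ainv z" by (auto simp: free_group_def)
  then have "reduce ainv (reduce ainv (x @ y) @ z) = reduce ainv (x @ reduce ainv (y @ z))"
    using foldr_push_reduce[of "x @ y" z] reduce_reduced[OF reduced_reduce, of ainv "y @ z"]
    by (simp add: reduce_append reduce_reduced)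
  then show ?case by (simp add: free_group_def)
next
  case (4 x)
  then show ?case by (simp add: free_group_def reduce_reduced)
next
  case (5 x)
  then have x: "x \<in> lists A" "reduced ainv x" by (auto simp: free_group_def)
  let ?y = "rev (map ainv x)"
  have y: "?y \<in> lists A" using x(1) by (auto simp: ainv_closed)
  have "reduce ainv (reduce ainv ?y @ x) = []"
    using foldr_push_reduce[OF y x(2)] foldr_push_inverse_word[OF x(1)] x(2)
    by (simp add: reduce_append reduce_reduced)
  then show ?case
    using y reduce_in_lists[OF y]
    by (intro bexI[of _ "reduce ainv ?y"]) (simp_all add: free_group_def reduced_reduce)
qed

end

section \<open>From coded actions to embeddings into the rational group\<close>

context word_action begin

text \<open>
  The product in \<open>BijGroup\<close> is composition with the right factor applied first, so the right action by \<open>run\<close> is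
  turned into the left action in which \<open>w\<close> acts as its inverse does on the right.
\<close>

definition left_run :: "'a list \<Rightarrow> 'v \<Rightarrow> 'v" where
  "left_run w = foldr (\<lambda>a x. act x (ainv a)) w"

lemma left_run_Nil [simp]: "left_run [] x = x"
  and left_run_Cons [simp]: "left_run (a # w) x = act (left_run w x) (ainv a)"
  and left_run_append: "left_run (u @ v) x = left_run u (left_run v x)"
  by (simp_all add: left_run_def)

lemma left_run_in: "w \<in> lists A \<Longrightarrow> x \<in> V \<Longrightarrow> left_run w x \<in> V"
  by (induction w) (auto intro: act_in ainv_closed)

lemma act_ainv': "v \<in> V \<Longrightarrow> a \<in> A \<Longrightarrow> act (act v (ainv a)) a = v"
  using act_ainv[of v "ainv a"] by (simp add: ainv_closed ainv_ainv)

lemma left_run_run: "w \<in> lists A \<Longrightarrow> x \<in> V \<Longrightarrow> left_run w (x \<triangleright> w) = x"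
proof (induction w arbitrary: x)
  case (Cons a w)
  then show ?case using Cons.IH[of "act x a"] by (simp add: act_in act_ainv)
qed simp

lemma run_left_run: "w \<in> lists A \<Longrightarrow> x \<in> V \<Longrightarrow> left_run w x \<triangleright> w = x"
proof (induction w arbitrary: x)
  case (Cons a w)
  then have "act (act (left_run w x) (ainv a)) a = left_run w x"
    by (intro act_ainv' left_run_in) auto
  with Cons show ?case by simp
qed simp

lemma left_run_trivial_iff:
  assumes "w \<in> lists A"
  shows "(\<forall>x \<in> V. left_run w x = x) \<longleftrightarrow> (\<forall>x \<in> V. x \<triangleright> w = x)"
  using left_run_run[OF assms] run_left_run[OF assms] by metis

lemma left_run_push_letter:
  assumes "a \<in> A" "w \<in> lists A" "x \<in> V"
  shows "left_run (push_letter ainv a w) x = left_run (a # w) x"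
proof (cases w)
  case (Cons b v)
  have "act (act (left_run v x) (ainv (ainv a))) (ainv a) = left_run v x"
    using assms Cons act_ainv[of "left_run v x" a] left_run_in[of v x] by (simp add: ainv_ainv)
  with Cons show ?thesis by simp
qed simp

lemma left_run_reduce: "w \<in> lists A \<Longrightarrow> x \<in> V \<Longrightarrow> left_run (reduce ainv w) x = left_run w x"
proof (induction w)
  case (Cons a w)
  then show ?case using left_run_push_letter[of a "reduce ainv w" x] reduce_in_lists[of w]
    by (simp add: reduce_def)
qed (simp add: reduce_def)

text \<open>
  The homomorphism \<open>H\<close> of the free group into the bijections of the Cantor space sends \<open>w\<close> to the code map of its permutation
  of \<open>V\<close>. Its kernel consists of the words that act trivially, because codes determine vertices; hence the factor
  group embeds. The image of a word is a composition of images of letters, therefore finite-state, and so is its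
  inverse.
\<close>

theorem mon_into_rational_group:
  fixes c :: "'v \<Rightarrow> 's list"
  assumes pc: "prefix_code V c" and c: "\<And>x. x \<in> V \<Longrightarrow> c x \<in> lists S" and S: "S \<noteq> {}"
    and fs: "\<And>a. a \<in> A \<Longrightarrow> finite_state S (code_map V c (\<lambda>x. act x a))"
  defines "K \<equiv> {w \<in> lists A. reduced ainv w \<and> (\<forall>x \<in> V. x \<triangleright> w = x)}"
  shows "group (free_group A ainv Mod K) \<and> (\<exists>h. h \<in> mon (free_group A ainv Mod K) (rational_group S))"
proof -
  let ?G = "free_group A ainv" and ?W = "infinite_words S"
  define \<Phi> where "\<Phi> w = code_map V c (left_run w)" for w
  define H where "H w = restrict (\<Phi> w) ?W" for w
  have \<Phi>_append: "\<Phi> (u @ v) = \<Phi> u \<circ> \<Phi> v" if "v \<in> lists A" for u v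
  proof -
    have "left_run (u @ v) = left_run u \<circ> left_run v" by (simp add: left_run_append fun_eq_iff)
    then show ?thesis
      unfolding \<Phi>_def using code_map_comp[OF pc, of "left_run v" "left_run u"] left_run_in[OF that] by simp
  qed
  have \<Phi>_cong: "\<Phi> u = \<Phi> v" if eq: "\<And>x. x \<in> V \<Longrightarrow> left_run u x = left_run v x" for u v
  proof
    fix \<eta>
    show "\<Phi> u \<eta> = \<Phi> v \<eta>"
    proof (cases "\<exists>x \<in> V. \<exists>\<zeta>. \<eta> = c x \<frown> \<zeta>")
      case True
      then show ?thesis using eq unfolding \<Phi>_def by (auto simp: code_map_code[OF pc])
    next
      case False
      then have "\<Phi> w \<eta> = \<eta>" for w unfolding \<Phi>_def by (intro code_map_other) blast
      then show ?thesis by simp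
    qed
  qed
  have \<Phi>_id: "\<Phi> w = id \<longleftrightarrow> (\<forall>x \<in> V. left_run w x = x)" and
    H_one: "H w = (\<lambda>\<eta> \<in> ?W. \<eta>) \<longleftrightarrow> (\<forall>x \<in> V. left_run w x = x)" if w: "w \<in> lists A" for w
  proof -
    obtain s where s: "s \<in> S" using S by blast
    have const: "(\<lambda>_. s) \<in> ?W" using s by (auto simp: infinite_words_def)
    have 1: "left_run w x = x" if H: "H w = (\<lambda>\<eta> \<in> ?W. \<eta>)" and x: "x \<in> V" for x
    proof -
      let ?\<eta> = "c x \<frown> (\<lambda>_. s)"
      have "?\<eta> \<in> ?W" using c[OF x] const by simp
      then have "\<Phi> w ?\<eta> = ?\<eta>" using fun_cong[OF H, of ?\<eta>] unfolding H_def by simp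
      then have "c (left_run w x) \<frown> (\<lambda>_. s) = c x \<frown> (\<lambda>_. s)"
        unfolding \<Phi>_def using code_map_code[OF pc x] by simp
      then show ?thesis by (rule prefix_codeD[OF pc left_run_in[OF w x] x])
    qed
    have 2: "\<Phi> w = id" if "\<forall>x \<in> V. left_run w x = x"
      unfolding \<Phi>_def using that by (intro code_map_id[OF pc]) auto
    have 3: "H w = (\<lambda>\<eta> \<in> ?W. \<eta>)" if "\<Phi> w = id" unfolding H_def that id_def by simp
    show "\<Phi> w = id \<longleftrightarrow> (\<forall>x \<in> V. left_run w x = x)" using 1 2 3 by blast
    show "H w = (\<lambda>\<eta> \<in> ?W. \<eta>) \<longleftrightarrow> (\<forall>x \<in> V. left_run w x = x)" using 1 2 3 by blast
  qed
  have \<Phi>_fs: "finite_state S (\<Phi> w)" if "w \<in> lists A" for w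
    using that
  proof (induction w)
    case Nil
    have id: "\<Phi> [] = id" using \<Phi>_id[of "[]"] by simp
    show ?case unfolding id by (rule finite_state_id)
  next
    case (Cons a w)
    then have a: "a \<in> A" and w: "w \<in> lists A" by auto
    have "left_run [a] = (\<lambda>x. act x (ainv a))" by (simp add: fun_eq_iff)
    then have "\<Phi> [a] = code_map V c (\<lambda>x. act x (ainv a))" unfolding \<Phi>_def by simp
    then have "finite_state S (\<Phi> [a])" using fs[OF ainv_closed[OF a]] by simp
    moreover have "\<Phi> (a # w) = \<Phi> [a] \<circ> \<Phi> w" using \<Phi>_append[OF w, of "[a]"] by (simp only: append.simps)
    ultimately show ?case using finite_state_comp[OF Cons.IH] by metis
  qed
  have \<Phi>_inverse: "\<Phi> (winv w) (\<Phi> w \<eta>) = \<eta>" "\<Phi> w (\<Phi> (winv w) \<eta>) = \<eta>" if w: "w \<in> lists A" for w \<eta>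
  proof -
    have "left_run (winv v) (left_run v x) = x" if "v \<in> lists A" "x \<in> V" for v x
      using that
    proof (induction v)
      case (Cons a v)
      then have "act (act (left_run v x) (ainv a)) (ainv (ainv a)) = left_run v x"
        using act_ainv[of "left_run v x" "ainv a"] left_run_in[of v x] by (simp add: ainv_closed)
      with Cons show ?case by (simp add: winv_def left_run_append)
    qed (simp add: winv_def)
    then have *: "\<Phi> (winv v) \<circ> \<Phi> v = id" if "v \<in> lists A" for v
      using \<Phi>_id[of "winv v @ v"] \<Phi>_append[OF that, of "winv v"] that winv_in[OF that]
      by (simp add: left_run_append)
    show "\<Phi> (winv w) (\<Phi> w \<eta>) = \<eta>" using fun_cong[OF *[OF w], of \<eta>] by simp
    show "\<Phi> w (\<Phi> (winv w) \<eta>) = \<eta>"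
      using fun_cong[OF *[OF winv_in[OF w]], of \<eta>] by (simp add: winv_winv[OF w])
  qed
  have into: "\<Phi> w \<eta> \<in> ?W" if "w \<in> lists A" "\<eta> \<in> ?W" for w \<eta>
    by (rule finite_state_maps_into[OF \<Phi>_fs[OF that(1)] that(2)])
  have H_Bij: "H w \<in> Bij ?W" if w: "w \<in> lists A" for w
  proof -
    have "bij_betw (\<Phi> w) ?W ?W"
      by (rule bij_betwI[of _ _ _ "\<Phi> (winv w)"])
        (use \<Phi>_inverse[OF w] into w winv_in[OF w] in auto)
    then have "bij_betw (H w) ?W ?W" unfolding H_def by simp
    then show ?thesis unfolding Bij_def H_def by simp
  qed
  have H_rational: "H w \<in> carrier (rational_group S)" if w: "w \<in> lists A" for w
  proof -
    have cont: "continuous_map (cantor_space S) (cantor_space S) (H v)" if "v \<in> lists A" for v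
      by (rule continuous_map_eq[OF finite_state_imp_continuous[OF \<Phi>_fs[OF that]]]) (simp add: H_def)
    have "homeomorphic_maps (cantor_space S) (cantor_space S) (H w) (H (winv w))"
      unfolding homeomorphic_maps_def
    proof (intro conjI ballI)
      show "continuous_map (cantor_space S) (cantor_space S) (H w)"
        "continuous_map (cantor_space S) (cantor_space S) (H (winv w))"
        by (rule cont[OF w], rule cont[OF winv_in[OF w]])
    next
      fix \<eta> assume "\<eta> \<in> topspace (cantor_space S)"
      then show "H (winv w) (H w \<eta>) = \<eta>" "H w (H (winv w) \<eta>) = \<eta>"
        using into[OF w] into[OF winv_in[OF w]] \<Phi>_inverse[OF w] unfolding H_def by simp_all
    qed
    then have "homeomorphic_map (cantor_space S) (cantor_space S) (H w)"
      using homeomorphic_map_maps by blast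
    moreover have "rational_map S (H w)"
      unfolding H_def by (rule finite_state_imp_rational_map[OF finite_state_cong[OF \<Phi>_fs[OF w]]]) simp
    ultimately show ?thesis
      using H_Bij[OF w] by (simp add: rational_group_def rational_homeos_def)
  qed
  have H_mult: "H (reduce ainv (u @ v)) = compose ?W (H u) (H v)" if "u \<in> lists A" "v \<in> lists A" for u v
  proof -
    have uv: "u @ v \<in> lists A" using that by simp
    have "\<Phi> (reduce ainv (u @ v)) = \<Phi> (u @ v)" by (rule \<Phi>_cong[OF left_run_reduce[OF uv]])
    also have "\<dots> = \<Phi> u \<circ> \<Phi> v" by (rule \<Phi>_append[OF that(2)])
    finally have "\<Phi> (reduce ainv (u @ v)) = \<Phi> u \<circ> \<Phi> v" .
    then show ?thesis
      unfolding H_def compose_def using into[OF that(2)] by (auto simp: fun_eq_iff)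
  qed
  have hom: "H \<in> hom ?G (BijGroup ?W)"
  proof (rule homI)
    show "H x \<in> carrier (BijGroup ?W)" if "x \<in> carrier ?G" for x
      using that H_Bij by (simp add: free_group_def BijGroup_def)
    show "H (x \<otimes>\<^bsub>?G\<^esub> y) = H x \<otimes>\<^bsub>BijGroup ?W\<^esub> H y" if "x \<in> carrier ?G" "y \<in> carrier ?G" for x y
      using that H_Bij[of x] H_Bij[of y] H_mult[of x y] by (simp add: free_group_def BijGroup_def)
  qed
  interpret H: group_hom ?G "BijGroup ?W" H
    by (rule group_hom.intro[OF group_free_group group_BijGroup]) (simp add: group_hom_axioms_def hom)
  have ker: "kernel ?G (BijGroup ?W) H = K"
    using H_one left_run_trivial_iff unfolding kernel_def K_def by (auto simp: free_group_def BijGroup_def)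
  let ?h = "\<lambda>X. the_elem (H ` X)"
  have "normal K ?G" using H.normal_kernel unfolding ker .
  then have "group (?G Mod K)" by (rule normal.factorgroup_is_group)
  moreover have "?h \<in> mon (?G Mod K) (rational_group S)"
  proof -
    have into_R: "?h X \<in> carrier (rational_group S)" if X: "X \<in> carrier (?G Mod K)" for X
    proof -
      obtain g where g: "g \<in> carrier ?G" "X = kernel ?G (BijGroup ?W) H #>\<^bsub>?G\<^esub> g"
        using X unfolding ker carrier_FactGroup by blast
      have "H ` X = {H g}"
      proof -
        have "H x = H g" if "x \<in> X" for x
          using that g H.hom_closed unfolding g(2) r_coset_def kernel_def by auto
        moreover have "X \<noteq> {}" using H.FactGroup_nonempty X unfolding ker by blast
        ultimately show ?thesis by auto
      qed
      moreover have "g \<in> lists A" using g(1) by (simp add: free_group_def)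
      ultimately show ?thesis using H_rational by simp
    qed
    have "?h \<in> hom (?G Mod K) (BijGroup ?W)" using H.FactGroup_hom unfolding ker .
    then have "?h \<in> hom (?G Mod K) (rational_group S)"
      using into_R unfolding hom_def by (auto simp: rational_group_def)
    moreover have "inj_on ?h (carrier (?G Mod K))" using H.FactGroup_inj_on unfolding ker .
    ultimately show ?thesis unfolding mon_def by blast
  qed
  ultimately show ?thesis by blast
qed

end

section \<open>Complete labelled graphs as actions\<close>

definition follow :: "('v, 'e, 'a) labelled_graph \<Rightarrow> 'v \<Rightarrow> 'a \<Rightarrow> 'v" where
  "follow \<Gamma> v a = head (skeleton \<Gamma>)
     (THE e. e \<in> arcs (skeleton \<Gamma>) \<and> tail (skeleton \<Gamma>) e = v \<and> label \<Gamma> e = a)"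

context complete_A_graph begin

abbreviation "vs \<equiv> verts (skeleton \<Gamma>)"

lemma follow_arc:
  assumes "e \<in> arcs (skeleton \<Gamma>)"
  shows "follow \<Gamma> (tail (skeleton \<Gamma>) e) (label \<Gamma> e) = head (skeleton \<Gamma>) e"
proof -
  have "(THE f. f \<in> arcs (skeleton \<Gamma>) \<and> tail (skeleton \<Gamma>) f = tail (skeleton \<Gamma>) e \<and> label \<Gamma> f = label \<Gamma> e) = e"
    using assms deterministic by (intro the_equality) auto
  then show ?thesis unfolding follow_def by simp
qed

lemma word_action_follow: "word_action A ainv vs (follow \<Gamma>)"
proof unfold_locales
  fix v a assume v: "v \<in> vs" and a: "a \<in> A"
  obtain e where e: "e \<in> arcs (skeleton \<Gamma>)" "tail (skeleton \<Gamma>) e = v" "label \<Gamma> e = a"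
    using complete[OF v a] by blast
  then have f: "follow \<Gamma> v a = head (skeleton \<Gamma>) e" using follow_arc[OF e(1)] by simp
  then show "follow \<Gamma> v a \<in> vs" using e(1) by simp
  have "follow \<Gamma> (head (skeleton \<Gamma>) e) (ainv a) = v"
    using follow_arc[of "edge_inv \<Gamma> e"] e label_edge_inv[OF e(1)] by simp
  then show "follow \<Gamma> (follow \<Gamma> v a) (ainv a) = v" using f by simp
qed

lemma awalk_iff_follow:
  assumes "v \<in> vs"
  shows "(\<exists>p. awalk v p u \<and> map (label \<Gamma>) p = w) \<longleftrightarrow> w \<in> lists A \<and> foldl (follow \<Gamma>) v w = u"
  using assms
proof (induction w arbitrary: v)
  case Nil
  then show ?case by (auto simp: awalk_Nil_iff)
next
  case (Cons a w)
  show ?case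
  proof
    assume "\<exists>p. awalk v p u \<and> map (label \<Gamma>) p = a # w"
    then obtain e p where e: "e \<in> arcs (skeleton \<Gamma>)" "v = tail (skeleton \<Gamma>) e" "label \<Gamma> e = a"
      and p: "awalk (head (skeleton \<Gamma>) e) p u" "map (label \<Gamma>) p = w"
      by (auto simp: awalk_Cons_iff map_eq_Cons_conv)
    have "head (skeleton \<Gamma>) e \<in> vs" using e(1) by simp
    with p have "w \<in> lists A \<and> foldl (follow \<Gamma>) (head (skeleton \<Gamma>) e) w = u"
      using Cons.IH by blast
    then show "a # w \<in> lists A \<and> foldl (follow \<Gamma>) v (a # w) = u"
      using e follow_arc[OF e(1)] label_in[OF e(1)] by simp
  next
    assume w: "a # w \<in> lists A \<and> foldl (follow \<Gamma>) v (a # w) = u"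
    obtain e where e: "e \<in> arcs (skeleton \<Gamma>)" "tail (skeleton \<Gamma>) e = v" "label \<Gamma> e = a"
      using complete[OF Cons.prems, of a] w by auto
    have "follow \<Gamma> v a = head (skeleton \<Gamma>) e" using follow_arc[OF e(1)] e by simp
    moreover have "head (skeleton \<Gamma>) e \<in> vs" using e(1) by simp
    ultimately obtain p where "awalk (head (skeleton \<Gamma>) e) p u" "map (label \<Gamma>) p = w"
      using Cons.IH[of "head (skeleton \<Gamma>) e"] w by auto
    then show "\<exists>p. awalk v p u \<and> map (label \<Gamma>) p = a # w"
      using e by (intro exI[of _ "e # p"]) (auto simp: awalk_Cons_iff)
  qed
qed

lemma circuit_language_follow:
  assumes "v \<in> vs"
  shows "circuit_language \<Gamma> v = {w \<in> lists A. foldl (follow \<Gamma>) v w = v}"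
  unfolding circuit_language_def using awalk_iff_follow[OF assms, of v]
  by (intro Set.set_eqI) (simp add: eq_commute conj_commute)

lemma rooted_action_follow:
  assumes "x0 \<in> vs"
  shows "rooted_action A ainv vs (follow \<Gamma>) x0"
proof -
  interpret word_action A ainv vs "follow \<Gamma>" by (rule word_action_follow)
  have sc: "strongly_connected (skeleton \<Gamma>)"
    by (rule symmetric_connected_imp_strongly_connected[OF sym_arcs connected_skeleton])
  show ?thesis
  proof unfold_locales
    show "x0 \<in> vs" by (rule assms)
    fix v assume "v \<in> vs"
    then have "x0 \<rightarrow>\<^sup>*\<^bsub>skeleton \<Gamma>\<^esub> v" using sc assms by (auto simp: strongly_connected_def)
    then obtain p where "awalk x0 p v" unfolding reachable_awalk by blast
    then show "\<exists>w \<in> lists A. foldl (follow \<Gamma>) x0 w = v" using awalk_iff_follow[OF assms] by blast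
  qed
qed

lemma finite_cone_types_follow:
  assumes "context_free_graph \<Gamma>"
  shows "\<exists>x0 \<in> vs. rooted_action A ainv vs (follow \<Gamma>) x0 \<and>
    finite (rooted_action.cone_type A (follow \<Gamma>) x0 ` vs)"
proof -
  obtain x0 P S where x0: "x0 \<in> vs" and P: "finite (P :: (nat \<times> (nat, 'a) symbol list) set)"
    "circuit_language \<Gamma> x0 = grammar_language P S"
    using assms unfolding context_free_graph_def context_free_language_def by blast
  interpret rooted_action A ainv vs "follow \<Gamma>" x0 by (rule rooted_action_follow[OF x0])
  interpret context_free_action A ainv vs "follow \<Gamma>" x0 P S
    by unfold_locales (use P circuit_language_follow[OF x0] in auto)
  show ?thesis using x0 finite_cone_types rooted_action_axioms by blast
qed

end

text \<open>
  All graphs use the same letters \<open>cl\<close> and \<open>fl\<close>; the index of the graph is put in front of a code by a further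
  letter \<open>gl i\<close>. The three kinds of letters are told apart by their residues modulo three.
\<close>

theorem theorem7p7:
  fixes A :: "'a set" and ainv :: "'a \<Rightarrow> 'a"
    and k :: nat and \<Gamma> :: "nat \<Rightarrow> ('v, 'e, 'a) labelled_graph"
  assumes "involutive_alphabet A ainv"
    and "\<And>i. i \<in> {1..k} \<Longrightarrow> complete_A_graph A ainv (\<Gamma> i)"
    and "\<And>i. i \<in> {1..k} \<Longrightarrow> context_free_graph (\<Gamma> i)"
  shows "is_rational_group (transition_group A ainv {1..k} \<Gamma>)"
proof -
  interpret involutive_alphabet A ainv by (rule assms(1))
  let ?I = "{1..k}" and ?V = "\<lambda>i. verts (skeleton (\<Gamma> i))"
  have "\<forall>i \<in> ?I. \<exists>x0. x0 \<in> ?V i \<and> rooted_action A ainv (?V i) (follow (\<Gamma> i)) x0 \<and>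
      finite (rooted_action.cone_type A (follow (\<Gamma> i)) x0 ` ?V i)"
    using complete_A_graph.finite_cone_types_follow[OF assms(2,3)] by blast
  then obtain x0 where x0: "\<And>i. i \<in> ?I \<Longrightarrow> rooted_action A ainv (?V i) (follow (\<Gamma> i)) (x0 i)"
    "\<And>i. i \<in> ?I \<Longrightarrow> finite (rooted_action.cone_type A (follow (\<Gamma> i)) (x0 i) ` ?V i)"
    by metis
  define num where "num = to_nat_on (lists A)"
  have num: "inj_on num (lists A)"
    unfolding num_def by (intro inj_on_to_nat_on countable_lists countable_finite finite_alphabet)
  define cl fl gl where "cl w = 3 * num w" and "fl w = 3 * num w + 1" and "gl i = 3 * i + 2"
    for w :: "'a list" and i :: nat
  have coded: "coded_action A ainv (?V i) (follow (\<Gamma> i)) (x0 i) cl fl" if i: "i \<in> ?I" for i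
  proof (rule coded_action.intro[OF x0(1)[OF i]], unfold_locales)
    show "finite (rooted_action.cone_type A (follow (\<Gamma> i)) (x0 i) ` ?V i)" by (rule x0(2)[OF i])
    show "inj_on cl (lists A)" "inj_on fl (lists A)"
      using num by (auto simp: cl_def fl_def inj_on_def)
    show "cl u \<noteq> fl v" for u v unfolding cl_def fl_def by presburger
  qed
  let ?code = "\<lambda>i. coded_action.code A (follow (\<Gamma> i)) (x0 i) cl fl (x0 i)"
  let ?letters = "\<lambda>i. coded_action.code_letters A (?V i) (follow (\<Gamma> i)) (x0 i) cl fl"
  define S where "S = (\<Union>i \<in> ?I. ?letters i) \<union> gl ` {0..k + 1}"
  have letters: "?letters i \<subseteq> S" if "i \<in> ?I" for i using that unfolding S_def by blast
  have finS: "finite S"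
    unfolding S_def using coded_action.finite_code_letters[OF coded] by blast
  \<comment> \<open>the two letters below exist for every \<open>k\<close>, even when there are no graphs\<close>
  have "card S \<ge> 2"
  proof -
    have "{gl 0, gl 1} \<subseteq> S" unfolding S_def by auto
    from card_mono[OF finS this] show ?thesis by (simp add: gl_def)
  qed
  let ?U = "Sigma ?I ?V" and ?act = "\<lambda>(i, x) a. (i, follow (\<Gamma> i) x a)"
  let ?c = "\<lambda>(i, x). gl i # ?code i x"
  interpret U: word_action A ainv ?U ?act
  proof unfold_locales
    fix v a assume v: "v \<in> ?U" and a: "a \<in> A"
    then obtain i x where ix: "v = (i, x)" "i \<in> ?I" "x \<in> ?V i" by blast
    interpret word_action A ainv "?V i" "follow (\<Gamma> i)"
      by (rule complete_A_graph.word_action_follow[OF assms(2)[OF ix(2)]])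
    show "?act v a \<in> ?U" using ix act_in[OF ix(3) a] by simp
    show "?act (?act v a) (ainv a) = v" using ix act_ainv[OF ix(3) a] by simp
  qed
  have run: "foldl ?act (i, x) w = (i, foldl (follow (\<Gamma> i)) x w)" for i x w
    by (induction w arbitrary: x) auto
  have gl: "inj_on gl ?I" "gl ` ?I \<subseteq> S" by (auto simp: gl_def inj_on_def S_def)
  have cone: "rooted_action.cone A (follow (\<Gamma> i)) (x0 i) (x0 i) = ?V i" if "i \<in> ?I" for i
    by (rule rooted_action.cone_root[OF x0(1)[OF that]])
  have x0V: "x0 i \<in> ?V i" if "i \<in> ?I" for i by (rule rooted_action.root_in[OF x0(1)[OF that]])
  have pc: "prefix_code (?V i) (?code i)" if "i \<in> ?I" for i
    using coded_action.prefix_code_cone[OF coded[OF that] x0V[OF that]] unfolding cone[OF that] .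
  have inS: "?c v \<in> lists S" if v: "v \<in> ?U" for v
  proof -
    obtain i x where ix: "v = (i, x)" "i \<in> ?I" "x \<in> ?V i" using v by blast
    have "?code i x \<in> lists (?letters i)"
      using coded_action.code_in_lists[OF coded[OF ix(2)] x0V[OF ix(2)]] ix(3) unfolding cone[OF ix(2)] .
    then show ?thesis using ix gl(2) lists_mono[OF letters[OF ix(2)]] by auto
  qed
  have fs: "finite_state S (code_map ?U ?c (\<lambda>v. ?act v a))" if a: "a \<in> A" for a
  proof -
    have "finite_state S (code_map ?U ?c (\<lambda>(i, x). (i, follow (\<Gamma> i) x a)))"
      by (rule finite_state_union[OF _ pc gl coded_action.letter_finite_state[OF coded a letters]]) auto
    then show ?thesis by (simp add: case_prod_beta')
  qed
  let ?K = "{w \<in> lists A. reduced ainv w \<and> (\<forall>v \<in> ?U. foldl ?act v w = v)}"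
  have K: "circuit_subgroup A ainv ?I \<Gamma> = ?K"
  proof -
    have trivial: "(\<forall>i \<in> ?I. \<forall>p \<in> ?V i. w \<in> circuit_language (\<Gamma> i) p) \<longleftrightarrow> (\<forall>v \<in> ?U. foldl ?act v w = v)"
      if "w \<in> lists A" for w
      using that complete_A_graph.circuit_language_follow[OF assms(2)] by (auto simp: run)
    have reduce_trivial: "(\<forall>v \<in> ?U. foldl ?act v (reduce ainv w) = v) \<longleftrightarrow> (\<forall>v \<in> ?U. foldl ?act v w = v)"
      if "w \<in> lists A" for w
      using U.left_run_trivial_iff[OF that] U.left_run_trivial_iff[OF reduce_in_lists[OF that]]
        U.left_run_reduce[OF that] by simp
    show ?thesis
    proof
      show "circuit_subgroup A ainv ?I \<Gamma> \<subseteq> ?K"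
        unfolding circuit_subgroup_def
      proof (rule image_subsetI)
        fix w assume "w \<in> {w \<in> lists A. \<forall>i \<in> ?I. \<forall>p \<in> ?V i. w \<in> circuit_language (\<Gamma> i) p}"
        then have w: "w \<in> lists A" "\<forall>i \<in> ?I. \<forall>p \<in> ?V i. w \<in> circuit_language (\<Gamma> i) p" by simp_all
        have "\<forall>v \<in> ?U. foldl ?act v (reduce ainv w) = v"
          unfolding reduce_trivial[OF w(1)] using w(2) unfolding trivial[OF w(1)] .
        then show "reduce ainv w \<in> ?K" using reduce_in_lists[OF w(1)] reduced_reduce by simp
      qed
      show "?K \<subseteq> circuit_subgroup A ainv ?I \<Gamma>"
      proof
        fix w assume w: "w \<in> ?K"
        then have "w = reduce ainv w" by (simp add: reduce_reduced)
        moreover have "w \<in> lists A" using w by simp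
        then have "w \<in> {w \<in> lists A. \<forall>i \<in> ?I. \<forall>p \<in> ?V i. w \<in> circuit_language (\<Gamma> i) p}"
          using w unfolding mem_Collect_eq trivial[OF \<open>w \<in> lists A\<close>] by simp
        ultimately show "w \<in> circuit_subgroup A ainv ?I \<Gamma>" unfolding circuit_subgroup_def by blast
      qed
    qed
  qed
  have "S \<noteq> {}" using \<open>card S \<ge> 2\<close> by auto
  from U.mon_into_rational_group[OF code_map_union(1)[OF pc gl(1)] inS this fs]
  show ?thesis
    unfolding is_rational_group_def transition_group_def K using finS \<open>card S \<ge> 2\<close> by blast
qed

end
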